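(* Let $\mathsf{C}$ be a cocomplete category (locally small, admitting all small colimits), and let $P,Q\in\mathsf{P}\mathsf{C}$ be small presheaves on $\mathsf{C}$. The following conditions are equivalent. (1) There exist a small diagram $D:\mathsf{J}\to\mathsf{C}$ such that $\mathrm{Im}\,D\cong P$, and a small category $\mathsf{K}$ with a functor $F:\mathsf{J}\to\mathsf{K}$, such that $\mathrm{Im}(\mathrm{Lan}_F D)\cong Q$, where $\mathrm{Lan}_F D:\mathsf{K}\to\mathsf{C}$ is the left Kan extension of $D$ along $F$. (2) There exists a partial evaluation from $P$ to $Q$ for the monad $\mathsf{P}$, i.e. an object $\Phi\in\mathsf{P}\mathsf{P}\mathsf{C}$ such that $\mu(\Phi)\cong P$ and $e_\sharp(\Phi)\cong Q$.
   Context: All categories are locally small. A small diagram in $\mathsf{C}$ is a functor $D:\mathsf{J}\to\mathsf{C}$ with $\mathsf{J}$ small. Its image presheaf is $\mathrm{Im}\,D=\mathrm{colim}_{J\in\mathsf{J}}\mathrm{Hom}_{\mathsf{C}}(-,DJ):\mathsf{C}^{\mathrm{op}}\to\mathsf{Set}$ (the colimit of $D$ followed by the Yoneda embedding). A presheaf on $\mathsf{C}$ is small if it is naturally isomorphic to $\mathrm{Im}\,D$ for some small diagram $D$ (equivalently, it is a small colimit of representables). $\mathsf{P}\mathsf{C}$ is the full subcategory of $[\mathsf{C}^{\mathrm{op}},\mathsf{Set}]$ on small presheaves; it is again locally small, so $\mathsf{P}\mathsf{P}\mathsf{C}$ makes sense. For a functor $F:\mathsf{C}\to\mathsf{D}$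 between locally small categories, $F_\sharp:\mathsf{P}\mathsf{C}\to\mathsf{P}\mathsf{D}$ sends $P$ to the pointwise left Kan extension of $P$ along $F^{\mathrm{op}}$, i.e. $F_\sharp P(X)\cong\int^{C\in\mathsf{C}}P(C)\times\mathrm{Hom}_{\mathsf{D}}(X,FC)$ (it is again small). The functor $\mu:\mathsf{P}\mathsf{P}\mathsf{C}\to\mathsf{P}\mathsf{C}$ is defined up to isomorphism by $\mu(\Phi)(C)=\int^{P\in\mathsf{P}\mathsf{C}}\Phi(P)\times P(C)$. For $\mathsf{C}$ cocomplete, $e:\mathsf{P}\mathsf{C}\to\mathsf{C}$ is a choice of weighted colimits $e(P)\cong\int^{X\in\mathsf{C}}P(X)\otimes X$, where $\otimes$ denotes the copower ($S\otimes X$ is the coproduct of $S$ copies of $X$); if $P\cong \mathrm{Im}\,D$ then $e(P)\cong\mathrm{colim}\,D$. $e_\sharp:\mathsf{P}\mathsf{P}\mathsf{C}\to\mathsf{P}\mathsf{C}$ is the functor obtained by applying the construction $(-)_\sharp$ to $e$. *)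

theory Defs
  imports Main "HOL-Library.FuncSet"
begin

unbundle cardinal_syntax

section \<open>Smallness\<close>

text \<open>
  Size is measured against a cardinal \<open>\<kappa>\<close>, given by a cardinal well-order on a part of a type
  \<open>'k\<close>: a set of any type is small if it has fewer than \<open>\<kappa>\<close> elements. The cardinal has the closure
  properties of the cardinality of a Grothendieck universe (regular strong limit). Uncountability is
  not required, so strongly inaccessible cardinals are covered, and also \<open>natLeq\<close>, for which
  ``small'' means ``finite''.

  Every small set is in bijection with a small subset of \<open>'k\<close>. Small categories are therefore taken,
  up to isomorphism, with objects and arrows in \<open>'k\<close>, and presheaves with values in \<open>'k set\<close>.
\<close>

definition universe_card :: "'k rel \<Rightarrow> bool" where
  "universe_card \<kappa> \<longleftrightarrow>
     Cinfinite \<kappa> \<and> regularCard \<kappa> \<and> (\<forall>A :: 'k set. |A| <o \<kappa> \<longrightarrow> |Pow A| <o \<kappa>)"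

definition small :: "'k rel \<Rightarrow> 'a set \<Rightarrow> bool" where
  "small \<kappa> A \<longleftrightarrow> |A| <o \<kappa>"


section \<open>Categories and functors\<close>

record ('o, 'a) cat =
  Obj :: "'o set"
  Arr :: "'a set"
  Dom :: "'a \<Rightarrow> 'o"
  Cod :: "'a \<Rightarrow> 'o"
  Ide :: "'o \<Rightarrow> 'a"
  Comp :: "'a \<Rightarrow> 'a \<Rightarrow> 'a"  \<comment> \<open>\<open>Comp C g f\<close> is \<open>g\<close> after \<open>f\<close>\<close>

definition hom :: "('o, 'a) cat \<Rightarrow> 'o \<Rightarrow> 'o \<Rightarrow> 'a set" where
  "hom C X Y = {f \<in> Arr C. Dom C f = X \<and> Cod C f = Y}"

locale category =
  fixes C :: "('o, 'a) cat"
  assumes Dom_in: "f \<in> Arr C \<Longrightarrow> Dom C f \<in> Obj C"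
    and Cod_in: "f \<in> Arr C \<Longrightarrow> Cod C f \<in> Obj C"
    and Ide_in: "X \<in> Obj C \<Longrightarrow> Ide C X \<in> hom C X X"
    and Comp_in: "\<lbrakk>f \<in> hom C X Y; g \<in> hom C Y Z\<rbrakk> \<Longrightarrow> Comp C g f \<in> hom C X Z"
    and Comp_Ide: "f \<in> hom C X Y \<Longrightarrow> Comp C f (Ide C X) = f"
    and Ide_Comp: "f \<in> hom C X Y \<Longrightarrow> Comp C (Ide C Y) f = f"
    and Comp_assoc: "\<lbrakk>f \<in> hom C W X; g \<in> hom C X Y; h \<in> hom C Y Z\<rbrakk>
          \<Longrightarrow> Comp C h (Comp C g f) = Comp C (Comp C h g) f"

definition locally_small :: "'k rel \<Rightarrow> ('o, 'a) cat \<Rightarrow> bool" where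
  "locally_small \<kappa> C \<longleftrightarrow> (\<forall>X \<in> Obj C. \<forall>Y \<in> Obj C. small \<kappa> (hom C X Y))"

definition small_category :: "'k rel \<Rightarrow> ('k, 'k) cat \<Rightarrow> bool" where
  "small_category \<kappa> J \<longleftrightarrow> category J \<and> small \<kappa> (Obj J) \<and> small \<kappa> (Arr J)"

record ('o, 'a, 'p, 'b) func =
  FOb :: "'o \<Rightarrow> 'p"
  FAr :: "'a \<Rightarrow> 'b"

definition is_functor :: "('o, 'a) cat \<Rightarrow> ('p, 'b) cat \<Rightarrow> ('o, 'a, 'p, 'b) func \<Rightarrow> bool" where
  "is_functor C D F \<longleftrightarrow>
     (\<forall>X \<in> Obj C. FOb F X \<in> Obj D \<and> FAr F (Ide C X) = Ide D (FOb F X)) \<and>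
     (\<forall>f \<in> Arr C. FAr F f \<in> hom D (FOb F (Dom C f)) (FOb F (Cod C f))) \<and>
     (\<forall>f \<in> Arr C. \<forall>g \<in> Arr C. Cod C f = Dom C g \<longrightarrow>
        FAr F (Comp C g f) = Comp D (FAr F g) (FAr F f))"

definition fcomp :: "('p, 'b, 'q, 'c) func \<Rightarrow> ('o, 'a, 'p, 'b) func \<Rightarrow> ('o, 'a, 'q, 'c) func" where
  "fcomp G F = \<lparr>FOb = FOb G \<circ> FOb F, FAr = FAr G \<circ> FAr F\<rparr>"

definition is_nat_trans ::
  "('o, 'a) cat \<Rightarrow> ('p, 'b) cat \<Rightarrow> ('o, 'a, 'p, 'b) func \<Rightarrow> ('o, 'a, 'p, 'b) func \<Rightarrow> ('o \<Rightarrow> 'b) \<Rightarrow> bool"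
  where
  "is_nat_trans C D F G \<alpha> \<longleftrightarrow>
     \<alpha> \<in> (\<Pi>\<^sub>E X \<in> Obj C. hom D (FOb F X) (FOb G X)) \<and>
     (\<forall>f \<in> Arr C. Comp D (\<alpha> (Cod C f)) (FAr F f) = Comp D (FAr G f) (\<alpha> (Dom C f)))"

definition is_left_kan_ext ::
  "('j, 'i) cat \<Rightarrow> ('l, 'n) cat \<Rightarrow> ('o, 'a) cat \<Rightarrow> ('j, 'i, 'l, 'n) func \<Rightarrow> ('j, 'i, 'o, 'a) func
    \<Rightarrow> ('l, 'n, 'o, 'a) func \<Rightarrow> ('j \<Rightarrow> 'a) \<Rightarrow> bool" where
  "is_left_kan_ext J K C F D L \<eta> \<longleftrightarrow>
     is_functor K C L \<and> is_nat_trans J C D (fcomp L F) \<eta> \<and>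
     (\<forall>G \<gamma>. is_functor K C G \<and> is_nat_trans J C D (fcomp G F) \<gamma> \<longrightarrow>
        (\<exists>!\<delta>. is_nat_trans K C L G \<delta> \<and>
              (\<forall>j \<in> Obj J. Comp C (\<delta> (FOb F j)) (\<eta> j) = \<gamma> j)))"


section \<open>Colimits, copowers and coends in a category\<close>

definition is_cocone ::
  "('j, 'i) cat \<Rightarrow> ('o, 'a) cat \<Rightarrow> ('j, 'i, 'o, 'a) func \<Rightarrow> 'o \<Rightarrow> ('j \<Rightarrow> 'a) \<Rightarrow> bool" where
  "is_cocone J C D c \<iota> \<longleftrightarrow>
     c \<in> Obj C \<and> (\<forall>j \<in> Obj J. \<iota> j \<in> hom C (FOb D j) c) \<and>
     (\<forall>u \<in> Arr J. Comp C (\<iota> (Cod J u)) (FAr D u) = \<iota> (Dom J u))"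

definition is_colimit ::
  "('j, 'i) cat \<Rightarrow> ('o, 'a) cat \<Rightarrow> ('j, 'i, 'o, 'a) func \<Rightarrow> 'o \<Rightarrow> ('j \<Rightarrow> 'a) \<Rightarrow> bool" where
  "is_colimit J C D c \<iota> \<longleftrightarrow>
     is_cocone J C D c \<iota> \<and>
     (\<forall>d \<zeta>. is_cocone J C D d \<zeta> \<longrightarrow>
        (\<exists>!h. h \<in> hom C c d \<and> (\<forall>j \<in> Obj J. Comp C h (\<iota> j) = \<zeta> j)))"

definition cocomplete :: "'k rel \<Rightarrow> ('o, 'a) cat \<Rightarrow> bool" where
  "cocomplete \<kappa> C \<longleftrightarrow>
     (\<forall>(J :: ('k, 'k) cat) D. small_category \<kappa> J \<and> is_functor J C D \<longrightarrow> (\<exists>c \<iota>. is_colimit J C D c \<iota>))"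

definition is_copower :: "('o, 'a) cat \<Rightarrow> 's set \<Rightarrow> 'o \<Rightarrow> 'o \<Rightarrow> ('s \<Rightarrow> 'a) \<Rightarrow> bool" where
  "is_copower C S X c \<iota> \<longleftrightarrow>
     c \<in> Obj C \<and> (\<forall>s \<in> S. \<iota> s \<in> hom C X c) \<and>
     (\<forall>d \<in> Obj C. \<forall>f. (\<forall>s \<in> S. f s \<in> hom C X d) \<longrightarrow>
        (\<exists>!h. h \<in> hom C c d \<and> (\<forall>s \<in> S. Comp C h (\<iota> s) = f s)))"

text \<open>A choice of copower \<open>S \<otimes> X\<close> with its injections, and its action on \<open>\<sigma> : S \<rightarrow> S'\<close>, \<open>f : X \<rightarrow> X'\<close>.\<close>

definition copower :: "('o, 'a) cat \<Rightarrow> 's set \<Rightarrow> 'o \<Rightarrow> 'o \<times> ('s \<Rightarrow> 'a)" where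
  "copower C S X = (SOME (c, \<iota>). is_copower C S X c \<iota>)"

definition copower_map ::
  "('o, 'a) cat \<Rightarrow> 's set \<Rightarrow> 's set \<Rightarrow> ('s \<Rightarrow> 's) \<Rightarrow> 'a \<Rightarrow> 'a" where
  "copower_map C S S' \<sigma> f =
     (let (c, \<iota>) = copower C S (Dom C f); (c', \<iota>') = copower C S' (Cod C f)
      in THE h. h \<in> hom C c c' \<and> (\<forall>s \<in> S. Comp C h (\<iota> s) = Comp C (\<iota>' (\<sigma> s)) f))"

text \<open>
  A bifunctor \<open>T : A\<^sup>o\<^sup>p \<times> A \<rightarrow> C\<close> is given by \<open>T0 X Y\<close> on objects and, for arrows \<open>f\<close>, \<open>g\<close> of \<open>A\<close>, by
  \<open>T1 f g : T0 (Cod f) (Dom g) \<rightarrow> T0 (Dom f) (Cod g)\<close>.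
\<close>

definition is_cowedge ::
  "('x, 'y) cat \<Rightarrow> ('o, 'a) cat \<Rightarrow> ('x \<Rightarrow> 'x \<Rightarrow> 'o) \<Rightarrow> ('y \<Rightarrow> 'y \<Rightarrow> 'a) \<Rightarrow> 'o \<Rightarrow> ('x \<Rightarrow> 'a) \<Rightarrow> bool" where
  "is_cowedge A C T0 T1 c w \<longleftrightarrow>
     c \<in> Obj C \<and> (\<forall>X \<in> Obj A. w X \<in> hom C (T0 X X) c) \<and>
     (\<forall>f \<in> Arr A. Comp C (w (Dom A f)) (T1 f (Ide A (Dom A f))) =
                   Comp C (w (Cod A f)) (T1 (Ide A (Cod A f)) f))"

definition is_coend ::
  "('x, 'y) cat \<Rightarrow> ('o, 'a) cat \<Rightarrow> ('x \<Rightarrow> 'x \<Rightarrow> 'o) \<Rightarrow> ('y \<Rightarrow> 'y \<Rightarrow> 'a) \<Rightarrow> 'o \<Rightarrow> ('x \<Rightarrow> 'a) \<Rightarrow> bool" where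
  "is_coend A C T0 T1 c w \<longleftrightarrow>
     is_cowedge A C T0 T1 c w \<and>
     (\<forall>d v. is_cowedge A C T0 T1 d v \<longrightarrow>
        (\<exists>!h. h \<in> hom C c d \<and> (\<forall>X \<in> Obj A. Comp C h (w X) = v X)))"


section \<open>Colimits and coends of sets\<close>

definition equiv_gen :: "'a set \<Rightarrow> 'a rel \<Rightarrow> 'a rel" where
  "equiv_gen A r = (r \<union> r\<inverse>)\<^sup>* \<inter> A \<times> A"

text \<open>The colimit of a diagram of sets, given by \<open>S0\<close> on objects and \<open>S1\<close> on arrows of \<open>J\<close>.\<close>

definition colim_rel ::
  "('j, 'i) cat \<Rightarrow> ('j \<Rightarrow> 's set) \<Rightarrow> ('i \<Rightarrow> 's \<Rightarrow> 's) \<Rightarrow> ('j \<times> 's) rel" where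
  "colim_rel J S0 S1 = equiv_gen (Sigma (Obj J) S0)
     {((Dom J u, s), (Cod J u, S1 u s)) | u s. u \<in> Arr J \<and> s \<in> S0 (Dom J u)}"

definition set_colim ::
  "('j, 'i) cat \<Rightarrow> ('j \<Rightarrow> 's set) \<Rightarrow> ('i \<Rightarrow> 's \<Rightarrow> 's) \<Rightarrow> ('j \<times> 's) set set" where
  "set_colim J S0 S1 = Sigma (Obj J) S0 // colim_rel J S0 S1"

text \<open>The coend of a bifunctor \<open>A\<^sup>o\<^sup>p \<times> A \<rightarrow> Set\<close>, encoded as above.\<close>

definition coend_rel ::
  "('x, 'y) cat \<Rightarrow> ('x \<Rightarrow> 'x \<Rightarrow> 't set) \<Rightarrow> ('y \<Rightarrow> 'y \<Rightarrow> 't \<Rightarrow> 't) \<Rightarrow> ('x \<times> 't) rel" where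
  "coend_rel A T0 T1 = equiv_gen (SIGMA X : Obj A. T0 X X)
     {((Dom A f, T1 f (Ide A (Dom A f)) t), (Cod A f, T1 (Ide A (Cod A f)) f t)) | f t.
        f \<in> Arr A \<and> t \<in> T0 (Cod A f) (Dom A f)}"

definition set_coend ::
  "('x, 'y) cat \<Rightarrow> ('x \<Rightarrow> 'x \<Rightarrow> 't set) \<Rightarrow> ('y \<Rightarrow> 'y \<Rightarrow> 't \<Rightarrow> 't) \<Rightarrow> ('x \<times> 't) set set" where
  "set_coend A T0 T1 = (SIGMA X : Obj A. T0 X X) // coend_rel A T0 T1"


section \<open>Presheaves\<close>

text \<open>
  For \<open>f : X \<rightarrow> Y\<close> the restriction \<open>P(Y) \<rightarrow> P(X)\<close> is \<open>PAr P f\<close>. Extensionality makes the records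
  satisfying the following predicate correspond one-to-one to presheaves.
\<close>

record ('o, 'a, 'v) presheaf =
  POb :: "'o \<Rightarrow> 'v set"
  PAr :: "'a \<Rightarrow> 'v \<Rightarrow> 'v"

definition is_presheaf :: "'k rel \<Rightarrow> ('o, 'a) cat \<Rightarrow> ('o, 'a, 'v) presheaf \<Rightarrow> bool" where
  "is_presheaf \<kappa> C P \<longleftrightarrow>
     POb P \<in> extensional (Obj C) \<and> (\<forall>X \<in> Obj C. small \<kappa> (POb P X)) \<and>
     PAr P \<in> (\<Pi>\<^sub>E f \<in> Arr C. POb P (Cod C f) \<rightarrow>\<^sub>E POb P (Dom C f)) \<and>
     (\<forall>X \<in> Obj C. \<forall>x \<in> POb P X. PAr P (Ide C X) x = x) \<and>
     (\<forall>f \<in> Arr C. \<forall>g \<in> Arr C. Cod C f = Dom C g \<longrightarrow>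
        (\<forall>x \<in> POb P (Cod C g). PAr P (Comp C g f) x = PAr P f (PAr P g x)))"

definition mk_presheaf ::
  "('o, 'a) cat \<Rightarrow> ('o \<Rightarrow> 'v set) \<Rightarrow> ('a \<Rightarrow> 'v \<Rightarrow> 'v) \<Rightarrow> ('o, 'a, 'v) presheaf" where
  "mk_presheaf C P0 P1 =
     \<lparr>POb = restrict P0 (Obj C), PAr = \<lambda>f \<in> Arr C. restrict (P1 f) (P0 (Cod C f))\<rparr>"

definition presheaf_iso ::
  "('o, 'a) cat \<Rightarrow> ('o, 'a, 'v) presheaf \<Rightarrow> ('o, 'a, 'w) presheaf \<Rightarrow> bool" where
  "presheaf_iso C P Q \<longleftrightarrow>
     (\<exists>\<alpha>. (\<forall>X \<in> Obj C. bij_betw (\<alpha> X) (POb P X) (POb Q X)) \<and>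
          (\<forall>f \<in> Arr C. \<forall>x \<in> POb P (Cod C f).
             \<alpha> (Dom C f) (PAr P f x) = PAr Q f (\<alpha> (Cod C f) x)))"

text \<open>
  The image presheaf: the value at \<open>X\<close> is the colimit of the sets \<open>hom X (D j)\<close>, and \<open>h\<close> sends the
  class of \<open>(j, f)\<close> to the class of \<open>(j, f \<circ> h)\<close>. Taking the image of a class under a relation, as
  here and below, picks out the class containing the images of its representatives.
\<close>

definition image_rel :: "('j, 'i) cat \<Rightarrow> ('o, 'a) cat \<Rightarrow> ('j, 'i, 'o, 'a) func \<Rightarrow> 'o \<Rightarrow> ('j \<times> 'a) rel"
  where
  "image_rel J C D X = colim_rel J (\<lambda>j. hom C X (FOb D j)) (\<lambda>u f. Comp C (FAr D u) f)"

definition image_presheaf ::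
  "('j, 'i) cat \<Rightarrow> ('o, 'a) cat \<Rightarrow> ('j, 'i, 'o, 'a) func \<Rightarrow> ('o, 'a, ('j \<times> 'a) set) presheaf" where
  "image_presheaf J C D = mk_presheaf C
     (\<lambda>X. set_colim J (\<lambda>j. hom C X (FOb D j)) (\<lambda>u f. Comp C (FAr D u) f))
     (\<lambda>h c. image_rel J C D (Dom C h) `` (\<lambda>(j, f). (j, Comp C f h)) ` c)"

definition small_presheaf :: "'k rel \<Rightarrow> ('o, 'a) cat \<Rightarrow> ('o, 'a, 'k) presheaf \<Rightarrow> bool" where
  "small_presheaf \<kappa> C P \<longleftrightarrow>
     is_presheaf \<kappa> C P \<and>
     (\<exists>(J :: ('k, 'k) cat) D.
        small_category \<kappa> J \<and> is_functor J C D \<and> presheaf_iso C (image_presheaf J C D) P)"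

text \<open>The category \<open>P C\<close>. An arrow is a triple consisting of domain, codomain and transformation.\<close>

type_synonym ('o, 'a, 'v) psh_arr =
  "('o, 'a, 'v) presheaf \<times> ('o, 'a, 'v) presheaf \<times> ('o \<Rightarrow> 'v \<Rightarrow> 'v)"

definition psh_trans ::
  "('o, 'a) cat \<Rightarrow> ('o, 'a, 'v) presheaf \<Rightarrow> ('o, 'a, 'v) presheaf \<Rightarrow> ('o \<Rightarrow> 'v \<Rightarrow> 'v) \<Rightarrow> bool" where
  "psh_trans C P Q \<alpha> \<longleftrightarrow>
     \<alpha> \<in> (\<Pi>\<^sub>E X \<in> Obj C. POb P X \<rightarrow>\<^sub>E POb Q X) \<and>
     (\<forall>f \<in> Arr C. \<forall>x \<in> POb P (Cod C f).
        \<alpha> (Dom C f) (PAr P f x) = PAr Q f (\<alpha> (Cod C f) x))"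

definition PSh ::
  "'k rel \<Rightarrow> ('o, 'a) cat \<Rightarrow> (('o, 'a, 'k) presheaf, ('o, 'a, 'k) psh_arr) cat" where
  "PSh \<kappa> C =
     \<lparr>Obj = {P. small_presheaf \<kappa> C P},
      Arr = {(P, Q, \<alpha>). small_presheaf \<kappa> C P \<and> small_presheaf \<kappa> C Q \<and> psh_trans C P Q \<alpha>},
      Dom = (\<lambda>(P, Q, \<alpha>). P),
      Cod = (\<lambda>(P, Q, \<alpha>). Q),
      Ide = (\<lambda>P. (P, P, \<lambda>X \<in> Obj C. \<lambda>x \<in> POb P X. x)),
      Comp = (\<lambda>(Q', R, \<beta>) (P, Q, \<alpha>). (P, R, \<lambda>X \<in> Obj C. \<lambda>x \<in> POb P X. \<beta> X (\<alpha> X x)))\<rparr>"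


section \<open>The presheaf monad\<close>

text \<open>
  \<open>F\<^sub>\<sharp> P (X) = \<integral>\<^sup>A P(A) \<times> hom(X, F A)\<close>, where \<open>h\<close> sends the class of \<open>(A, p, k)\<close> to that of
  \<open>(A, p, k \<circ> h)\<close>.
\<close>

definition push0 ::
  "('p, 'b) cat \<Rightarrow> ('o, 'a, 'p, 'b) func \<Rightarrow> ('o, 'a, 'v) presheaf \<Rightarrow> 'p \<Rightarrow> 'o \<Rightarrow> 'o \<Rightarrow> ('v \<times> 'b) set" where
  "push0 D F P X A B = POb P A \<times> hom D X (FOb F B)"

definition push1 ::
  "('p, 'b) cat \<Rightarrow> ('o, 'a, 'p, 'b) func \<Rightarrow> ('o, 'a, 'v) presheaf \<Rightarrow> 'a \<Rightarrow> 'a \<Rightarrow> 'v \<times> 'b \<Rightarrow> 'v \<times> 'b" where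
  "push1 D F P f g = (\<lambda>(p, k). (PAr P f p, Comp D (FAr F g) k))"

definition push ::
  "('o, 'a) cat \<Rightarrow> ('p, 'b) cat \<Rightarrow> ('o, 'a, 'p, 'b) func \<Rightarrow> ('o, 'a, 'v) presheaf
    \<Rightarrow> ('p, 'b, ('o \<times> 'v \<times> 'b) set) presheaf" where
  "push C D F P = mk_presheaf D
     (\<lambda>X. set_coend C (push0 D F P X) (push1 D F P))
     (\<lambda>h c. coend_rel C (push0 D F P (Dom D h)) (push1 D F P) ``
              (\<lambda>(A, p, k). (A, p, Comp D k h)) ` c)"

text \<open>
  \<open>\<mu>(\<Phi>)(X) = \<integral>\<^sup>P \<Phi>(P) \<times> P(X)\<close> over all small presheaves \<open>P\<close>, where \<open>h\<close> sends the class of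
  \<open>(P, s, x)\<close> to that of \<open>(P, s, P(h)(x))\<close>.
\<close>

definition mu0 ::
  "(('o, 'a, 'k) presheaf, ('o, 'a, 'k) psh_arr, 'k) presheaf \<Rightarrow> 'o
    \<Rightarrow> ('o, 'a, 'k) presheaf \<Rightarrow> ('o, 'a, 'k) presheaf \<Rightarrow> ('k \<times> 'k) set" where
  "mu0 \<Phi> X P Q = POb \<Phi> P \<times> POb Q X"

definition mu1 ::
  "(('o, 'a, 'k) presheaf, ('o, 'a, 'k) psh_arr, 'k) presheaf \<Rightarrow> 'o
    \<Rightarrow> ('o, 'a, 'k) psh_arr \<Rightarrow> ('o, 'a, 'k) psh_arr \<Rightarrow> 'k \<times> 'k \<Rightarrow> 'k \<times> 'k" where
  "mu1 \<Phi> X f g = (\<lambda>(s, x). (PAr \<Phi> f s, snd (snd g) X x))"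

definition mu ::
  "'k rel \<Rightarrow> ('o, 'a) cat \<Rightarrow> (('o, 'a, 'k) presheaf, ('o, 'a, 'k) psh_arr, 'k) presheaf
    \<Rightarrow> ('o, 'a, (('o, 'a, 'k) presheaf \<times> 'k \<times> 'k) set) presheaf" where
  "mu \<kappa> C \<Phi> = mk_presheaf C
     (\<lambda>X. set_coend (PSh \<kappa> C) (mu0 \<Phi> X) (mu1 \<Phi> X))
     (\<lambda>h c. coend_rel (PSh \<kappa> C) (mu0 \<Phi> (Dom C h)) (mu1 \<Phi> (Dom C h)) ``
              (\<lambda>(P, s, x). (P, s, PAr P h x)) ` c)"

text \<open>
  A choice of weighted colimits is a functor \<open>e : P C \<rightarrow> C\<close> with \<open>e(P) = \<integral>\<^sup>X P(X) \<otimes> X\<close>, its value on a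
  transformation \<open>\<alpha>\<close> being the arrow that \<open>\<alpha>\<close> induces between the coends.
\<close>

definition tensor0 :: "('o, 'a) cat \<Rightarrow> ('o, 'a, 'v) presheaf \<Rightarrow> 'o \<Rightarrow> 'o \<Rightarrow> 'o" where
  "tensor0 C P X Y = fst (copower C (POb P X) Y)"

definition tensor1 :: "('o, 'a) cat \<Rightarrow> ('o, 'a, 'v) presheaf \<Rightarrow> 'a \<Rightarrow> 'a \<Rightarrow> 'a" where
  "tensor1 C P f g = copower_map C (POb P (Cod C f)) (POb P (Dom C f)) (PAr P f) g"

definition is_weighted_colimit_choice ::
  "'k rel \<Rightarrow> ('o, 'a) cat \<Rightarrow> (('o, 'a, 'k) presheaf, ('o, 'a, 'k) psh_arr, 'o, 'a) func \<Rightarrow> bool" where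
  "is_weighted_colimit_choice \<kappa> C e \<longleftrightarrow>
     is_functor (PSh \<kappa> C) C e \<and>
     (\<exists>w. (\<forall>P \<in> Obj (PSh \<kappa> C). is_coend C C (tensor0 C P) (tensor1 C P) (FOb e P) (w P)) \<and>
          (\<forall>(P, Q, \<alpha>) \<in> Arr (PSh \<kappa> C). \<forall>X \<in> Obj C.
             Comp C (FAr e (P, Q, \<alpha>)) (w P X) =
             Comp C (w Q X) (copower_map C (POb P X) (POb Q X) (\<alpha> X) (Ide C X))))"

definition is_partial_evaluation ::
  "'k rel \<Rightarrow> ('o, 'a) cat \<Rightarrow> (('o, 'a, 'k) presheaf, ('o, 'a, 'k) psh_arr, 'o, 'a) func
    \<Rightarrow> ('o, 'a, 'k) presheaf \<Rightarrow> ('o, 'a, 'k) presheaf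
    \<Rightarrow> (('o, 'a, 'k) presheaf, ('o, 'a, 'k) psh_arr, 'k) presheaf \<Rightarrow> bool" where
  "is_partial_evaluation \<kappa> C e P Q \<Phi> \<longleftrightarrow>
     \<Phi> \<in> Obj (PSh \<kappa> (PSh \<kappa> C)) \<and>
     presheaf_iso C (mu \<kappa> C \<Phi>) P \<and> presheaf_iso C (push (PSh \<kappa> C) C e \<Phi>) Q"

end

theory Submission
  imports Defs
begin

text \<open>
  Both conditions say that some functor \<open>G : K \<rightarrow> P C\<close> on a small category has colimit \<open>P\<close> while the image
  presheaf of \<open>e \<circ> G\<close> is \<open>Q\<close>.

  A small presheaf \<open>\<Phi>\<close> on \<open>P C\<close> is the image presheaf of such a \<open>G\<close>, and the co-Yoneda lemma identifies
  \<open>\<mu>(\<Phi>)\<close> with the colimit of \<open>G\<close>, and \<open>e\<^sub>\<sharp>(\<Phi>)\<close> with the image presheaf of \<open>e \<circ> G\<close>.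

  If \<open>G\<close> is the pointwise left Kan extension along \<open>F : J \<rightarrow> K\<close> of \<open>D : J \<rightarrow> C\<close> followed by the Yoneda
  embedding, then the colimit of \<open>G\<close> is the image presheaf of \<open>D\<close>, and \<open>e \<circ> G\<close> is the left Kan extension
  of \<open>D\<close> along \<open>F\<close>. Every \<open>G\<close> arises in this way: choose a small set \<open>S\<close> of objects of \<open>C\<close> that contains the
  objects of diagrams presenting all the \<open>G k\<close>, and let \<open>J\<close> be the category of triples \<open>(k, X, y)\<close> with
  \<open>X \<in> S\<close> and \<open>y \<in> G k (X)\<close>.
\<close>

section \<open>Small sets\<close>

text \<open>Two size problems shape the proof. The coends in \<open>mu\<close> and
  \<open>push\<close> run over the large category of small presheaves, and the canonical
  decomposition of a single \<open>G k\<close> into representables is indexed by a large category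
  too. The first is harmless because \<Phi> has a small presentation and every class of the coend
  can be slid onto one of its generators. The second is the reason for cutting the objects of
  \<open>C\<close> down to \<open>S\<close>. All arrows between objects of \<open>S\<close> are
  kept, so each element over \<open>S\<close> is still joined by an arrow to a generator of the
  chosen diagram, and the colimit survives.

  Condition (1) allows any left Kan extension, known only by its universal property, while the
  argument controls the particular one given by \<open>e\<close> after \<open>G\<close>. Uniqueness
  up to natural isomorphism closes this gap.

  Small categories and values of presheaves must live in the type of \<kappa>, whereas comma
  categories, categories of elements and quotients consist of tuples and sets. Hence the repeated
  transport along encodings.\<close>

lemma small_subset: "small \<kappa> B \<Longrightarrow> A \<subseteq> B \<Longrightarrow> small \<kappa> A"
  unfolding small_def using card_of_mono1 ordLeq_ordLess_trans by blast

lemma small_image: "small \<kappa> A \<Longrightarrow> small \<kappa> (f ` A)"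
  unfolding small_def using card_of_image ordLeq_ordLess_trans by blast

lemma small_inj_on: "inj_on f A \<Longrightarrow> small \<kappa> (f ` A) \<Longrightarrow> small \<kappa> A"
  using small_image[of \<kappa> "f ` A" "inv_into A f"] by simp

text \<open>Stability is closure of smallness under small disjoint unions. It is the only form in
  which regularity of \<kappa> is used.\<close>

lemma universe_card_stable: "universe_card \<kappa> \<Longrightarrow> stable \<kappa>"
  unfolding universe_card_def cinfinite_def using regularCard_stable by blast

lemma small_Sigma: "universe_card \<kappa> \<Longrightarrow> small \<kappa> A \<Longrightarrow> (\<And>a. a \<in> A \<Longrightarrow> small \<kappa> (F a)) \<Longrightarrow> small \<kappa> (Sigma A F)"
  unfolding small_def by (rule stable_elim[OF universe_card_stable])

lemma small_UN: "universe_card \<kappa> \<Longrightarrow> small \<kappa> A \<Longrightarrow> (\<And>a. a \<in> A \<Longrightarrow> small \<kappa> (F a)) \<Longrightarrow> small \<kappa> (\<Union>a\<in>A. F a)"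
  unfolding small_def by (rule stable_UNION[OF universe_card_stable])

text \<open>Moves small sets of any type into the type of \<kappa>, where presheaf values and small
  categories are required to live. Injectivity on \<open>A\<close> is all that the later transports
  need.\<close>

lemma small_encode:
  fixes \<kappa> :: "'k rel" and A :: "'a set"
  assumes "small \<kappa> A"
  obtains f :: "'a \<Rightarrow> 'k" where "inj_on f A"
proof -
  obtain B where "B < Field \<kappa>" "|A| =o |B|"
    using internalize_card_of_ordLess[of A \<kappa>] assms unfolding small_def by blast
  then show ?thesis using that card_of_ordIso[of A B] unfolding bij_betw_def by blast
qed

text \<open>\<open>universe_card\<close> bounds power sets only for sets of elements of
  \<open>'k\<close>; an encoding carries the bound to other types.\<close>

lemma small_Pow:
  fixes \<kappa> :: "'k rel" and A :: "'a set"
  assumes "universe_card \<kappa>" "small \<kappa> A"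
  shows "small \<kappa> (Pow A)"
proof -
  obtain f :: "'a \<Rightarrow> 'k" where f: "inj_on f A" using small_encode[OF assms(2)] by blast
  have "small \<kappa> (f ` A)" using assms(2) by (rule small_image)
  then have "small \<kappa> (Pow (f ` A))" using assms(1) unfolding universe_card_def small_def by blast
  then have "small \<kappa> ((`) f ` Pow A)" by (simp add: image_Pow_surj[OF refl])
  then show ?thesis by (rule small_inj_on[OF inj_on_image_Pow[OF f]])
qed

text \<open>A dependent function is determined by its graph, so the product embeds into the power
  set of the dependent sum.\<close>

lemma small_PiE:
  assumes "universe_card \<kappa>" "small \<kappa> A" "\<And>a. a \<in> A \<Longrightarrow> small \<kappa> (F a)"
  shows "small \<kappa> (PiE A F)"
proof -
  have "inj_on (\<lambda>f. (\<lambda>a. (a, f a)) ` A) (PiE A F)"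
  proof (rule inj_onI)
    fix f g assume fg: "f \<in> PiE A F" "g \<in> PiE A F" "(\<lambda>a. (a, f a)) ` A = (\<lambda>a. (a, g a)) ` A"
    show "f = g" by (rule PiE_ext[OF fg(1,2)]) (use fg(3) in blast)
  qed
  moreover have "small \<kappa> (Sigma A F)" using assms by (rule small_Sigma)
  then have "small \<kappa> ((\<lambda>f. (\<lambda>a. (a, f a)) ` A) ` PiE A F)"
    by (rule small_subset[OF small_Pow[OF assms(1)]]) (auto simp: PiE_iff)
  ultimately show ?thesis by (rule small_inj_on)
qed


section \<open>Presentations of sets\<close>

text \<open>
  \<open>f\<close> exhibits \<open>B\<close> as the quotient of \<open>A\<close> by the equivalence relation generated by \<open>r\<close>. It suffices
  to test this on \<open>r\<close>-invariant predicates, so zigzags of generators never have to be handled below.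
\<close>

definition presents :: "'a set \<Rightarrow> 'a rel \<Rightarrow> ('a \<Rightarrow> 'b) \<Rightarrow> 'b set \<Rightarrow> bool" where
  "presents A r f B \<longleftrightarrow> f ` A = B \<and> (\<forall>a\<in>A. \<forall>a'\<in>A. f a = f a' \<longleftrightarrow> (a, a') \<in> equiv_gen A r)"

definition invariant :: "'a rel \<Rightarrow> ('a \<Rightarrow> 'b) \<Rightarrow> bool" where
  "invariant r \<phi> \<longleftrightarrow> (\<forall>(a, a')\<in>r. \<phi> a = \<phi> a')"

lemma equiv_equiv_gen: "equiv A (equiv_gen A r)"
proof -
  have "sym ((r \<union> r\<inverse>)\<^sup>*)" by (rule sym_rtrancl) (auto simp: sym_def)
  moreover have "trans ((r \<union> r\<inverse>)\<^sup>*)" by (rule trans_rtrancl)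
  ultimately show ?thesis
    unfolding equiv_gen_def equiv_def refl_on_def sym_on_def trans_on_def by blast
qed

lemma equiv_gen_generator: "(a, a') \<in> r \<Longrightarrow> a \<in> A \<Longrightarrow> a' \<in> A \<Longrightarrow> (a, a') \<in> equiv_gen A r"
  unfolding equiv_gen_def by auto

lemma equiv_gen_invariant:
  assumes "(a, a') \<in> equiv_gen A r" "invariant r \<phi>"
  shows "\<phi> a = \<phi> a'"
proof -
  have "(a, a') \<in> (r \<union> r\<inverse>)\<^sup>*" using assms unfolding equiv_gen_def by blast
  then show ?thesis by induction (use assms(2) in \<open>auto simp: invariant_def\<close>)
qed

text \<open>Boolean predicates suffice because membership in the equivalence class of a fixed
  \<open>a\<close> is itself invariant; applied to it, \<open>univ\<close> gives the missing
  equivalence. That \<open>r\<close> lies inside \<open>A\<close> times \<open>A\<close> keeps the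
  zigzags within \<open>A\<close>.\<close>

lemma presentsI:
  assumes r: "r \<subseteq> A \<times> A" and B: "f ` A = B" and inv: "invariant r f"
    and univ: "\<And>(\<phi> :: 'a \<Rightarrow> bool) a a'. invariant r \<phi> \<Longrightarrow> a \<in> A \<Longrightarrow> a' \<in> A \<Longrightarrow> f a = f a' \<Longrightarrow> \<phi> a = \<phi> a'"
  shows "presents A r f B"
  unfolding presents_def
proof (intro conjI ballI iffI)
  fix a a' assume a: "a \<in> A" "a' \<in> A"
  show "f a = f a'" if "(a, a') \<in> equiv_gen A r" using equiv_gen_invariant[OF that inv] .
  assume eq: "f a = f a'"
  have refl: "(a, a) \<in> equiv_gen A r" using a(1) unfolding equiv_gen_def by blast
  have sym: "sym (equiv_gen A r)" and trans: "trans (equiv_gen A r)"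
    using equiv_equiv_gen[of A r] unfolding equiv_def by auto
  have "invariant r (\<lambda>b. (a, b) \<in> equiv_gen A r)"
    unfolding invariant_def
  proof clarify
    fix b b' assume "(b, b') \<in> r"
    then have b: "(b, b') \<in> equiv_gen A r" by (rule equiv_gen_generator) (use \<open>(b, b') \<in> r\<close> r in auto)
    then have b': "(b', b) \<in> equiv_gen A r" by (rule symD[OF sym])
    show "((a, b) \<in> equiv_gen A r) = ((a, b') \<in> equiv_gen A r)"
      using transD[OF trans _ b] transD[OF trans _ b'] by blast
  qed
  from univ[OF this a eq] show "(a, a') \<in> equiv_gen A r"
    using refl by simp
qed (use B in auto)

lemma presents_cong:
  assumes "\<And>a. a \<in> A \<Longrightarrow> f a = g a"
  shows "presents A r f B \<longleftrightarrow> presents A r g B"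
  using assms unfolding presents_def by (simp cong: image_cong)

text \<open>Only predicates are tested when a presentation is established, yet invariant maps into
  any type factor through it.\<close>

lemma presents_factor:
  "presents A r f B \<Longrightarrow> invariant r \<phi> \<Longrightarrow> a \<in> A \<Longrightarrow> a' \<in> A \<Longrightarrow> f a = f a' \<Longrightarrow> \<phi> a = \<phi> a'"
  unfolding presents_def using equiv_gen_invariant by metis

lemma presents_generator:
  "presents A r f B \<Longrightarrow> (a, a') \<in> r \<Longrightarrow> a \<in> A \<Longrightarrow> a' \<in> A \<Longrightarrow> f a = f a'"
  unfolding presents_def using equiv_gen_generator by metis

lemma presents_in: "presents A r f B \<Longrightarrow> a \<in> A \<Longrightarrow> f a \<in> B"
  unfolding presents_def by blast

lemma presents_ex: "presents A r f B \<Longrightarrow> b \<in> B \<Longrightarrow> \<exists>a\<in>A. b = f a"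
  unfolding presents_def by blast

lemma presents_lift:
  assumes "presents A r f B" "invariant r \<phi>"
  shows "\<exists>g. \<forall>a\<in>A. g (f a) = \<phi> a"
proof (intro exI ballI)
  fix a assume "a \<in> A"
  then show "(\<lambda>b. \<phi> (inv_into A f b)) (f a) = \<phi> a"
    using presents_factor[OF assms] by (metis f_inv_into_f imageI inv_into_into)
qed

lemma presents_quotient: "presents A r (\<lambda>a. equiv_gen A r `` {a}) (A // equiv_gen A r)"
  unfolding presents_def
  by (auto simp: quotient_def eq_equiv_class_iff[OF equiv_equiv_gen])

lemma presents_comp_bij:
  assumes f: "presents A r f B" and g: "bij_betw g B B'"
  shows "presents A r (\<lambda>a. g (f a)) B'"
proof -
  have "g (f a) = g (f a') \<longleftrightarrow> f a = f a'" if "a \<in> A" "a' \<in> A" for a a'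
    using g presents_in[OF f] that by (auto simp: bij_betw_def dest: inj_onD)
  moreover have "(\<lambda>a. g (f a)) ` A = B'"
    using f g unfolding presents_def bij_betw_def by (metis image_image)
  ultimately show ?thesis using f unfolding presents_def by blast
qed

text \<open>Both maps have the same kernel. This trades the concrete set of equivalence classes for
  any other model of the quotient, compatibly with representatives.\<close>

lemma presents_bij_ex:
  assumes f: "presents A r f B" and f': "presents A r f' B'"
  shows "\<exists>g. bij_betw g B B' \<and> (\<forall>a\<in>A. g (f a) = f' a)"
proof -
  define g where "g b = f' (inv_into A f b)" for b
  have g: "g (f a) = f' a" if "a \<in> A" for a
    using that f f' unfolding g_def presents_def by (metis f_inv_into_f imageI inv_into_into)
  have "bij_betw g B B'" unfolding bij_betw_def
  proof
    show "inj_on g B" using f f' g unfolding presents_def inj_on_def by (smt (verit) imageE)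
    show "g ` B = B'" using f f' g unfolding presents_def by (smt (verit) image_cong image_image)
  qed
  then show ?thesis using g by blast
qed


section \<open>Colimits of sets\<close>

text \<open>The relation inside \<open>colim_rel\<close> before its equivalence closure, isolated so
  that \<open>presents\<close> applies to it.\<close>

definition colim_gen ::
  "('j, 'i) cat \<Rightarrow> ('j \<Rightarrow> 's set) \<Rightarrow> ('i \<Rightarrow> 's \<Rightarrow> 's) \<Rightarrow> ('j \<times> 's) rel" where
  "colim_gen J S0 S1 = {((Dom J u, s), (Cod J u, S1 u s)) | u s. u \<in> Arr J \<and> s \<in> S0 (Dom J u)}"

definition set_diagram :: "('j, 'i) cat \<Rightarrow> ('j \<Rightarrow> 's set) \<Rightarrow> ('i \<Rightarrow> 's \<Rightarrow> 's) \<Rightarrow> bool" where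
  "set_diagram J S0 S1 \<longleftrightarrow> (\<forall>u\<in>Arr J. Dom J u \<in> Obj J \<and> Cod J u \<in> Obj J \<and> S1 u \<in> S0 (Dom J u) \<rightarrow> S0 (Cod J u))"

definition set_cocone ::
  "('j, 'i) cat \<Rightarrow> ('j \<Rightarrow> 's set) \<Rightarrow> ('i \<Rightarrow> 's \<Rightarrow> 's) \<Rightarrow> ('j \<Rightarrow> 's \<Rightarrow> 'b) \<Rightarrow> bool" where
  "set_cocone J S0 S1 \<iota> \<longleftrightarrow> (\<forall>u\<in>Arr J. \<forall>s\<in>S0 (Dom J u). \<iota> (Cod J u) (S1 u s) = \<iota> (Dom J u) s)"

definition set_colimit ::
  "('j, 'i) cat \<Rightarrow> ('j \<Rightarrow> 's set) \<Rightarrow> ('i \<Rightarrow> 's \<Rightarrow> 's) \<Rightarrow> ('j \<Rightarrow> 's \<Rightarrow> 'b) \<Rightarrow> 'b set \<Rightarrow> bool" where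
  "set_colimit J S0 S1 \<iota> B \<longleftrightarrow> presents (Sigma (Obj J) S0) (colim_gen J S0 S1) (\<lambda>(j, s). \<iota> j s) B"

lemma set_coconeI:
  "(\<And>u s. u \<in> Arr J \<Longrightarrow> s \<in> S0 (Dom J u) \<Longrightarrow> \<iota> (Cod J u) (S1 u s) = \<iota> (Dom J u) s) \<Longrightarrow> set_cocone J S0 S1 \<iota>"
  unfolding set_cocone_def by blast

lemma set_coconeD:
  "set_cocone J S0 S1 \<iota> \<Longrightarrow> u \<in> Arr J \<Longrightarrow> s \<in> S0 (Dom J u) \<Longrightarrow> \<iota> (Cod J u) (S1 u s) = \<iota> (Dom J u) s"
  unfolding set_cocone_def by blast

lemma set_cocone_invariant: "set_cocone J S0 S1 \<iota> \<longleftrightarrow> invariant (colim_gen J S0 S1) (\<lambda>(j, s). \<iota> j s)"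
  unfolding set_cocone_def invariant_def colim_gen_def by fastforce

lemma colim_gen_subset: "set_diagram J S0 S1 \<Longrightarrow> colim_gen J S0 S1 \<subseteq> Sigma (Obj J) S0 \<times> Sigma (Obj J) S0"
  unfolding set_diagram_def colim_gen_def by fastforce

lemma set_colimitI:
  assumes dia: "set_diagram J S0 S1" and coc: "set_cocone J S0 S1 \<iota>"
    and into: "\<And>j s. j \<in> Obj J \<Longrightarrow> s \<in> S0 j \<Longrightarrow> \<iota> j s \<in> B"
    and onto: "\<And>b. b \<in> B \<Longrightarrow> \<exists>j\<in>Obj J. \<exists>s\<in>S0 j. b = \<iota> j s"
    and univ: "\<And>(\<phi> :: 'j \<Rightarrow> 's \<Rightarrow> bool) j s j' s'. set_cocone J S0 S1 \<phi> \<Longrightarrow> j \<in> Obj J \<Longrightarrow> s \<in> S0 j \<Longrightarrow>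
      j' \<in> Obj J \<Longrightarrow> s' \<in> S0 j' \<Longrightarrow> \<iota> j s = \<iota> j' s' \<Longrightarrow> \<phi> j s = \<phi> j' s'"
  shows "set_colimit J S0 S1 \<iota> B"
  unfolding set_colimit_def
proof (rule presentsI)
  show "invariant (colim_gen J S0 S1) (\<lambda>(j, s). \<iota> j s)" using coc by (simp add: set_cocone_invariant)
  show "(\<lambda>(j, s). \<iota> j s) ` Sigma (Obj J) S0 = B" using into onto by force
  fix \<phi> :: "'j \<times> 's \<Rightarrow> bool" and a a'
  assume \<phi>: "invariant (colim_gen J S0 S1) \<phi>"
    and a: "a \<in> Sigma (Obj J) S0" "a' \<in> Sigma (Obj J) S0" "(\<lambda>(j, s). \<iota> j s) a = (\<lambda>(j, s). \<iota> j s) a'"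
  have "set_cocone J S0 S1 (\<lambda>j s. \<phi> (j, s))" unfolding set_cocone_invariant using \<phi> by simp
  from univ[OF this, of "fst a" "snd a" "fst a'" "snd a'"] a show "\<phi> a = \<phi> a'" by auto
qed (rule colim_gen_subset[OF dia])

lemma set_colimit_in: "set_colimit J S0 S1 \<iota> B \<Longrightarrow> j \<in> Obj J \<Longrightarrow> s \<in> S0 j \<Longrightarrow> \<iota> j s \<in> B"
  unfolding set_colimit_def using presents_in[of "Sigma (Obj J) S0" _ "\<lambda>(j, s). \<iota> j s" B "(j, s)"] by auto

lemma set_colimit_ex:
  assumes "set_colimit J S0 S1 \<iota> B" "b \<in> B"
  obtains j s where "j \<in> Obj J" "s \<in> S0 j" "b = \<iota> j s"
  using presents_ex[OF assms[unfolded set_colimit_def]] by auto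

lemma set_colimit_cocone:
  assumes "set_diagram J S0 S1" "set_colimit J S0 S1 \<iota> B"
  shows "set_cocone J S0 S1 \<iota>"
  unfolding set_cocone_invariant invariant_def
  using presents_generator[OF assms(2)[unfolded set_colimit_def]] colim_gen_subset[OF assms(1)] by blast

lemma set_colimit_factor:
  assumes "set_colimit J S0 S1 \<iota> B" "set_cocone J S0 S1 \<phi>"
    "j \<in> Obj J" "s \<in> S0 j" "j' \<in> Obj J" "s' \<in> S0 j'" "\<iota> j s = \<iota> j' s'"
  shows "\<phi> j s = \<phi> j' s'"
  using presents_factor[OF assms(1)[unfolded set_colimit_def] assms(2)[unfolded set_cocone_invariant],
      of "(j, s)" "(j', s')"] assms(3-) by auto

lemma set_colimit_lift:
  assumes "set_colimit J S0 S1 \<iota> B" "set_cocone J S0 S1 \<phi>"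
  shows "\<exists>g. \<forall>j\<in>Obj J. \<forall>s\<in>S0 j. g (\<iota> j s) = \<phi> j s"
  using presents_lift[OF assms(1)[unfolded set_colimit_def] assms(2)[unfolded set_cocone_invariant]]
  by fastforce


section \<open>Presheaves of quotients\<close>

lemma mk_presheaf_simps [simp]:
  "X \<in> Obj C \<Longrightarrow> POb (mk_presheaf C P0 P1) X = P0 X"
  "f \<in> Arr C \<Longrightarrow> x \<in> P0 (Cod C f) \<Longrightarrow> PAr (mk_presheaf C P0 P1) f x = P1 f x"
  by (simp_all add: mk_presheaf_def)

text \<open>The common form of \<open>image_presheaf\<close>, \<open>mu\<close> and
  \<open>push\<close>, all of which are quotients at each object with an action given on
  representatives.\<close>

definition quotient_presheaf ::
  "('o, 'a) cat \<Rightarrow> ('o \<Rightarrow> 's set) \<Rightarrow> ('o \<Rightarrow> 's rel) \<Rightarrow> ('a \<Rightarrow> 's \<Rightarrow> 's) \<Rightarrow> ('o, 'a, 's set) presheaf" where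
  "quotient_presheaf C A r t = mk_presheaf C (\<lambda>X. A X // equiv_gen (A X) (r X))
     (\<lambda>h c. equiv_gen (A (Dom C h)) (r (Dom C h)) `` t h ` c)"

text \<open>Compatibility of \<open>t\<close> is asked on generators only;
  \<open>quotient_act\<close> extends it to the generated equivalence relations.\<close>

locale quotient_data = category C for C :: "('o, 'a) cat" +
  fixes A :: "'o \<Rightarrow> 's set" and r :: "'o \<Rightarrow> 's rel" and t :: "'a \<Rightarrow> 's \<Rightarrow> 's"
  assumes r_subset: "X \<in> Obj C \<Longrightarrow> r X \<subseteq> A X \<times> A X"
    and t_in: "h \<in> Arr C \<Longrightarrow> a \<in> A (Cod C h) \<Longrightarrow> t h a \<in> A (Dom C h)"
    and t_rel: "h \<in> Arr C \<Longrightarrow> (a, a') \<in> r (Cod C h) \<Longrightarrow> (t h a, t h a') \<in> r (Dom C h)"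
begin

abbreviation "cls X a \<equiv> equiv_gen (A X) (r X) `` {a}"

text \<open>The action is defined as the image of a whole class under the relation, hence as a union
  of classes. It is a single class because sending \<open>b\<close> to the class of
  \<open>t h b\<close> is invariant, so all members of the given class contribute the same
  one.\<close>

lemma quotient_act:
  assumes h: "h \<in> Arr C" and a: "a \<in> A (Cod C h)"
  shows "PAr (quotient_presheaf C A r t) h (cls (Cod C h) a) = cls (Dom C h) (t h a)"
proof -
  let ?Q = "\<lambda>X. equiv_gen (A X) (r X)"
  have "invariant (r (Cod C h)) (\<lambda>b. cls (Dom C h) (t h b))"
    unfolding invariant_def
  proof clarify
    fix b b' assume b: "(b, b') \<in> r (Cod C h)"
    then have "b \<in> A (Cod C h)" "b' \<in> A (Cod C h)" using r_subset[OF Cod_in[OF h]] by auto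
    then have "(t h b, t h b') \<in> ?Q (Dom C h)" using equiv_gen_generator[OF t_rel[OF h b]] t_in[OF h] by simp
    then show "cls (Dom C h) (t h b) = cls (Dom C h) (t h b')" by (rule equiv_class_eq[OF equiv_equiv_gen])
  qed
  then have const: "cls (Dom C h) (t h b) = cls (Dom C h) (t h a)" if "b \<in> cls (Cod C h) a" for b
    using equiv_gen_invariant[of a b "A (Cod C h)" "r (Cod C h)"] that by auto
  have "a \<in> cls (Cod C h) a" using a unfolding equiv_gen_def by auto
  then have ne: "cls (Cod C h) a \<noteq> {}" by blast
  have "?Q (Dom C h) `` t h ` cls (Cod C h) a = (\<Union>b\<in>cls (Cod C h) a. cls (Dom C h) (t h b))" by blast
  also have "\<dots> = cls (Dom C h) (t h a)" by (rule SUP_eq_const[OF ne const])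
  finally have "?Q (Dom C h) `` t h ` cls (Cod C h) a = cls (Dom C h) (t h a)" .
  then show ?thesis using h a unfolding quotient_presheaf_def by (simp add: quotientI)
qed

text \<open>Turns an isomorphism of presheaves into a natural family of presentations by maps on
  representatives, which is the form used for all three quotient presheaves of the theorem.\<close>

lemma quotient_presheaf_iso_iff:
  "presheaf_iso C (quotient_presheaf C A r t) P \<longleftrightarrow>
    (\<exists>f. (\<forall>X\<in>Obj C. presents (A X) (r X) (f X) (POb P X)) \<and>
         (\<forall>h\<in>Arr C. \<forall>a\<in>A (Cod C h). f (Dom C h) (t h a) = PAr P h (f (Cod C h) a)))"
  (is "?L \<longleftrightarrow> (\<exists>f. ?R f)")
proof
  assume ?L
  then obtain \<alpha> where \<alpha>: "\<And>X. X \<in> Obj C \<Longrightarrow> bij_betw (\<alpha> X) (A X // equiv_gen (A X) (r X)) (POb P X)"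
    "\<And>h x. h \<in> Arr C \<Longrightarrow> x \<in> POb (quotient_presheaf C A r t) (Cod C h) \<Longrightarrow>
      \<alpha> (Dom C h) (PAr (quotient_presheaf C A r t) h x) = PAr P h (\<alpha> (Cod C h) x)"
    unfolding presheaf_iso_def by (auto simp: quotient_presheaf_def)
  have "?R (\<lambda>X a. \<alpha> X (cls X a))"
  proof (intro conjI ballI)
    show "presents (A X) (r X) (\<lambda>a. \<alpha> X (cls X a)) (POb P X)" if "X \<in> Obj C" for X
      by (rule presents_comp_bij[OF presents_quotient \<alpha>(1)[OF that]])
    fix h a assume h: "h \<in> Arr C" "a \<in> A (Cod C h)"
    then have "cls (Cod C h) a \<in> POb (quotient_presheaf C A r t) (Cod C h)"
      using Cod_in by (auto simp: quotient_presheaf_def quotientI)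
    from \<alpha>(2)[OF h(1) this]
    show "\<alpha> (Dom C h) (cls (Dom C h) (t h a)) = PAr P h (\<alpha> (Cod C h) (cls (Cod C h) a))"
      by (simp add: quotient_act[OF h])
  qed
  then show "\<exists>f. ?R f" by (rule exI[of _ "\<lambda>X a. \<alpha> X (cls X a)"])
next
  assume "\<exists>f. ?R f"
  then obtain f where f: "\<And>X. X \<in> Obj C \<Longrightarrow> presents (A X) (r X) (f X) (POb P X)"
    "\<And>h a. h \<in> Arr C \<Longrightarrow> a \<in> A (Cod C h) \<Longrightarrow> f (Dom C h) (t h a) = PAr P h (f (Cod C h) a)" by blast
  have "\<forall>X\<in>Obj C. \<exists>g. bij_betw g (A X // equiv_gen (A X) (r X)) (POb P X) \<and> (\<forall>a\<in>A X. g (cls X a) = f X a)"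
    by (intro ballI presents_bij_ex[OF presents_quotient] f(1))
  then obtain \<alpha> where \<alpha>: "\<And>X. X \<in> Obj C \<Longrightarrow> bij_betw (\<alpha> X) (A X // equiv_gen (A X) (r X)) (POb P X)"
    "\<And>X a. X \<in> Obj C \<Longrightarrow> a \<in> A X \<Longrightarrow> \<alpha> X (cls X a) = f X a" by metis
  show ?L unfolding presheaf_iso_def
  proof (intro exI[of _ \<alpha>] conjI ballI)
    show "bij_betw (\<alpha> X) (POb (quotient_presheaf C A r t) X) (POb P X)" if "X \<in> Obj C" for X
      using \<alpha>(1)[OF that] that by (simp add: quotient_presheaf_def)
    fix h x assume h: "h \<in> Arr C" and "x \<in> POb (quotient_presheaf C A r t) (Cod C h)"
    then obtain a where a: "a \<in> A (Cod C h)" "x = cls (Cod C h) a"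
      using Cod_in[OF h] by (auto simp: quotient_presheaf_def elim: quotientE)
    then show "\<alpha> (Dom C h) (PAr (quotient_presheaf C A r t) h x) = PAr P h (\<alpha> (Cod C h) x)"
      by (simp add: quotient_act h \<alpha>(2) Dom_in Cod_in t_in f(2))
  qed
qed

lemma is_presheaf_quotient:
  assumes sm: "\<And>X. X \<in> Obj C \<Longrightarrow> small \<kappa> (A X)"
    and t_Ide: "\<And>X a. X \<in> Obj C \<Longrightarrow> a \<in> A X \<Longrightarrow> t (Ide C X) a = a"
    and t_Comp: "\<And>f g a. f \<in> Arr C \<Longrightarrow> g \<in> Arr C \<Longrightarrow> Cod C f = Dom C g \<Longrightarrow> a \<in> A (Cod C g) \<Longrightarrow>
      t (Comp C g f) a = t f (t g a)"
  shows "is_presheaf \<kappa> C (quotient_presheaf C A r t)"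
proof -
  let ?P = "quotient_presheaf C A r t"
  have ob: "POb ?P X = A X // equiv_gen (A X) (r X)" if "X \<in> Obj C" for X
    using that by (simp add: quotient_presheaf_def)
  have el: "\<exists>a\<in>A X. x = cls X a" if "X \<in> Obj C" "x \<in> POb ?P X" for X x
    using that by (auto simp: ob elim: quotientE)
  have act: "PAr ?P f \<in> POb ?P (Cod C f) \<rightarrow>\<^sub>E POb ?P (Dom C f)" if f: "f \<in> Arr C" for f
  proof
    fix x assume "x \<in> POb ?P (Cod C f)"
    then obtain a where "a \<in> A (Cod C f)" "x = cls (Cod C f) a" using el[OF Cod_in[OF f]] by blast
    then show "PAr ?P f x \<in> POb ?P (Dom C f)"
      using f by (simp add: quotient_act ob Dom_in t_in quotientI)
  next
    fix x assume "x \<notin> POb ?P (Cod C f)"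
    then show "PAr ?P f x = undefined" using f Cod_in[OF f] by (auto simp: quotient_presheaf_def mk_presheaf_def)
  qed
  show ?thesis unfolding is_presheaf_def
  proof (intro conjI ballI impI)
    show "POb ?P \<in> extensional (Obj C)" by (auto simp: quotient_presheaf_def mk_presheaf_def)
    show "PAr ?P \<in> (\<Pi>\<^sub>E f\<in>Arr C. POb ?P (Cod C f) \<rightarrow>\<^sub>E POb ?P (Dom C f))"
      by (rule PiE_I[OF act]) (auto simp: quotient_presheaf_def mk_presheaf_def)
    show "small \<kappa> (POb ?P X)" if X: "X \<in> Obj C" for X
    proof -
      have "POb ?P X = cls X ` A X" unfolding ob[OF X] quotient_def by auto
      then show ?thesis using small_image[OF sm[OF X]] by simp
    qed
    show "PAr ?P (Ide C X) x = x" if X: "X \<in> Obj C" "x \<in> POb ?P X" for X x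
    proof -
      obtain a where a: "a \<in> A X" "x = cls X a" using el[OF X] by blast
      have "Ide C X \<in> Arr C" "Dom C (Ide C X) = X" "Cod C (Ide C X) = X"
        using Ide_in[OF X(1)] by (auto simp: hom_def)
      then show ?thesis using quotient_act[of "Ide C X" a] a t_Ide[OF X(1)] by simp
    qed
    fix f g x assume fg: "f \<in> Arr C" "g \<in> Arr C" "Cod C f = Dom C g" "x \<in> POb ?P (Cod C g)"
    then obtain a where a: "a \<in> A (Cod C g)" "x = cls (Cod C g) a" using el[OF Cod_in] by blast
    have "Comp C g f \<in> Arr C" "Dom C (Comp C g f) = Dom C f" "Cod C (Comp C g f) = Cod C g"
      using Comp_in[of f "Dom C f" "Dom C g" g "Cod C g"] fg by (auto simp: hom_def)
    then show "PAr ?P (Comp C g f) x = PAr ?P f (PAr ?P g x)"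
      using quotient_act[of "Comp C g f" a] quotient_act[of g a] quotient_act[of f "t g a"] fg a t_Comp t_in[of g a]
      by simp
  qed
qed

end

text \<open>Quotient presheaves take values in sets of sets of pairs, but objects of
  \<open>PSh\<close> must have values in \<open>'k\<close>. The encodings at the various objects can
  be chosen independently, since the action is carried along them.\<close>

lemma presheaf_copy:
  fixes \<kappa> :: "'k rel" and P :: "('o, 'a, 'v) presheaf"
  assumes "category C" and P: "is_presheaf \<kappa> C P"
  obtains P' :: "('o, 'a, 'k) presheaf" where "is_presheaf \<kappa> C P'" "presheaf_iso C P P'"
proof -
  interpret category C by fact
  have "\<forall>X\<in>Obj C. \<exists>f :: 'v \<Rightarrow> 'k. inj_on f (POb P X)"
    using P small_encode unfolding is_presheaf_def by metis
  then obtain f :: "'o \<Rightarrow> 'v \<Rightarrow> 'k" where f: "\<And>X. X \<in> Obj C \<Longrightarrow> inj_on (f X) (POb P X)" by metis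
  let ?g = "\<lambda>X. inv_into (POb P X) (f X)"
  define P' where "P' = mk_presheaf C (\<lambda>X. f X ` POb P X) (\<lambda>h y. f (Dom C h) (PAr P h (?g (Cod C h) y)))"
  have act: "PAr P h x \<in> POb P (Dom C h)" if "h \<in> Arr C" "x \<in> POb P (Cod C h)" for h x
    using P that unfolding is_presheaf_def by (meson PiE_mem)
  have ob: "POb P' X = f X ` POb P X" if "X \<in> Obj C" for X using that by (simp add: P'_def)
  have nat: "PAr P' h (f (Cod C h) x) = f (Dom C h) (PAr P h x)" if "h \<in> Arr C" "x \<in> POb P (Cod C h)" for h x
    using that f[OF Cod_in] by (simp add: P'_def)
  have "is_presheaf \<kappa> C P'" unfolding is_presheaf_def
  proof (intro conjI ballI impI)
    show "POb P' \<in> extensional (Obj C)" by (auto simp: P'_def mk_presheaf_def)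
    show "small \<kappa> (POb P' X)" if "X \<in> Obj C" for X
      using that P small_image unfolding is_presheaf_def by (metis ob)
    show "PAr P' \<in> (\<Pi>\<^sub>E f\<in>Arr C. POb P' (Cod C f) \<rightarrow>\<^sub>E POb P' (Dom C f))"
    proof (intro PiE_I)
      fix h y assume h: "h \<in> Arr C"
      show "PAr P' h y \<in> POb P' (Dom C h)" if "y \<in> POb P' (Cod C h)"
        using that nat[OF h] act[OF h] by (auto simp: ob Dom_in Cod_in h)
      show "PAr P' h y = undefined" if "y \<notin> POb P' (Cod C h)"
        using that h Cod_in[OF h] by (simp add: P'_def mk_presheaf_def)
    qed (simp add: P'_def mk_presheaf_def)
    show "PAr P' (Ide C X) y = y" if X: "X \<in> Obj C" and y: "y \<in> POb P' X" for X y
    proof -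
      obtain x where x: "x \<in> POb P X" "y = f X x" using y by (auto simp: ob X)
      have "Ide C X \<in> Arr C" "Dom C (Ide C X) = X" "Cod C (Ide C X) = X"
        using Ide_in[OF X] by (auto simp: hom_def)
      then show ?thesis using nat[of "Ide C X" x] x P X unfolding is_presheaf_def by simp
    qed
    fix h k y assume hk: "h \<in> Arr C" "k \<in> Arr C" "Cod C h = Dom C k" and y: "y \<in> POb P' (Cod C k)"
    obtain x where x: "x \<in> POb P (Cod C k)" "y = f (Cod C k) x" using y by (auto simp: ob Cod_in hk)
    have "Comp C k h \<in> Arr C" "Dom C (Comp C k h) = Dom C h" "Cod C (Comp C k h) = Cod C k"
      using Comp_in[of h "Dom C h" "Dom C k" k "Cod C k"] hk by (auto simp: hom_def)
    moreover have "PAr P (Comp C k h) x = PAr P h (PAr P k x)" using P hk x unfolding is_presheaf_def by blast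
    ultimately show "PAr P' (Comp C k h) y = PAr P' h (PAr P' k y)"
      using nat[of "Comp C k h" x] nat[of k x] nat[of h "PAr P k x"] x hk act[of k x] by simp
  qed
  moreover have "presheaf_iso C P P'" unfolding presheaf_iso_def
  proof (intro exI[of _ f] conjI ballI)
    show "bij_betw (f X) (POb P X) (POb P' X)" if "X \<in> Obj C" for X
      using f[OF that] by (simp add: bij_betw_def ob that)
  qed (simp add: nat)
  ultimately show ?thesis using that by blast
qed


section \<open>Categories, functors and presheaves\<close>

lemma homD: "f \<in> hom C X Y \<Longrightarrow> f \<in> Arr C \<and> Dom C f = X \<and> Cod C f = Y"
  by (simp add: hom_def)

lemma homI: "f \<in> Arr C \<Longrightarrow> f \<in> hom C (Dom C f) (Cod C f)"
  by (simp add: hom_def)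

lemma (in category) hom_Obj: "f \<in> hom C X Y \<Longrightarrow> X \<in> Obj C \<and> Y \<in> Obj C"
  using Dom_in Cod_in by (auto simp: hom_def)

lemma functor_Obj: "is_functor C D F \<Longrightarrow> X \<in> Obj C \<Longrightarrow> FOb F X \<in> Obj D"
  unfolding is_functor_def by blast

lemma functor_hom: "is_functor C D F \<Longrightarrow> f \<in> hom C X Y \<Longrightarrow> FAr F f \<in> hom D (FOb F X) (FOb F Y)"
  unfolding is_functor_def hom_def by blast

lemma functor_Ide: "is_functor C D F \<Longrightarrow> X \<in> Obj C \<Longrightarrow> FAr F (Ide C X) = Ide D (FOb F X)"
  unfolding is_functor_def by blast

lemma functor_Comp:
  "is_functor C D F \<Longrightarrow> f \<in> hom C X Y \<Longrightarrow> g \<in> hom C Y Z \<Longrightarrow> FAr F (Comp C g f) = Comp D (FAr F g) (FAr F f)"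
  unfolding is_functor_def hom_def by auto

lemma is_functorI:
  assumes "\<And>X. X \<in> Obj C \<Longrightarrow> FOb F X \<in> Obj D"
    and "\<And>X. X \<in> Obj C \<Longrightarrow> FAr F (Ide C X) = Ide D (FOb F X)"
    and "\<And>f X Y. f \<in> hom C X Y \<Longrightarrow> FAr F f \<in> hom D (FOb F X) (FOb F Y)"
    and "\<And>f g X Y Z. f \<in> hom C X Y \<Longrightarrow> g \<in> hom C Y Z \<Longrightarrow> FAr F (Comp C g f) = Comp D (FAr F g) (FAr F f)"
  shows "is_functor C D F"
  unfolding is_functor_def using assms by (fastforce simp: hom_def)

lemma fcomp_simps [simp]: "FOb (fcomp G F) X = FOb G (FOb F X)" "FAr (fcomp G F) f = FAr G (FAr F f)"
  by (simp_all add: fcomp_def)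

lemma functor_fcomp:
  assumes F: "is_functor A B F" and G: "is_functor B C G"
  shows "is_functor A C (fcomp G F)"
proof (rule is_functorI)
  fix f g X Y Z assume f: "f \<in> hom A X Y" and g: "g \<in> hom A Y Z"
  show "FAr (fcomp G F) (Comp A g f) = Comp C (FAr (fcomp G F) g) (FAr (fcomp G F) f)"
    using functor_Comp[OF F f g] functor_Comp[OF G functor_hom[OF F f] functor_hom[OF F g]] by simp
qed (simp_all add: functor_Obj[OF F] functor_Obj[OF G] functor_Ide[OF F] functor_Ide[OF G]
      functor_hom[OF F] functor_hom[OF G])

lemma presheaf_act: "is_presheaf \<kappa> C P \<Longrightarrow> f \<in> hom C X Y \<Longrightarrow> x \<in> POb P Y \<Longrightarrow> PAr P f x \<in> POb P X"
  unfolding is_presheaf_def hom_def by (auto dest: PiE_mem)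

lemma presheaf_Ide: "is_presheaf \<kappa> C P \<Longrightarrow> X \<in> Obj C \<Longrightarrow> x \<in> POb P X \<Longrightarrow> PAr P (Ide C X) x = x"
  unfolding is_presheaf_def by blast

lemma presheaf_Comp:
  "is_presheaf \<kappa> C P \<Longrightarrow> f \<in> hom C X Y \<Longrightarrow> g \<in> hom C Y Z \<Longrightarrow> x \<in> POb P Z \<Longrightarrow>
    PAr P (Comp C g f) x = PAr P f (PAr P g x)"
  unfolding is_presheaf_def hom_def by auto

lemma presheaf_small: "is_presheaf \<kappa> C P \<Longrightarrow> X \<in> Obj C \<Longrightarrow> small \<kappa> (POb P X)"
  unfolding is_presheaf_def by blast

text \<open>Needed because the theorem asks for small categories with objects and arrows in
  \<open>'k\<close>, while the constructions produce tuples. Bijectivity of \<open>I\<close> on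
  objects and arrows stands in for an inverse functor.\<close>

lemma category_copy:
  fixes \<kappa> :: "'k rel"
  assumes "category J" and so: "small \<kappa> (Obj J)" and sa: "small \<kappa> (Arr J)"
  obtains J' :: "('k, 'k) cat" and I where "small_category \<kappa> J'" "is_functor J' J I"
    "bij_betw (FOb I) (Obj J') (Obj J)" "bij_betw (FAr I) (Arr J') (Arr J)"
proof -
  interpret J: category J by fact
  obtain f :: "'a \<Rightarrow> 'k" where f: "inj_on f (Obj J)" using small_encode[OF so] by blast
  obtain g :: "'b \<Rightarrow> 'k" where g: "inj_on g (Arr J)" using small_encode[OF sa] by blast
  define fi gi where "fi = inv_into (Obj J) f" and "gi = inv_into (Arr J) g"
  have fi [simp]: "fi (f X) = X" if "X \<in> Obj J" for X using that f by (simp add: fi_def)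
  have gi [simp]: "gi (g u) = u" if "u \<in> Arr J" for u using that g by (simp add: gi_def)
  define J' where "J' = \<lparr>Obj = f ` Obj J, Arr = g ` Arr J, Dom = \<lambda>a. f (Dom J (gi a)), Cod = \<lambda>a. f (Cod J (gi a)),
    Ide = \<lambda>X. g (Ide J (fi X)), Comp = \<lambda>b a. g (Comp J (gi b) (gi a))\<rparr>"
  define I where "I = \<lparr>FOb = fi, FAr = gi\<rparr>"
  have homJ': "v \<in> hom J' A B \<longleftrightarrow> (\<exists>X Y u. v = g u \<and> A = f X \<and> B = f Y \<and> u \<in> hom J X Y)" for v A B
    by (auto simp: J'_def hom_def)
  have feq: "f X = f Y \<longleftrightarrow> X = Y" if "X \<in> Obj J" "Y \<in> Obj J" for X Y
    using f that by (auto dest: inj_onD)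
  have comp: "Comp J' (g v) (g u) = g (Comp J v u)" if "u \<in> hom J X Y" "v \<in> hom J Z W" for u v X Y Z W
    using homD[OF that(1)] homD[OF that(2)] by (simp add: J'_def)
  have ide: "Ide J' (f X) = g (Ide J X)" if "X \<in> Obj J" for X using that by (simp add: J'_def)
  have "category J'"
  proof
    show "Dom J' a \<in> Obj J'" "Cod J' a \<in> Obj J'" if "a \<in> Arr J'" for a
      using that J.Dom_in J.Cod_in by (auto simp: J'_def)
    show "Ide J' X \<in> hom J' X X" if "X \<in> Obj J'" for X
      using that J.Ide_in unfolding homJ' by (fastforce simp: J'_def)
  next
    fix u X Y assume "u \<in> hom J' X Y"
    then show "Comp J' u (Ide J' X) = u" "Comp J' (Ide J' Y) u = u"
      unfolding homJ' using J.hom_Obj by (auto simp: ide comp[OF J.Ide_in] comp[OF _ J.Ide_in] J.Comp_Ide J.Ide_Comp)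
  next
    fix u v X Y Z assume "u \<in> hom J' X Y" "v \<in> hom J' Y Z"
    then obtain x y y' z u' v' where *: "u = g u'" "v = g v'" "X = f x" "Y = f y" "Y = f y'" "Z = f z"
      "u' \<in> hom J x y" "v' \<in> hom J y' z" unfolding homJ' by blast
    then have "y = y'" using feq J.hom_Obj by metis
    then show "Comp J' v u \<in> hom J' X Z"
      using * J.Comp_in unfolding homJ' by (metis comp)
  next
    fix u v w X Y Z W assume "u \<in> hom J' W X" "v \<in> hom J' X Y" "w \<in> hom J' Y Z"
    then obtain a b b' c c' d u' v' w' where *: "u = g u'" "v = g v'" "w = g w'" "X = f b" "X = f b'" "Y = f c" "Y = f c'"
      "u' \<in> hom J a b" "v' \<in> hom J b' c" "w' \<in> hom J c' d" unfolding homJ' by blast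
    then have "b = b'" "c = c'" using feq J.hom_Obj by metis+
    with * have h: "u' \<in> hom J a b" "v' \<in> hom J b c" "w' \<in> hom J c d" by auto
    show "Comp J' w (Comp J' v u) = Comp J' (Comp J' w v) u"
      using * comp[OF h(1,2)] comp[OF h(2,3)] comp[OF J.Comp_in[OF h(1,2)] h(3)]
        comp[OF h(1) J.Comp_in[OF h(2,3)]] J.Comp_assoc[OF h] by simp
  qed
  moreover have "small \<kappa> (Obj J')" "small \<kappa> (Arr J')" using so sa by (simp_all add: J'_def small_image)
  ultimately have "small_category \<kappa> J'" by (simp add: small_category_def)
  moreover have "is_functor J' J I"
  proof (rule is_functorI)
    fix X assume "X \<in> Obj J'"
    then obtain x where x: "x \<in> Obj J" "X = f x" by (auto simp: J'_def)
    then have "Ide J x \<in> Arr J" using homD[OF J.Ide_in] by blast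
    then show "FOb I X \<in> Obj J" "FAr I (Ide J' X) = Ide J (FOb I X)" using x by (simp_all add: I_def ide)
  next
    fix u X Y assume "u \<in> hom J' X Y"
    then show "FAr I u \<in> hom J (FOb I X) (FOb I Y)"
      unfolding homJ' using J.hom_Obj homD by (fastforce simp: I_def)
  next
    fix u v X Y Z assume "u \<in> hom J' X Y" "v \<in> hom J' Y Z"
    then obtain x y y' z u' v' where *: "u = g u'" "v = g v'" "X = f x" "Y = f y" "Y = f y'" "Z = f z"
      "u' \<in> hom J x y" "v' \<in> hom J y' z" unfolding homJ' by blast
    then have "y = y'" using feq J.hom_Obj by metis
    with * have "Comp J v' u' \<in> hom J x z" using J.Comp_in by blast
    then show "FAr I (Comp J' v u) = Comp J (FAr I v) (FAr I u)"
      using * homD by (simp add: I_def comp[OF *(7,8)] homD[THEN conjunct1])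
  qed
  moreover have "bij_betw (FOb I) (Obj J') (Obj J)" "bij_betw (FAr I) (Arr J') (Arr J)"
    using f g by (simp_all add: I_def J'_def fi_def gi_def bij_betw_inv_into inj_on_imp_bij_betw)
  ultimately show ?thesis using that by blast
qed


section \<open>Colimits of representables\<close>

text \<open>
  \<open>P\<close> is the colimit of the representables \<open>hom(-, D j)\<close>; the cocone is given, according to Yoneda, by
  elements \<open>x j\<close> of \<open>P(D j)\<close>.
\<close>

definition presented_by ::
  "('j, 'i) cat \<Rightarrow> ('o, 'a) cat \<Rightarrow> ('j, 'i, 'o, 'a) func \<Rightarrow> ('o, 'a, 'v) presheaf \<Rightarrow> ('j \<Rightarrow> 'v) \<Rightarrow> bool" where
  "presented_by J C D P x \<longleftrightarrow>
     (\<forall>j\<in>Obj J. x j \<in> POb P (FOb D j)) \<and>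
     (\<forall>X\<in>Obj C. set_colimit J (\<lambda>j. hom C X (FOb D j)) (\<lambda>u. Comp C (FAr D u)) (\<lambda>j f. PAr P f (x j)) (POb P X))"

lemma presented_by_in: "presented_by J C D P x \<Longrightarrow> j \<in> Obj J \<Longrightarrow> x j \<in> POb P (FOb D j)"
  unfolding presented_by_def by blast

lemma presented_by_ex:
  assumes "presented_by J C D P x" "X \<in> Obj C" "y \<in> POb P X"
  obtains j f where "j \<in> Obj J" "f \<in> hom C X (FOb D j)" "y = PAr P f (x j)"
proof -
  have "set_colimit J (\<lambda>j. hom C X (FOb D j)) (\<lambda>u. Comp C (FAr D u)) (\<lambda>j f. PAr P f (x j)) (POb P X)"
    using assms(1,2) unfolding presented_by_def by blast
  from set_colimit_ex[OF this assms(3)] show ?thesis using that by metis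
qed

lemma hom_set_diagram:
  assumes "category C" "category J" "is_functor J C D"
  shows "set_diagram J (\<lambda>j. hom C X (FOb D j)) (\<lambda>u. Comp C (FAr D u))"
  unfolding set_diagram_def
  using category.Dom_in[OF assms(2)] category.Cod_in[OF assms(2)] category.Comp_in[OF assms(1)]
    functor_hom[OF assms(3) homI] by blast

text \<open>Yoneda: this is the cocone condition evaluated at the identity of
  \<open>FOb D j\<close>.\<close>

lemma presented_by_eq:
  assumes C: "category C" and J: "category J" and D: "is_functor J C D" and P: "is_presheaf \<kappa> C P"
    and x: "presented_by J C D P x" and u: "u \<in> hom J j j'"
  shows "PAr P (FAr D u) (x j') = x j"
proof -
  have j: "j \<in> Obj J" "j' \<in> Obj J" using category.hom_Obj[OF J u] by auto
  have Dj: "FOb D j \<in> Obj C" using functor_Obj[OF D j(1)] .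
  have "set_cocone J (\<lambda>i. hom C (FOb D j) (FOb D i)) (\<lambda>u. Comp C (FAr D u)) (\<lambda>i f. PAr P f (x i))"
    using set_colimit_cocone[OF hom_set_diagram[OF C J D]] x Dj unfolding presented_by_def by blast
  from set_coconeD[OF this, of u "Ide C (FOb D j)"] show ?thesis
    using homD[OF u] category.Ide_in[OF C Dj] category.Comp_Ide[OF C functor_hom[OF D u]]
      presheaf_Ide[OF P Dj presented_by_in[OF x j(1)]] by simp
qed

lemma presented_by_factor:
  assumes x: "presented_by J C D P x" and X: "X \<in> Obj C"
    and \<phi>: "\<And>u j j' f. u \<in> hom J j j' \<Longrightarrow> f \<in> hom C X (FOb D j) \<Longrightarrow> \<phi> j' (Comp C (FAr D u) f) = \<phi> j f"
    and "j \<in> Obj J" "f \<in> hom C X (FOb D j)" "j' \<in> Obj J" "f' \<in> hom C X (FOb D j')"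
    and "PAr P f (x j) = PAr P f' (x j')"
  shows "\<phi> j f = \<phi> j' f'"
proof -
  have "set_colimit J (\<lambda>j. hom C X (FOb D j)) (\<lambda>u. Comp C (FAr D u)) (\<lambda>j f. PAr P f (x j)) (POb P X)"
    using x X unfolding presented_by_def by blast
  moreover have "set_cocone J (\<lambda>j. hom C X (FOb D j)) (\<lambda>u. Comp C (FAr D u)) \<phi>"
    by (rule set_coconeI) (rule \<phi>[OF homI])
  ultimately show ?thesis by (rule set_colimit_factor) (rule assms)+
qed

lemma presented_by_lift:
  assumes x: "presented_by J C D P x" and X: "X \<in> Obj C"
    and \<phi>: "\<And>u j j' f. u \<in> hom J j j' \<Longrightarrow> f \<in> hom C X (FOb D j) \<Longrightarrow> \<phi> j' (Comp C (FAr D u) f) = \<phi> j f"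
  shows "\<exists>g. \<forall>j\<in>Obj J. \<forall>f\<in>hom C X (FOb D j). g (PAr P f (x j)) = \<phi> j f"
proof -
  have "set_colimit J (\<lambda>j. hom C X (FOb D j)) (\<lambda>u. Comp C (FAr D u)) (\<lambda>j f. PAr P f (x j)) (POb P X)"
    using x X unfolding presented_by_def by blast
  moreover have "set_cocone J (\<lambda>j. hom C X (FOb D j)) (\<lambda>u. Comp C (FAr D u)) \<phi>"
    by (rule set_coconeI) (rule \<phi>[OF homI])
  ultimately show ?thesis by (rule set_colimit_lift)
qed

text \<open>Colimits of presheaves are computed at each object, so a test \<phi> belongs to one
  fixed \<open>X\<close> and no naturality in \<open>X\<close> is asked of it. The cocone condition
  at every \<open>X\<close> follows from \<open>nat\<close> by functoriality of
  \<open>P\<close>.\<close>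

lemma presented_byI:
  assumes C: "category C" and J: "category J" and D: "is_functor J C D" and P: "is_presheaf \<kappa> C P"
    and x: "\<And>j. j \<in> Obj J \<Longrightarrow> x j \<in> POb P (FOb D j)"
    and nat: "\<And>u j j'. u \<in> hom J j j' \<Longrightarrow> PAr P (FAr D u) (x j') = x j"
    and onto: "\<And>X y. X \<in> Obj C \<Longrightarrow> y \<in> POb P X \<Longrightarrow> \<exists>j\<in>Obj J. \<exists>f\<in>hom C X (FOb D j). y = PAr P f (x j)"
    and univ: "\<And>(\<phi> :: 'j \<Rightarrow> 'a \<Rightarrow> bool) X j f j' f'. X \<in> Obj C \<Longrightarrow>
      (\<And>u j j' f. u \<in> hom J j j' \<Longrightarrow> f \<in> hom C X (FOb D j) \<Longrightarrow> \<phi> j' (Comp C (FAr D u) f) = \<phi> j f) \<Longrightarrow>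
      j \<in> Obj J \<Longrightarrow> f \<in> hom C X (FOb D j) \<Longrightarrow> j' \<in> Obj J \<Longrightarrow> f' \<in> hom C X (FOb D j') \<Longrightarrow>
      PAr P f (x j) = PAr P f' (x j') \<Longrightarrow> \<phi> j f = \<phi> j' f'"
  shows "presented_by J C D P x"
  unfolding presented_by_def
proof (intro conjI ballI)
  fix X assume X: "X \<in> Obj C"
  show "set_colimit J (\<lambda>j. hom C X (FOb D j)) (\<lambda>u. Comp C (FAr D u)) (\<lambda>j f. PAr P f (x j)) (POb P X)"
  proof (rule set_colimitI[OF hom_set_diagram[OF C J D]])
    show "set_cocone J (\<lambda>j. hom C X (FOb D j)) (\<lambda>u. Comp C (FAr D u)) (\<lambda>j f. PAr P f (x j))"
    proof (rule set_coconeI)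
      fix u f assume u: "u \<in> Arr J" and f: "f \<in> hom C X (FOb D (Dom J u))"
      show "PAr P (Comp C (FAr D u) f) (x (Cod J u)) = PAr P f (x (Dom J u))"
        using presheaf_Comp[OF P f functor_hom[OF D homI[OF u]] x[OF category.Cod_in[OF J u]]] nat[OF homI[OF u]] by simp
    qed
    show "\<And>j f. j \<in> Obj J \<Longrightarrow> f \<in> hom C X (FOb D j) \<Longrightarrow> PAr P f (x j) \<in> POb P X"
      using presheaf_act[OF P] x by blast
  next
    fix \<phi> :: "'j \<Rightarrow> 'a \<Rightarrow> bool" and j f j' f'
    assume \<phi>: "set_cocone J (\<lambda>j. hom C X (FOb D j)) (\<lambda>u. Comp C (FAr D u)) \<phi>"
      and *: "j \<in> Obj J" "f \<in> hom C X (FOb D j)" "j' \<in> Obj J" "f' \<in> hom C X (FOb D j')"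
        "PAr P f (x j) = PAr P f' (x j')"
    show "\<phi> j f = \<phi> j' f'"
    proof (rule univ[OF X _ *])
      show "\<phi> i' (Comp C (FAr D u) k) = \<phi> i k" if "u \<in> hom J i i'" "k \<in> hom C X (FOb D i)" for u i i' k
        using set_coconeD[OF \<phi>, of u k] homD[OF that(1)] that(2) by simp
    qed
  qed (rule onto[OF X])
qed (rule x)

text \<open>The inverse of \<open>I\<close> on objects turns a test on \<open>J'\<close> into one on
  \<open>J\<close>. Surjectivity of \<open>I\<close> on arrows makes the result compatible with
  every arrow of \<open>J\<close>.\<close>

lemma presented_by_copy:
  fixes J :: "('j, 'i) cat" and J' :: "('l, 'm) cat" and C :: "('o, 'a) cat"
  assumes C: "category C" and J: "category J" and D: "is_functor J C D" and P: "is_presheaf \<kappa> C P"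
    and J': "category J'" and I: "is_functor J' J I"
    and bo: "bij_betw (FOb I) (Obj J') (Obj J)" and ba: "bij_betw (FAr I) (Arr J') (Arr J)"
    and x: "presented_by J C D P x"
  shows "presented_by J' C (fcomp D I) P (\<lambda>j. x (FOb I j))"
proof (rule presented_byI[OF C J' functor_fcomp[OF I D] P])
  show "\<And>j. j \<in> Obj J' \<Longrightarrow> x (FOb I j) \<in> POb P (FOb (fcomp D I) j)"
    using presented_by_in[OF x functor_Obj[OF I]] by simp
  show "PAr P (FAr (fcomp D I) u) (x (FOb I j')) = x (FOb I j)" if "u \<in> hom J' j j'" for u j j'
    using presented_by_eq[OF C J D P x functor_hom[OF I that]] by simp
  show "\<exists>j\<in>Obj J'. \<exists>f\<in>hom C X (FOb (fcomp D I) j). y = PAr P f (x (FOb I j))"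
    if X: "X \<in> Obj C" "y \<in> POb P X" for X y
  proof -
    obtain j f where j: "j \<in> Obj J" "f \<in> hom C X (FOb D j)" "y = PAr P f (x j)"
      using presented_by_ex[OF x X] by metis
    moreover obtain j' where "j' \<in> Obj J'" "j = FOb I j'" using bo j(1) unfolding bij_betw_def by blast
    ultimately show ?thesis by (auto intro!: bexI[of _ j'] bexI[of _ f])
  qed
next
  fix \<phi> :: "'l \<Rightarrow> 'a \<Rightarrow> bool" and X j f j' f'
  assume X: "X \<in> Obj C"
    and \<phi>: "\<And>u j j' f. u \<in> hom J' j j' \<Longrightarrow> f \<in> hom C X (FOb (fcomp D I) j) \<Longrightarrow> \<phi> j' (Comp C (FAr (fcomp D I) u) f) = \<phi> j f"
    and j: "j \<in> Obj J'" "f \<in> hom C X (FOb (fcomp D I) j)" "j' \<in> Obj J'" "f' \<in> hom C X (FOb (fcomp D I) j')"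
    and eq: "PAr P f (x (FOb I j)) = PAr P f' (x (FOb I j'))"
  define i where "i = inv_into (Obj J') (FOb I)"
  have i: "i (FOb I a) = a" if "a \<in> Obj J'" for a using bij_betw_inv_into_left[OF bo that] by (simp add: i_def)
  have "\<phi> (i (FOb I j)) f = \<phi> (i (FOb I j')) f'"
  proof (rule presented_by_factor[OF x X _ _ _ _ _ eq])
    fix u a b k assume u: "u \<in> hom J a b" and k: "k \<in> hom C X (FOb D a)"
    obtain v where v: "v \<in> Arr J'" "u = FAr I v" using homD[OF u] ba unfolding bij_betw_def by blast
    have "FOb I (Dom J' v) = a" "FOb I (Cod J' v) = b"
      using homD[OF functor_hom[OF I homI[OF v(1)]]] homD[OF u] v(2) by auto
    then show "\<phi> (i b) (Comp C (FAr D u) k) = \<phi> (i a) k"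
      using \<phi>[OF homI[OF v(1)], of k] k v i category.Dom_in[OF J' v(1)] category.Cod_in[OF J' v(1)] by auto
  qed (use j functor_Obj[OF I] in auto)
  then show "\<phi> j f = \<phi> j' f'" using i j by simp
qed

abbreviation image_gen :: "('j, 'i) cat \<Rightarrow> ('o, 'a) cat \<Rightarrow> ('j, 'i, 'o, 'a) func \<Rightarrow> 'o \<Rightarrow> ('j \<times> 'a) rel" where
  "image_gen J C D X \<equiv> colim_gen J (\<lambda>j. hom C X (FOb D j)) (\<lambda>u. Comp C (FAr D u))"

lemma image_presheaf_eq:
  "image_presheaf J C D =
    quotient_presheaf C (\<lambda>X. SIGMA j:Obj J. hom C X (FOb D j)) (image_gen J C D) (\<lambda>h (j, f). (j, Comp C f h))"
  unfolding image_presheaf_def quotient_presheaf_def image_rel_def set_colim_def colim_rel_def colim_gen_def ..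

lemma quotient_data_image:
  assumes C: "category C" and J: "category J" and D: "is_functor J C D"
  shows "quotient_data C (\<lambda>X. SIGMA j:Obj J. hom C X (FOb D j)) (image_gen J C D) (\<lambda>h (j, f). (j, Comp C f h))"
proof -
  interpret category C by fact
  show ?thesis
  proof
    show "image_gen J C D X \<subseteq> (SIGMA j:Obj J. hom C X (FOb D j)) \<times> (SIGMA j:Obj J. hom C X (FOb D j))" for X
      by (rule colim_gen_subset[OF hom_set_diagram[OF assms]])
    fix h assume h: "h \<in> Arr C"
    show "(case a of (j, f) \<Rightarrow> (j, Comp C f h)) \<in> (SIGMA j:Obj J. hom C (Dom C h) (FOb D j))"
      if "a \<in> (SIGMA j:Obj J. hom C (Cod C h) (FOb D j))" for a
      using that Comp_in[OF homI[OF h]] by auto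
    fix a a' assume "(a, a') \<in> image_gen J C D (Cod C h)"
    then obtain u f where u: "u \<in> Arr J" "f \<in> hom C (Cod C h) (FOb D (Dom J u))"
      "a = (Dom J u, f)" "a' = (Cod J u, Comp C (FAr D u) f)" unfolding colim_gen_def by blast
    then show "(case a of (j, f) \<Rightarrow> (j, Comp C f h), case a' of (j, f) \<Rightarrow> (j, Comp C f h)) \<in> image_gen J C D (Dom C h)"
      using Comp_assoc[OF homI[OF h] u(2) functor_hom[OF D homI[OF u(1)]]] Comp_in[OF homI[OF h] u(2)]
      unfolding colim_gen_def by auto
  qed
qed

text \<open>By Yoneda a natural family of maps out of the representables is determined by the images
  of the identities, and these are the generators \<open>x j\<close>.\<close>

lemma image_presheaf_iso_iff:
  assumes C: "category C" and J: "category J" and D: "is_functor J C D" and P: "is_presheaf \<kappa> C P"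
  shows "presheaf_iso C (image_presheaf J C D) P \<longleftrightarrow> (\<exists>x. presented_by J C D P x)"
proof -
  interpret category C by fact
  note iff = quotient_data.quotient_presheaf_iso_iff[OF quotient_data_image[OF C J D], folded image_presheaf_eq]
  show ?thesis
  proof
    assume "presheaf_iso C (image_presheaf J C D) P"
    then obtain f where
      f: "\<And>X. X \<in> Obj C \<Longrightarrow> presents (SIGMA j:Obj J. hom C X (FOb D j)) (image_gen J C D X) (f X) (POb P X)"
      and nat: "\<And>h a. h \<in> Arr C \<Longrightarrow> a \<in> (SIGMA j:Obj J. hom C (Cod C h) (FOb D j)) \<Longrightarrow>
        f (Dom C h) (case a of (j, k) \<Rightarrow> (j, Comp C k h)) = PAr P h (f (Cod C h) a)"
      unfolding iff by blast
    define x where "x j = f (FOb D j) (j, Ide C (FOb D j))" for j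
    have xin: "x j \<in> POb P (FOb D j)" if "j \<in> Obj J" for j
      unfolding x_def by (rule presents_in[OF f]) (use that functor_Obj[OF D] Ide_in in auto)
    have fx: "f X (j, k) = PAr P k (x j)" if "j \<in> Obj J" "k \<in> hom C X (FOb D j)" for X j k
      using nat[of k "(j, Ide C (FOb D j))"] that homD[OF that(2)] Ide_in[OF functor_Obj[OF D that(1)]] Ide_Comp[OF that(2)]
      by (auto simp: x_def)
    have "set_colimit J (\<lambda>j. hom C X (FOb D j)) (\<lambda>u. Comp C (FAr D u)) (\<lambda>j k. PAr P k (x j)) (POb P X)"
      if X: "X \<in> Obj C" for X
    proof -
      have "presents (SIGMA j:Obj J. hom C X (FOb D j)) (image_gen J C D X) (f X) (POb P X) \<longleftrightarrow>
        presents (SIGMA j:Obj J. hom C X (FOb D j)) (image_gen J C D X) (\<lambda>(j, k). PAr P k (x j)) (POb P X)"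
        by (rule presents_cong) (auto simp: fx)
      then show ?thesis using f[OF X] by (simp add: set_colimit_def)
    qed
    then show "\<exists>x. presented_by J C D P x" unfolding presented_by_def using xin by blast
  next
    assume "\<exists>x. presented_by J C D P x"
    then obtain x where x: "presented_by J C D P x" by blast
    show "presheaf_iso C (image_presheaf J C D) P" unfolding iff
    proof (intro exI[of _ "\<lambda>X (j, k). PAr P k (x j)"] conjI ballI)
      show "presents (SIGMA j:Obj J. hom C X (FOb D j)) (image_gen J C D X) (\<lambda>(j, k). PAr P k (x j)) (POb P X)"
        if "X \<in> Obj C" for X using x that unfolding presented_by_def set_colimit_def by blast
      fix h a assume "h \<in> Arr C" "a \<in> (SIGMA j:Obj J. hom C (Cod C h) (FOb D j))"
      then show "(case (case a of (j, k) \<Rightarrow> (j, Comp C k h)) of (j, k) \<Rightarrow> PAr P k (x j)) =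
          PAr P h (case a of (j, k) \<Rightarrow> PAr P k (x j))"
        using presheaf_Comp[OF P homI] presented_by_in[OF x] by auto
    qed
  qed
qed

lemma small_presheaf_iff:
  fixes \<kappa> :: "'k rel"
  assumes C: "category C"
  shows "small_presheaf \<kappa> C P \<longleftrightarrow> is_presheaf \<kappa> C P \<and>
    (\<exists>(J :: ('k, 'k) cat) D x. small_category \<kappa> J \<and> is_functor J C D \<and> presented_by J C D P x)"
  unfolding small_presheaf_def small_category_def using image_presheaf_iso_iff[OF C] by blast

text \<open>Supplies a representative of the image presheaf inside \<open>PSh\<close> for an index
  category of any type. A copy of \<open>J\<close> in \<open>'k\<close> serves as witness of
  smallness, while the presentation is stated over \<open>J\<close> itself. It is used both over
  \<open>C\<close> and over the category of small presheaves.\<close>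

lemma image_presheaf_exists:
  fixes \<kappa> :: "'k rel" and C :: "('o, 'a) cat"
  assumes "universe_card \<kappa>" and C: "category C" "locally_small \<kappa> C"
    and J: "category J" "small \<kappa> (Obj J)" "small \<kappa> (Arr J)" and D: "is_functor J C D"
  obtains P :: "('o, 'a, 'k) presheaf" and x where "small_presheaf \<kappa> C P" "presented_by J C D P x"
proof -
  interpret category C by fact
  have "is_presheaf \<kappa> C (image_presheaf J C D)" unfolding image_presheaf_eq
  proof (rule quotient_data.is_presheaf_quotient[OF quotient_data_image[OF C(1) J(1) D]])
    show "small \<kappa> (SIGMA j:Obj J. hom C X (FOb D j))" if "X \<in> Obj C" for X
      using that C(2) functor_Obj[OF D] by (intro small_Sigma assms) (auto simp: locally_small_def)
    show "(case a of (j, f) \<Rightarrow> (j, Comp C f (Ide C X))) = a" if "a \<in> (SIGMA j:Obj J. hom C X (FOb D j))" for X a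
      using that Comp_Ide by auto
    show "(case a of (j, k) \<Rightarrow> (j, Comp C k (Comp C g f))) = (case (case a of (j, k) \<Rightarrow> (j, Comp C k g)) of (j, k) \<Rightarrow> (j, Comp C k f))"
      if fg: "f \<in> Arr C" "g \<in> Arr C" "Cod C f = Dom C g" and a: "a \<in> (SIGMA j:Obj J. hom C (Cod C g) (FOb D j))" for f g a
    proof -
      have "f \<in> hom C (Dom C f) (Dom C g)" "g \<in> hom C (Dom C g) (Cod C g)" using fg by (auto simp: hom_def)
      then show ?thesis using a Comp_assoc by fastforce
    qed
  qed
  from presheaf_copy[OF C(1) this] obtain P :: "('o, 'a, 'k) presheaf"
    where P: "is_presheaf \<kappa> C P" "presheaf_iso C (image_presheaf J C D) P" by blast
  then obtain x where x: "presented_by J C D P x" using image_presheaf_iso_iff[OF C(1) J(1) D] by blast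
  obtain J' :: "('k, 'k) cat" and I where J': "small_category \<kappa> J'" "is_functor J' J I"
    "bij_betw (FOb I) (Obj J') (Obj J)" "bij_betw (FAr I) (Arr J') (Arr J)"
    using category_copy[OF J] by blast
  then have "presented_by J' C (fcomp D I) P (\<lambda>j. x (FOb I j))"
    using presented_by_copy[OF C(1) J(1) D P(1) _ J'(2-4) x] unfolding small_category_def by blast
  then have "small_presheaf \<kappa> C P"
    unfolding small_presheaf_iff[OF C(1)] using P(1) J'(1) functor_fcomp[OF J'(2) D] by blast
  then show ?thesis using that x by blast
qed

section \<open>The category of small presheaves\<close>

abbreviation psh_map :: "('o, 'a, 'v) psh_arr \<Rightarrow> 'o \<Rightarrow> 'v \<Rightarrow> 'v" where
  "psh_map a \<equiv> snd (snd a)"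

lemma small_presheaf_is_presheaf: "small_presheaf \<kappa> C P \<Longrightarrow> is_presheaf \<kappa> C P"
  by (simp add: small_presheaf_def)

lemma PSh_Obj: "P \<in> Obj (PSh \<kappa> C) \<longleftrightarrow> small_presheaf \<kappa> C P"
  by (simp add: PSh_def)

lemma PSh_hom: "a \<in> hom (PSh \<kappa> C) P Q \<longleftrightarrow>
    small_presheaf \<kappa> C P \<and> small_presheaf \<kappa> C Q \<and> a = (P, Q, psh_map a) \<and> psh_trans C P Q (psh_map a)"
  by (cases a) (auto simp: PSh_def hom_def)

lemma PSh_hom_map: "a \<in> hom (PSh \<kappa> C) P Q \<Longrightarrow> X \<in> Obj C \<Longrightarrow> x \<in> POb P X \<Longrightarrow> psh_map a X x \<in> POb Q X"
  unfolding PSh_hom psh_trans_def by (auto dest: PiE_mem)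

lemma PSh_hom_nat:
  "a \<in> hom (PSh \<kappa> C) P Q \<Longrightarrow> f \<in> hom C X Y \<Longrightarrow> x \<in> POb P Y \<Longrightarrow>
    psh_map a X (PAr P f x) = PAr Q f (psh_map a Y x)"
  unfolding PSh_hom psh_trans_def by (auto simp: hom_def)

lemma PSh_hom_eqI:
  assumes a: "a \<in> hom (PSh \<kappa> C) P Q" and b: "b \<in> hom (PSh \<kappa> C) P Q"
    and eq: "\<And>X x. X \<in> Obj C \<Longrightarrow> x \<in> POb P X \<Longrightarrow> psh_map a X x = psh_map b X x"
  shows "a = b"
proof -
  have tr: "psh_map a \<in> (\<Pi>\<^sub>E X\<in>Obj C. POb P X \<rightarrow>\<^sub>E POb Q X)" "psh_map b \<in> (\<Pi>\<^sub>E X\<in>Obj C. POb P X \<rightarrow>\<^sub>E POb Q X)"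
    using a b unfolding PSh_hom psh_trans_def by auto
  have "psh_map a = psh_map b"
  proof (rule PiE_ext[OF tr])
    fix X assume X: "X \<in> Obj C"
    show "psh_map a X = psh_map b X"
      by (rule PiE_ext[OF PiE_mem[OF tr(1) X] PiE_mem[OF tr(2) X]]) (rule eq[OF X])
  qed
  moreover have "a = (P, Q, psh_map a)" "b = (P, Q, psh_map b)" using a b unfolding PSh_hom by auto
  ultimately show ?thesis by simp
qed

lemma PSh_homI:
  assumes "category C" and "small_presheaf \<kappa> C P" "small_presheaf \<kappa> C Q"
    and into: "\<And>X x. X \<in> Obj C \<Longrightarrow> x \<in> POb P X \<Longrightarrow> \<alpha> X x \<in> POb Q X"
    and nat: "\<And>X Y f x. f \<in> hom C X Y \<Longrightarrow> x \<in> POb P Y \<Longrightarrow> \<alpha> X (PAr P f x) = PAr Q f (\<alpha> Y x)"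
  shows "(P, Q, \<lambda>X\<in>Obj C. \<lambda>x\<in>POb P X. \<alpha> X x) \<in> hom (PSh \<kappa> C) P Q"
proof -
  interpret category C by fact
  have "PAr P f x \<in> POb P (Dom C f)" if "f \<in> Arr C" "x \<in> POb P (Cod C f)" for f x
    using presheaf_act[OF small_presheaf_is_presheaf[OF assms(2)] homI[OF that(1)] that(2)] .
  then have "psh_trans C P Q (\<lambda>X\<in>Obj C. \<lambda>x\<in>POb P X. \<alpha> X x)"
    unfolding psh_trans_def using into nat[OF homI] Dom_in Cod_in by auto
  then show ?thesis unfolding PSh_hom using assms(2,3) by simp
qed

lemma PSh_Comp:
  assumes "category C" and a: "a \<in> hom (PSh \<kappa> C) P Q" and b: "b \<in> hom (PSh \<kappa> C) Q R"
  shows "Comp (PSh \<kappa> C) b a \<in> hom (PSh \<kappa> C) P R"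
    and "X \<in> Obj C \<Longrightarrow> x \<in> POb P X \<Longrightarrow> psh_map (Comp (PSh \<kappa> C) b a) X x = psh_map b X (psh_map a X x)"
proof -
  have eq: "Comp (PSh \<kappa> C) b a = (P, R, \<lambda>X\<in>Obj C. \<lambda>x\<in>POb P X. psh_map b X (psh_map a X x))"
    using a b unfolding PSh_hom by (cases a; cases b) (simp add: PSh_def)
  show "Comp (PSh \<kappa> C) b a \<in> hom (PSh \<kappa> C) P R" unfolding eq
  proof (rule PSh_homI[OF assms(1)])
    show "small_presheaf \<kappa> C P" "small_presheaf \<kappa> C R" using a b unfolding PSh_hom by auto
    show "psh_map b X (psh_map a X x) \<in> POb R X" if "X \<in> Obj C" "x \<in> POb P X" for X x
      using that by (intro PSh_hom_map[OF b] PSh_hom_map[OF a])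
    show "psh_map b X (psh_map a X (PAr P f x)) = PAr R f (psh_map b Y (psh_map a Y x))"
      if "f \<in> hom C X Y" "x \<in> POb P Y" for X Y f x
      using PSh_hom_nat[OF a that] PSh_hom_nat[OF b that(1) PSh_hom_map[OF a _ that(2)]]
        category.hom_Obj[OF assms(1) that(1)] by simp
  qed
  show "X \<in> Obj C \<Longrightarrow> x \<in> POb P X \<Longrightarrow> psh_map (Comp (PSh \<kappa> C) b a) X x = psh_map b X (psh_map a X x)"
    unfolding eq by simp
qed

lemma PSh_Ide_map: "X \<in> Obj C \<Longrightarrow> x \<in> POb P X \<Longrightarrow> psh_map (Ide (PSh \<kappa> C) P) X x = x"
  by (simp add: PSh_def)

lemma category_PSh:
  assumes C: "category C"
  shows "category (PSh \<kappa> C)"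
proof
  let ?A = "PSh \<kappa> C"
  show "Dom ?A a \<in> Obj ?A" "Cod ?A a \<in> Obj ?A" if "a \<in> Arr ?A" for a
    using that by (auto simp: PSh_def)
  have ide: "Ide ?A P \<in> hom ?A P P" if "P \<in> Obj ?A" for P
    using PSh_homI[OF C, of \<kappa> P P "\<lambda>_ x. x"] that by (simp add: PSh_def)
  then show "\<And>P. P \<in> Obj ?A \<Longrightarrow> Ide ?A P \<in> hom ?A P P" .
  show "\<And>a P Q b R. a \<in> hom ?A P Q \<Longrightarrow> b \<in> hom ?A Q R \<Longrightarrow> Comp ?A b a \<in> hom ?A P R"
    by (rule PSh_Comp(1)[OF C])
  fix a P Q assume a: "a \<in> hom ?A P Q"
  then have P: "P \<in> Obj ?A" and Q: "Q \<in> Obj ?A" by (auto simp: PSh_hom PSh_Obj)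
  show "Comp ?A a (Ide ?A P) = a"
    by (rule PSh_hom_eqI[OF PSh_Comp(1)[OF C ide[OF P] a] a]) (simp add: PSh_Comp(2)[OF C ide[OF P] a] PSh_Ide_map)
  show "Comp ?A (Ide ?A Q) a = a"
    by (rule PSh_hom_eqI[OF PSh_Comp(1)[OF C a ide[OF Q]] a])
      (simp add: PSh_Comp(2)[OF C a ide[OF Q]] PSh_Ide_map PSh_hom_map[OF a])
next
  let ?A = "PSh \<kappa> C"
  fix a b c P Q R S assume abc: "a \<in> hom ?A P Q" "b \<in> hom ?A Q R" "c \<in> hom ?A R S"
  note ba = PSh_Comp[OF C abc(1,2)] and cb = PSh_Comp[OF C abc(2,3)]
  note l = PSh_Comp[OF C ba(1) abc(3)] and r = PSh_Comp[OF C abc(1) cb(1)]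
  show "Comp ?A c (Comp ?A b a) = Comp ?A (Comp ?A c b) a"
    by (rule PSh_hom_eqI[OF l(1) r(1)]) (simp add: l(2) r(2) ba(2) cb(2) PSh_hom_map[OF abc(1)])
qed

text \<open>By Yoneda, a transformation out of a colimit of representables is determined by its values on the generators.\<close>

lemma locally_small_PSh:
  fixes \<kappa> :: "'k rel"
  assumes U: "universe_card \<kappa>" and C: "category C"
  shows "locally_small \<kappa> (PSh \<kappa> C)"
  unfolding locally_small_def
proof (intro ballI)
  let ?A = "PSh \<kappa> C"
  fix P Q assume "P \<in> Obj ?A" "Q \<in> Obj ?A"
  then have P: "small_presheaf \<kappa> C P" and Q: "is_presheaf \<kappa> C Q" by (auto simp: PSh_Obj small_presheaf_is_presheaf)
  then obtain J :: "('k, 'k) cat" and D x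
    where J: "small_category \<kappa> J" and D: "is_functor J C D" and x: "presented_by J C D P x"
    unfolding small_presheaf_iff[OF C] by blast
  let ?h = "\<lambda>a. \<lambda>j\<in>Obj J. psh_map a (FOb D j) (x j)"
  have "inj_on ?h (hom ?A P Q)"
  proof (rule inj_onI)
    fix a b assume a: "a \<in> hom ?A P Q" and b: "b \<in> hom ?A P Q" and eq: "?h a = ?h b"
    show "a = b"
    proof (rule PSh_hom_eqI[OF a b])
      fix X y assume "X \<in> Obj C" "y \<in> POb P X"
      then obtain j f where j: "j \<in> Obj J" "f \<in> hom C X (FOb D j)" "y = PAr P f (x j)"
        by (rule presented_by_ex[OF x])
      have "psh_map a (FOb D j) (x j) = psh_map b (FOb D j) (x j)" using fun_cong[OF eq, of j] j(1) by simp
      then show "psh_map a X y = psh_map b X y"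
        using PSh_hom_nat[OF a j(2) presented_by_in[OF x j(1)]] PSh_hom_nat[OF b j(2) presented_by_in[OF x j(1)]] j(3)
        by simp
    qed
  qed
  moreover have "small \<kappa> (\<Pi>\<^sub>E j\<in>Obj J. POb Q (FOb D j))"
    using J by (intro small_PiE[OF U] presheaf_small[OF Q] functor_Obj[OF D]) (auto simp: small_category_def)
  then have "small \<kappa> (?h ` hom ?A P Q)"
  proof (rule small_subset, intro image_subsetI restrict_PiE_iff[THEN iffD2] ballI)
    fix a j assume "a \<in> hom ?A P Q" and j: "j \<in> Obj J"
    then show "psh_map a (FOb D j) (x j) \<in> POb Q (FOb D j)"
      using PSh_hom_map functor_Obj[OF D j] presented_by_in[OF x j] by metis
  qed
  ultimately show "small \<kappa> (hom ?A P Q)" by (rule small_inj_on)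
qed


section \<open>Left Kan extensions with values in presheaves\<close>

text \<open>An arrow records its underlying arrow of \<open>J\<close> and the structure map of its
  codomain only. The structure map of the domain is forced by commutativity, so \<open>Dom\<close>
  computes it.\<close>

definition comma :: "('j, 'i) cat \<Rightarrow> ('l, 'n) cat \<Rightarrow> ('j, 'i, 'l, 'n) func \<Rightarrow> 'l \<Rightarrow> ('j \<times> 'n, 'i \<times> 'n) cat" where
  "comma J K F k = \<lparr>
     Obj = {(j, u). j \<in> Obj J \<and> u \<in> hom K (FOb F j) k},
     Arr = {(v, u). v \<in> Arr J \<and> u \<in> hom K (FOb F (Cod J v)) k},
     Dom = (\<lambda>(v, u). (Dom J v, Comp K u (FAr F v))),
     Cod = (\<lambda>(v, u). (Cod J v, u)),
     Ide = (\<lambda>(j, u). (Ide J j, u)),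
     Comp = (\<lambda>(v', u') (v, u). (Comp J v' v, u'))\<rparr>"

definition comma_diagram :: "('j, 'i, 'o, 'a) func \<Rightarrow> ('j \<times> 'n, 'i \<times> 'n, 'o, 'a) func" where
  "comma_diagram D = \<lparr>FOb = \<lambda>(j, u). FOb D j, FAr = \<lambda>(v, u). FAr D v\<rparr>"

lemma comma_diagram_simps [simp]: "FOb (comma_diagram D) (j, u) = FOb D j" "FAr (comma_diagram D) (v, u) = FAr D v"
  by (simp_all add: comma_diagram_def)

lemma comma_Obj [simp]: "(j, u) \<in> Obj (comma J K F k) \<longleftrightarrow> j \<in> Obj J \<and> u \<in> hom K (FOb F j) k"
  by (simp add: comma_def)

lemma comma_hom: "(v, w) \<in> hom (comma J K F k) (j, u) (j', u') \<longleftrightarrow>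
    v \<in> hom J j j' \<and> w = u' \<and> u' \<in> hom K (FOb F j') k \<and> u = Comp K u' (FAr F v)"
  by (auto simp: comma_def hom_def)

lemma category_comma:
  assumes J: "category J" and K: "category K" and F: "is_functor J K F"
  shows "category (comma J K F k)"
proof -
  interpret J: category J by fact
  interpret K: category K by fact
  let ?X = "comma J K F k"
  have comp: "Comp ?X (v', u') (v, u) = (Comp J v' v, u')" for v v' u u' by (simp add: comma_def)
  have ide: "Ide ?X (j, u) = (Ide J j, u)" for j u by (simp add: comma_def)
  show ?thesis
  proof
    fix a assume "a \<in> Arr ?X"
    then show "Dom ?X a \<in> Obj ?X" "Cod ?X a \<in> Obj ?X"
      using K.Comp_in[OF functor_hom[OF F homI]] J.Dom_in J.Cod_in by (auto simp: comma_def)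
  next
    fix X assume "X \<in> Obj ?X"
    then obtain j u where X: "X = (j, u)" "j \<in> Obj J" "u \<in> hom K (FOb F j) k" by (cases X) auto
    then show "Ide ?X X \<in> hom ?X X X"
      using J.Ide_in K.Comp_Ide by (simp add: comma_hom ide functor_Ide[OF F])
  next
    fix f X Y assume f: "f \<in> hom ?X X Y"
    obtain v w j u j' u' where *: "f = (v, w)" "X = (j, u)" "Y = (j', u')" by (cases f; cases X; cases Y)
    show "Comp ?X f (Ide ?X X) = f" "Comp ?X (Ide ?X Y) f = f"
      using f J.Comp_Ide J.Ide_Comp unfolding * by (auto simp: comma_hom comp ide)
  next
    fix f X Y g Z assume f: "f \<in> hom ?X X Y" and g: "g \<in> hom ?X Y Z"
    obtain v w j u j' u' v' w' j'' u'' where *: "f = (v, w)" "X = (j, u)" "Y = (j', u')" "g = (v', w')" "Z = (j'', u'')"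
      by (cases f; cases X; cases Y; cases g; cases Z)
    have h: "v \<in> hom J j j'" "v' \<in> hom J j' j''" "u'' \<in> hom K (FOb F j'') k" "w' = u''" "w = u'"
      "u = Comp K u' (FAr F v)" "u' = Comp K u'' (FAr F v')"
      using f g unfolding * by (auto simp: comma_hom)
    show "Comp ?X g f \<in> hom ?X X Z"
      unfolding * comp comma_hom
      using h J.Comp_in[OF h(1,2)] functor_Comp[OF F h(1,2)] K.Comp_assoc[OF functor_hom[OF F h(1)] functor_hom[OF F h(2)] h(3)]
      by simp
  next
    fix f g h W X Y Z
    assume f: "f \<in> hom ?X W X" and g: "g \<in> hom ?X X Y" and h: "h \<in> hom ?X Y Z"
    obtain v1 w1 v2 w2 v3 w3 j1 u1 j2 u2 j3 u3 j4 u4 where *: "f = (v1, w1)" "g = (v2, w2)" "h = (v3, w3)"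
      "W = (j1, u1)" "X = (j2, u2)" "Y = (j3, u3)" "Z = (j4, u4)"
      by (cases f; cases g; cases h; cases W; cases X; cases Y; cases Z)
    show "Comp ?X h (Comp ?X g f) = Comp ?X (Comp ?X h g) f"
      using f g h J.Comp_assoc unfolding * comp comma_hom by auto
  qed
qed

lemma functor_comma_diagram: "is_functor J C D \<Longrightarrow> is_functor (comma J K F k) C (comma_diagram D)"
  unfolding is_functor_def comma_def by (auto simp: comma_diagram_def hom_def)

lemma small_comma:
  assumes U: "universe_card \<kappa>" and J: "small_category \<kappa> J" and K: "small_category \<kappa> K"
  shows "small \<kappa> (Obj (comma J K F k))" "small \<kappa> (Arr (comma J K F k))"
proof -
  have "small \<kappa> (Obj J \<times> Arr K)" "small \<kappa> (Arr J \<times> Arr K)"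
    using J K unfolding small_category_def by (auto intro: small_Sigma[OF U])
  moreover have "Obj (comma J K F k) \<subseteq> Obj J \<times> Arr K" "Arr (comma J K F k) \<subseteq> Arr J \<times> Arr K"
    by (auto simp: comma_def hom_def)
  ultimately show "small \<kappa> (Obj (comma J K F k))" "small \<kappa> (Arr (comma J K F k))"
    using small_subset by metis+
qed

text \<open>Stated at each object because this is the form that the co-Yoneda lemma yields for
  \<open>mu\<close>; the second clause makes the cocone consist of transformations of
  presheaves.\<close>

definition psh_colimit ::
  "('l, 'n) cat \<Rightarrow> ('o, 'a) cat \<Rightarrow> ('l, 'n, ('o, 'a, 'k) presheaf, ('o, 'a, 'k) psh_arr) func
    \<Rightarrow> ('o \<Rightarrow> 'l \<Rightarrow> 'k \<Rightarrow> 'v) \<Rightarrow> ('o, 'a, 'v) presheaf \<Rightarrow> bool" where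
  "psh_colimit K C G q P \<longleftrightarrow>
     (\<forall>X\<in>Obj C. set_colimit K (\<lambda>k. POb (FOb G k) X) (\<lambda>w. psh_map (FAr G w) X) (q X) (POb P X)) \<and>
     (\<forall>f\<in>Arr C. \<forall>k\<in>Obj K. \<forall>y\<in>POb (FOb G k) (Cod C f).
        q (Dom C f) k (PAr (FOb G k) f y) = PAr P f (q (Cod C f) k y))"

text \<open>
  The left Kan extension \<open>G : K \<rightarrow> P C\<close> along \<open>F\<close> of \<open>D\<close> followed by the Yoneda embedding, in the pointwise form:
  \<open>G k\<close> is the colimit of \<open>hom(-, D j)\<close> over the objects \<open>(j, u : F j \<rightarrow> k)\<close> of \<open>F \<down> k\<close>. The unit is given by the
  elements \<open>x j\<close> of \<open>G(F j)(D j)\<close>.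
\<close>

locale presheaf_kan_ext = J: category J + K: category K + C: category C
  for J :: "('j, 'i) cat" and K :: "('l, 'n) cat" and C :: "('o, 'a) cat" +
  fixes \<kappa> :: "'k rel"
    and F :: "('j, 'i, 'l, 'n) func" and D :: "('j, 'i, 'o, 'a) func"
    and G :: "('l, 'n, ('o, 'a, 'k) presheaf, ('o, 'a, 'k) psh_arr) func" and x :: "'j \<Rightarrow> 'k"
  assumes F: "is_functor J K F" and D: "is_functor J C D" and G: "is_functor K (PSh \<kappa> C) G"
    and x_in: "j \<in> Obj J \<Longrightarrow> x j \<in> POb (FOb G (FOb F j)) (FOb D j)"
    and presented: "k \<in> Obj K \<Longrightarrow> presented_by (comma J K F k) C (comma_diagram D) (FOb G k)
          (\<lambda>(j, u). psh_map (FAr G u) (FOb D j) (x j))"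
begin

abbreviation "gen j u \<equiv> psh_map (FAr G u) (FOb D j) (x j)"

abbreviation "G0 X \<equiv> \<lambda>k. POb (FOb G k) X"
abbreviation "G1 X \<equiv> \<lambda>w. psh_map (FAr G w) X"

lemma G_presheaf: "k \<in> Obj K \<Longrightarrow> is_presheaf \<kappa> C (FOb G k)"
  using functor_Obj[OF G] by (simp add: PSh_Obj small_presheaf_is_presheaf)

lemma G_Comp:
  "u \<in> hom K k k' \<Longrightarrow> w \<in> hom K k' k'' \<Longrightarrow> X \<in> Obj C \<Longrightarrow> y \<in> POb (FOb G k) X \<Longrightarrow>
    psh_map (FAr G (Comp K w u)) X y = psh_map (FAr G w) X (psh_map (FAr G u) X y)"
  using PSh_Comp(2)[OF C.category_axioms functor_hom[OF G] functor_hom[OF G]] functor_Comp[OF G] by metis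

lemma gen_in: "j \<in> Obj J \<Longrightarrow> u \<in> hom K (FOb F j) k \<Longrightarrow> gen j u \<in> POb (FOb G k) (FOb D j)"
  by (rule PSh_hom_map[OF functor_hom[OF G] functor_Obj[OF D] x_in])

lemma gen_act:
  "j \<in> Obj J \<Longrightarrow> u \<in> hom K (FOb F j) k \<Longrightarrow> w \<in> hom K k k' \<Longrightarrow> psh_map (FAr G w) (FOb D j) (gen j u) = gen j (Comp K w u)"
  using G_Comp functor_Obj[OF D] x_in by metis

lemma gen_Ide: "j \<in> Obj J \<Longrightarrow> gen j (Ide K (FOb F j)) = x j"
  using functor_Ide[OF G functor_Obj[OF F]] PSh_Ide_map[OF functor_Obj[OF D] x_in] by simp

text \<open>The pair \<open>(v, u)\<close> is an arrow of the comma category, and the equation is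
  compatibility of the presentation of \<open>FOb G k\<close> with it.\<close>

lemma gen_nat:
  assumes v: "v \<in> hom J j j'" and u: "u \<in> hom K (FOb F j') k"
  shows "PAr (FOb G k) (FAr D v) (gen j' u) = gen j (Comp K u (FAr F v))"
proof -
  have k: "k \<in> Obj K" using K.hom_Obj[OF u] by simp
  have "(v, u) \<in> hom (comma J K F k) (j, Comp K u (FAr F v)) (j', u)" using v u by (simp add: comma_hom)
  from presented_by_eq[OF C.category_axioms category_comma[OF J.category_axioms K.category_axioms F]
      functor_comma_diagram[OF D] G_presheaf[OF k] presented[OF k] this]
  show ?thesis by simp
qed

lemma G_set_diagram: "X \<in> Obj C \<Longrightarrow> set_diagram K (G0 X) (G1 X)"
  unfolding set_diagram_def using K.Dom_in K.Cod_in PSh_hom_map[OF functor_hom[OF G homI]] by blast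

lemma gen_restrict_act:
  assumes "j \<in> Obj J" "u \<in> hom K (FOb F j) k" "f \<in> hom C X (FOb D j)" "w \<in> hom K k k'"
  shows "psh_map (FAr G w) X (PAr (FOb G k) f (gen j u)) = PAr (FOb G k') f (gen j (Comp K w u))"
  using PSh_hom_nat[OF functor_hom[OF G assms(4)] assms(3) gen_in[OF assms(1,2)]] gen_act[OF assms(1,2,4)] by simp

lemma gen_ex:
  assumes k: "k \<in> Obj K" and X: "X \<in> Obj C" and y: "y \<in> POb (FOb G k) X"
  obtains j u f where "j \<in> Obj J" "u \<in> hom K (FOb F j) k" "f \<in> hom C X (FOb D j)" "y = PAr (FOb G k) f (gen j u)"
proof -
  obtain a f where a: "a \<in> Obj (comma J K F k)" "f \<in> hom C X (FOb (comma_diagram D) a)"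
    "y = PAr (FOb G k) f (case a of (j, u) \<Rightarrow> gen j u)"
    by (rule presented_by_ex[OF presented[OF k] X y])
  then show ?thesis using that by (cases a) auto
qed

text \<open>The tool for defining maps out of \<open>G k\<close> at \<open>X\<close>: the condition
  on \<phi> is the cocone condition over the comma category, with the structure map of the domain
  written out.\<close>

lemma gen_lift:
  assumes k: "k \<in> Obj K" and X: "X \<in> Obj C"
    and \<phi>: "\<And>v j j' u f. v \<in> hom J j j' \<Longrightarrow> u \<in> hom K (FOb F j') k \<Longrightarrow> f \<in> hom C X (FOb D j) \<Longrightarrow>
      \<phi> j' u (Comp C (FAr D v) f) = \<phi> j (Comp K u (FAr F v)) f"
  shows "\<exists>g. \<forall>j u f. j \<in> Obj J \<longrightarrow> u \<in> hom K (FOb F j) k \<longrightarrow> f \<in> hom C X (FOb D j) \<longrightarrow>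
    g (PAr (FOb G k) f (gen j u)) = \<phi> j u f"
proof -
  define \<psi> where "\<psi> a f = \<phi> (fst a) (snd a) f" for a f
  have nat: "\<psi> a' (Comp C (FAr (comma_diagram D) w) f) = \<psi> a f"
    if w: "w \<in> hom (comma J K F k) a a'" "f \<in> hom C X (FOb (comma_diagram D) a)" for w a a' f
  proof -
    obtain v w' j u j' u' where *: "w = (v, w')" "a = (j, u)" "a' = (j', u')" by (cases w; cases a; cases a')
    show ?thesis using w unfolding * \<psi>_def by (auto simp: comma_hom intro!: \<phi>)
  qed
  have "\<exists>g. \<forall>a\<in>Obj (comma J K F k). \<forall>f\<in>hom C X (FOb (comma_diagram D) a).
      g (PAr (FOb G k) f (case a of (j, u) \<Rightarrow> gen j u)) = \<psi> a f"
    by (rule presented_by_lift[OF presented[OF k] X]) (rule nat)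
  then obtain g where g: "\<forall>a\<in>Obj (comma J K F k). \<forall>f\<in>hom C X (FOb (comma_diagram D) a).
      g (PAr (FOb G k) f (case a of (j, u) \<Rightarrow> gen j u)) = \<psi> a f" ..
  have "g (PAr (FOb G k) f (gen j u)) = \<phi> j u f"
    if "j \<in> Obj J" "u \<in> hom K (FOb F j) k" "f \<in> hom C X (FOb D j)" for j u f
    using bspec[OF bspec[OF g, of "(j, u)"], of f] that by (simp add: \<psi>_def)
  then show ?thesis by (intro exI[of _ g] allI impI)
qed

text \<open>A left Kan extension has the same colimit as the diagram it extends. The cocone sends
  the restriction of \<open>gen j u\<close> along \<open>f\<close> to that of \<open>y j\<close>,
  forgetting \<open>u\<close>. For the universal property, a test on \<open>K\<close> is pulled back
  along \<open>F\<close> to a test on \<open>J\<close>, where the presentation of \<open>P\<close>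
  decides it.\<close>

lemma presented_colimit:
  assumes P: "is_presheaf \<kappa> C P" and y: "presented_by J C D P y"
  shows "\<exists>q. psh_colimit K C G q P"
proof -
  have "\<exists>g. \<forall>j u f. j \<in> Obj J \<longrightarrow> u \<in> hom K (FOb F j) k \<longrightarrow> f \<in> hom C X (FOb D j) \<longrightarrow>
      g (PAr (FOb G k) f (gen j u)) = PAr P f (y j)" if k: "k \<in> Obj K" and X: "X \<in> Obj C" for k X
  proof (rule gen_lift[OF k X, of "\<lambda>j u f. PAr P f (y j)"])
    fix v j j' u f assume v: "v \<in> hom J j j'" and f: "f \<in> hom C X (FOb D j)"
    show "PAr P (Comp C (FAr D v) f) (y j') = PAr P f (y j)"
      using presheaf_Comp[OF P f functor_hom[OF D v]] presented_by_in[OF y] J.hom_Obj[OF v]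
        presented_by_eq[OF C.category_axioms J.category_axioms D P y v] by simp
  qed
  note lift = this
  define q where "q X k = (SOME g. \<forall>j u f. j \<in> Obj J \<longrightarrow> u \<in> hom K (FOb F j) k \<longrightarrow> f \<in> hom C X (FOb D j) \<longrightarrow>
      g (PAr (FOb G k) f (gen j u)) = PAr P f (y j))" for X k
  have q: "q X k (PAr (FOb G k) f (gen j u)) = PAr P f (y j)" if "k \<in> Obj K" "X \<in> Obj C"
    "j \<in> Obj J" "u \<in> hom K (FOb F j) k" "f \<in> hom C X (FOb D j)" for k X j u f
    using someI_ex[OF lift[OF that(1,2)]] that(3-) unfolding q_def by blast
  have "psh_colimit K C G q P" unfolding psh_colimit_def
  proof (intro conjI ballI)
    fix X assume X: "X \<in> Obj C"
    show "set_colimit K (G0 X) (G1 X) (q X) (POb P X)"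
    proof (rule set_colimitI[OF G_set_diagram[OF X]])
      show "set_cocone K (G0 X) (G1 X) (q X)"
      proof (rule set_coconeI)
        fix w s assume w: "w \<in> Arr K" and s: "s \<in> POb (FOb G (Dom K w)) X"
        obtain j u f where j: "j \<in> Obj J" "u \<in> hom K (FOb F j) (Dom K w)" "f \<in> hom C X (FOb D j)"
          "s = PAr (FOb G (Dom K w)) f (gen j u)" by (rule gen_ex[OF K.Dom_in[OF w] X s])
        show "q X (Cod K w) (psh_map (FAr G w) X s) = q X (Dom K w) s"
          using q[OF K.Cod_in[OF w] X j(1) K.Comp_in[OF j(2) homI[OF w]] j(3)] q[OF K.Dom_in[OF w] X j(1-3)] j(4)
            gen_restrict_act[OF j(1-3) homI[OF w]] by simp
      qed
      show "q X k s \<in> POb P X" if k: "k \<in> Obj K" and s: "s \<in> POb (FOb G k) X" for k s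
      proof -
        obtain j u f where j: "j \<in> Obj J" "u \<in> hom K (FOb F j) k" "f \<in> hom C X (FOb D j)"
          "s = PAr (FOb G k) f (gen j u)" by (rule gen_ex[OF k X s])
        then show ?thesis using q[OF k X j(1-3)] presheaf_act[OF P j(3) presented_by_in[OF y j(1)]] by simp
      qed
      have x': "gen j (Ide K (FOb F j)) = x j" "Ide K (FOb F j) \<in> hom K (FOb F j) (FOb F j)"
        "FOb F j \<in> Obj K" if "j \<in> Obj J" for j
        using gen_Ide[OF that] K.Ide_in[OF functor_Obj[OF F that]] functor_Obj[OF F that] by auto
      show "\<exists>k\<in>Obj K. \<exists>s\<in>POb (FOb G k) X. b = q X k s" if b: "b \<in> POb P X" for b
      proof -
        obtain j f where j: "j \<in> Obj J" "f \<in> hom C X (FOb D j)" "b = PAr P f (y j)" by (rule presented_by_ex[OF y X b])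
        have "b = q X (FOb F j) (PAr (FOb G (FOb F j)) f (x j))"
          using q[OF x'(3)[OF j(1)] X j(1) x'(2)[OF j(1)] j(2)] x'(1)[OF j(1)] j(3) by simp
        moreover have "PAr (FOb G (FOb F j)) f (x j) \<in> POb (FOb G (FOb F j)) X"
          by (rule presheaf_act[OF G_presheaf[OF x'(3)[OF j(1)]] j(2) x_in[OF j(1)]])
        ultimately show ?thesis using x'(3)[OF j(1)] by blast
      qed
      fix \<phi> :: "'l \<Rightarrow> 'k \<Rightarrow> bool" and k s k' s'
      assume \<phi>: "set_cocone K (G0 X) (G1 X) \<phi>"
        and k: "k \<in> Obj K" "s \<in> POb (FOb G k) X" "k' \<in> Obj K" "s' \<in> POb (FOb G k') X" and eq: "q X k s = q X k' s'"
      \<comment> \<open>The arrow \<open>u\<close> carries \<open>x j\<close> to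
        \<open>gen j u\<close>, so a cocone over \<open>K\<close> takes the same value at
        \<open>k\<close> as at \<open>FOb F j\<close>. This eliminates \<open>k\<close> and
        \<open>u\<close>, leaving a test that depends on \<open>j\<close> and \<open>f\<close>
        alone.\<close>
      have move: "\<phi> k (PAr (FOb G k) f (gen j u)) = \<phi> (FOb F j) (PAr (FOb G (FOb F j)) f (x j))"
        if u: "u \<in> hom K (FOb F j) k" and j: "j \<in> Obj J" and f: "f \<in> hom C X (FOb D j)" for k u j f
        using set_coconeD[OF \<phi>, of u] homD[OF u] PSh_hom_nat[OF functor_hom[OF G u] f x_in[OF j]]
          presheaf_act[OF G_presheaf[OF functor_Obj[OF F j]] f x_in[OF j]] by metis
      obtain j u f where j: "j \<in> Obj J" "u \<in> hom K (FOb F j) k" "f \<in> hom C X (FOb D j)"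
        "s = PAr (FOb G k) f (gen j u)" by (rule gen_ex[OF k(1) X k(2)])
      obtain j' u' f' where j': "j' \<in> Obj J" "u' \<in> hom K (FOb F j') k'" "f' \<in> hom C X (FOb D j')"
        "s' = PAr (FOb G k') f' (gen j' u')" by (rule gen_ex[OF k(3) X k(4)])
      have yy: "PAr P f (y j) = PAr P f' (y j')"
        using q[OF k(1) X j(1-3)] q[OF k(3) X j'(1-3)] j(4) j'(4) eq by simp
      let ?\<psi> = "\<lambda>j f. \<phi> (FOb F j) (PAr (FOb G (FOb F j)) f (x j))"
      have "?\<psi> j f = ?\<psi> j' f'"
      proof (rule presented_by_factor[OF y X _ j(1) j(3) j'(1) j'(3) yy])
        fix v i i' h assume v: "v \<in> hom J i i'" and h: "h \<in> hom C X (FOb D i)"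
        have i: "i \<in> Obj J" "i' \<in> Obj J" using J.hom_Obj[OF v] by auto
        have "PAr (FOb G (FOb F i')) (FAr D v) (x i') = gen i (FAr F v)"
          using gen_nat[OF v x'(2)[OF i(2)]] x'(1)[OF i(2)] K.Ide_Comp[OF functor_hom[OF F v]] by simp
        then have "PAr (FOb G (FOb F i')) (Comp C (FAr D v) h) (x i') = PAr (FOb G (FOb F i')) h (gen i (FAr F v))"
          using presheaf_Comp[OF G_presheaf[OF x'(3)[OF i(2)]] h functor_hom[OF D v] x_in[OF i(2)]] by simp
        then show "?\<psi> i' (Comp C (FAr D v) h) = ?\<psi> i h" using move[OF functor_hom[OF F v] i(1) h] by simp
      qed
      then show "\<phi> k s = \<phi> k' s'" using move[OF j(2,1,3)] move[OF j'(2,1,3)] j(4) j'(4) by simp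
    qed
  next
    fix h k s assume h: "h \<in> Arr C" and k: "k \<in> Obj K" and s: "s \<in> POb (FOb G k) (Cod C h)"
    obtain j u f where j: "j \<in> Obj J" "u \<in> hom K (FOb F j) k" "f \<in> hom C (Cod C h) (FOb D j)"
      "s = PAr (FOb G k) f (gen j u)" by (rule gen_ex[OF k C.Cod_in[OF h] s])
    have "PAr (FOb G k) h s = PAr (FOb G k) (Comp C f h) (gen j u)"
      using presheaf_Comp[OF G_presheaf[OF k] homI[OF h] j(3) gen_in[OF j(1,2)]] j(4) by simp
    then show "q (Dom C h) k (PAr (FOb G k) h s) = PAr P h (q (Cod C h) k s)"
      using q[OF k C.Dom_in[OF h] j(1,2) C.Comp_in[OF homI[OF h] j(3)]] q[OF k C.Cod_in[OF h] j(1-3)] j(4)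
        presheaf_Comp[OF P homI[OF h] j(3) presented_by_in[OF y j(1)]] by simp
  qed
  then show ?thesis by blast
qed

text \<open>The converse comparison. A colimit cocone over \<open>K\<close>, evaluated on the unit
  elements \<open>x j\<close>, gives generators for a presentation over \<open>J\<close>.\<close>

lemma colimit_presented:
  assumes P: "is_presheaf \<kappa> C P" and q: "psh_colimit K C G q P"
  shows "presented_by J C D P (\<lambda>j. q (FOb D j) (FOb F j) (x j))"
proof -
  have colim: "set_colimit K (G0 X) (G1 X) (q X) (POb P X)" if "X \<in> Obj C" for X
    using q that unfolding psh_colimit_def by blast
  have nat: "q X k (PAr (FOb G k) f s) = PAr P f (q Y k s)"
    if "f \<in> hom C X Y" "k \<in> Obj K" "s \<in> POb (FOb G k) Y" for X Y f k s
    using q that homD[OF that(1)] unfolding psh_colimit_def by blast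
  have coc: "q X k' (psh_map (FAr G w) X s) = q X k s" if "w \<in> hom K k k'" "X \<in> Obj C" "s \<in> POb (FOb G k) X" for X k k' w s
  proof -
    from set_coconeD[OF set_colimit_cocone[OF G_set_diagram colim, OF that(2,2)], of w s] show ?thesis
      using homD[OF that(1)] that(3) by simp
  qed
  have Fj: "FOb F j \<in> Obj K" "FOb D j \<in> Obj C" if "j \<in> Obj J" for j using functor_Obj[OF F that] functor_Obj[OF D that] .
  have qgen: "PAr P f (q (FOb D j) (FOb F j) (x j)) = q X k (PAr (FOb G k) f (gen j u))"
    if j: "j \<in> Obj J" and u: "u \<in> hom K (FOb F j) k" and f: "f \<in> hom C X (FOb D j)" for j u k f X
  proof -
    have k: "k \<in> Obj K" using K.hom_Obj[OF u] by simp
    show ?thesis using nat[OF f k gen_in[OF j u]] coc[OF u Fj(2)[OF j] x_in[OF j]] by simp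
  qed
  show ?thesis
  proof (rule presented_byI[OF C.category_axioms J.category_axioms D P])
    show "q (FOb D j) (FOb F j) (x j) \<in> POb P (FOb D j)" if "j \<in> Obj J" for j
      by (rule set_colimit_in[OF colim[OF Fj(2)[OF that]] Fj(1)[OF that] x_in[OF that]])
    show "PAr P (FAr D v) (q (FOb D j') (FOb F j') (x j')) = q (FOb D j) (FOb F j) (x j)" if v: "v \<in> hom J j j'" for v j j'
    proof -
      have j: "j \<in> Obj J" "j' \<in> Obj J" using J.hom_Obj[OF v] by auto
      note id = K.Ide_in[OF Fj(1)[OF j(2)]]
      show ?thesis
        using qgen[OF j(2) id functor_hom[OF D v]] gen_nat[OF v id] K.Ide_Comp[OF functor_hom[OF F v]]
          coc[OF functor_hom[OF F v] Fj(2)[OF j(1)] x_in[OF j(1)]] by simp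
    qed
  next
    fix X y assume X: "X \<in> Obj C" and y: "y \<in> POb P X"
    obtain k s where k: "k \<in> Obj K" "s \<in> POb (FOb G k) X" "y = q X k s" by (rule set_colimit_ex[OF colim[OF X] y])
    obtain j u f where j: "j \<in> Obj J" "u \<in> hom K (FOb F j) k" "f \<in> hom C X (FOb D j)"
      "s = PAr (FOb G k) f (gen j u)" by (rule gen_ex[OF k(1) X k(2)])
    show "\<exists>j\<in>Obj J. \<exists>f\<in>hom C X (FOb D j). y = PAr P f (q (FOb D j) (FOb F j) (x j))"
      using qgen[OF j(1-3)] j(1,3,4) k(3) by metis
  next
    fix \<phi> :: "'j \<Rightarrow> 'a \<Rightarrow> bool" and X j f j' f'
    assume X: "X \<in> Obj C"
      and \<phi>: "\<And>v j j' f. v \<in> hom J j j' \<Longrightarrow> f \<in> hom C X (FOb D j) \<Longrightarrow> \<phi> j' (Comp C (FAr D v) f) = \<phi> j f"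
      and j: "j \<in> Obj J" "f \<in> hom C X (FOb D j)" "j' \<in> Obj J" "f' \<in> hom C X (FOb D j')"
      and eq: "PAr P f (q (FOb D j) (FOb F j) (x j)) = PAr P f' (q (FOb D j') (FOb F j') (x j'))"
    \<comment> \<open>A test on \<open>J\<close> becomes a family of tests on the presheaves
      \<open>G k\<close> by ignoring \<open>u\<close>. The family is a cocone over \<open>K\<close>,
      so the colimit property applies to it.\<close>
    have "\<exists>g. \<forall>j u f. j \<in> Obj J \<longrightarrow> u \<in> hom K (FOb F j) k \<longrightarrow> f \<in> hom C X (FOb D j) \<longrightarrow>
        g (PAr (FOb G k) f (gen j u)) = \<phi> j f" if k: "k \<in> Obj K" for k
      by (rule gen_lift[OF k X, of "\<lambda>j u f. \<phi> j f"]) (use \<phi> in blast)+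
    then obtain g where g: "\<And>k j u f. k \<in> Obj K \<Longrightarrow> j \<in> Obj J \<Longrightarrow> u \<in> hom K (FOb F j) k \<Longrightarrow> f \<in> hom C X (FOb D j) \<Longrightarrow>
        g k (PAr (FOb G k) f (gen j u)) = \<phi> j f" by metis
    have coc_g: "set_cocone K (G0 X) (G1 X) g"
    proof (rule set_coconeI)
      fix w s assume w: "w \<in> Arr K" and s: "s \<in> POb (FOb G (Dom K w)) X"
      obtain j u f where j: "j \<in> Obj J" "u \<in> hom K (FOb F j) (Dom K w)" "f \<in> hom C X (FOb D j)"
        "s = PAr (FOb G (Dom K w)) f (gen j u)" by (rule gen_ex[OF K.Dom_in[OF w] X s])
      show "g (Cod K w) (psh_map (FAr G w) X s) = g (Dom K w) s"
        using g[OF K.Cod_in[OF w] j(1) K.Comp_in[OF j(2) homI[OF w]] j(3)] g[OF K.Dom_in[OF w] j(1-3)] j(4)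
          gen_restrict_act[OF j(1-3) homI[OF w]] by simp
    qed
    note id = K.Ide_in[OF Fj(1)[OF j(1)]] and id' = K.Ide_in[OF Fj(1)[OF j(3)]]
    have "g (FOb F j) (PAr (FOb G (FOb F j)) f (x j)) = g (FOb F j') (PAr (FOb G (FOb F j')) f' (x j'))"
    proof (rule set_colimit_factor[OF colim[OF X] coc_g])
      show "q X (FOb F j) (PAr (FOb G (FOb F j)) f (x j)) = q X (FOb F j') (PAr (FOb G (FOb F j')) f' (x j'))"
        using nat[OF j(2) Fj(1)[OF j(1)] x_in[OF j(1)]] nat[OF j(4) Fj(1)[OF j(3)] x_in[OF j(3)]] eq by simp
    qed (use j Fj presheaf_act[OF G_presheaf _ x_in] in auto)
    then show "\<phi> j f = \<phi> j' f'"
      using g[OF Fj(1)[OF j(1)] j(1) id j(2)] g[OF Fj(1)[OF j(3)] j(3) id' j(4)] gen_Ide[OF j(1)] gen_Ide[OF j(3)] by simp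
  qed
qed

end

section \<open>Weighted colimits\<close>

text \<open>A copower is the colimit of a constant diagram over a discrete category, for which
  \<open>S\<close> serves both as the objects and as the arrows. Existence makes the choice in the
  definition of \<open>copower\<close> meaningful.\<close>

lemma (in category) copower:
  fixes \<kappa> :: "'k rel" and S :: "'k set"
  assumes "cocomplete \<kappa> C" and S: "small \<kappa> S" and X: "X \<in> Obj C"
  shows "is_copower C S X (fst (copower C S X)) (snd (copower C S X))"
proof -
  define J :: "('k, 'k) cat" where
    "J = \<lparr>Obj = S, Arr = S, Dom = \<lambda>s. s, Cod = \<lambda>s. s, Ide = \<lambda>s. s, Comp = \<lambda>t s. s\<rparr>"
  define D where "D = \<lparr>FOb = \<lambda>_ :: 'k. X, FAr = \<lambda>_ :: 'k. Ide C X\<rparr>"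
  have "category J" by unfold_locales (auto simp: J_def hom_def)
  then have "small_category \<kappa> J" using S by (simp add: small_category_def J_def)
  moreover have "is_functor J C D"
    using Ide_in[OF X] Ide_Comp[OF Ide_in[OF X]] X by (auto simp: is_functor_def J_def D_def)
  ultimately obtain c \<iota> where c: "is_colimit J C D c \<iota>" using assms(1) unfolding cocomplete_def by blast
  have coc: "is_cocone J C D d f \<longleftrightarrow> d \<in> Obj C \<and> (\<forall>s\<in>S. f s \<in> hom C X d)" for d f
    using Comp_Ide by (auto simp: is_cocone_def J_def D_def)
  have "is_copower C S X c \<iota>"
    using c unfolding is_colimit_def coc is_copower_def by (simp add: J_def)
  then have "\<exists>p. case p of (c, \<iota>) \<Rightarrow> is_copower C S X c \<iota>" by auto
  from someI_ex[OF this] have "case copower C S X of (c, \<iota>) \<Rightarrow> is_copower C S X c \<iota>" unfolding copower_def .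
  then show ?thesis by (simp split: prod.splits)
qed

lemma copower_ex1:
  assumes "is_copower C S X c \<iota>" "d \<in> Obj C" "\<forall>s\<in>S. f s \<in> hom C X d"
  shows "\<exists>!h. h \<in> hom C c d \<and> (\<forall>s\<in>S. Comp C h (\<iota> s) = f s)"
  using assms unfolding is_copower_def by blast

lemma (in category) copower_eqI:
  assumes cop: "is_copower C S X c \<iota>" and h: "h \<in> hom C c d" "h' \<in> hom C c d"
    and eq: "\<And>s. s \<in> S \<Longrightarrow> Comp C h (\<iota> s) = Comp C h' (\<iota> s)"
  shows "h = h'"
proof -
  have d: "d \<in> Obj C" using hom_Obj[OF h(1)] by simp
  have "\<forall>s\<in>S. Comp C h (\<iota> s) \<in> hom C X d"
    using cop Comp_in[OF _ h(1)] unfolding is_copower_def by blast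
  from copower_ex1[OF cop d this] obtain k
    where "\<forall>h'. h' \<in> hom C c d \<and> (\<forall>s\<in>S. Comp C h' (\<iota> s) = Comp C h (\<iota> s)) \<longrightarrow> h' = k" by (elim ex1E) (rule that)
  then have "h = k" "h' = k" using h eq by simp_all
  then show ?thesis by simp
qed

lemma (in category) copower_map:
  assumes cop: "is_copower C S X c \<iota>" "is_copower C S' Y c' \<iota>'"
    and c: "copower C S X = (c, \<iota>)" "copower C S' Y = (c', \<iota>')"
    and \<sigma>: "\<forall>s\<in>S. \<sigma> s \<in> S'" and f: "f \<in> hom C X Y"
  shows "copower_map C S S' \<sigma> f \<in> hom C c c'"
    and "s \<in> S \<Longrightarrow> Comp C (copower_map C S S' \<sigma> f) (\<iota> s) = Comp C (\<iota>' (\<sigma> s)) f"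
proof -
  let ?P = "\<lambda>h. h \<in> hom C c c' \<and> (\<forall>s\<in>S. Comp C h (\<iota> s) = Comp C (\<iota>' (\<sigma> s)) f)"
  have c': "c' \<in> Obj C" using cop(2) by (simp add: is_copower_def)
  have "\<forall>s\<in>S. Comp C (\<iota>' (\<sigma> s)) f \<in> hom C X c'"
    using cop(2) \<sigma> Comp_in[OF f] by (simp add: is_copower_def)
  from theI'[OF copower_ex1[OF cop(1) c' this]] have "?P (THE h. ?P h)" by simp
  moreover have "copower_map C S S' \<sigma> f = (THE h. ?P h)"
    unfolding copower_map_def using homD[OF f] c by simp
  ultimately show "copower_map C S S' \<sigma> f \<in> hom C c c'"
    "s \<in> S \<Longrightarrow> Comp C (copower_map C S S' \<sigma> f) (\<iota> s) = Comp C (\<iota>' (\<sigma> s)) f" by auto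
qed

text \<open>
  The colimit of the identity weighted by \<open>P\<close>, without coends and copowers: \<open>e P\<close> carries a universal natural
  transformation \<open>\<epsilon> P : P \<rightarrow> hom(-, e P)\<close>.
\<close>

locale weighted_colimits = C: category C for C :: "('o, 'a) cat" +
  fixes \<kappa> :: "'k rel" and e :: "(('o, 'a, 'k) presheaf, ('o, 'a, 'k) psh_arr, 'o, 'a) func"
    and \<epsilon> :: "('o, 'a, 'k) presheaf \<Rightarrow> 'o \<Rightarrow> 'k \<Rightarrow> 'a"
  assumes e_functor: "is_functor (PSh \<kappa> C) C e"
    and eps_hom: "\<lbrakk>P \<in> Obj (PSh \<kappa> C); X \<in> Obj C; x \<in> POb P X\<rbrakk> \<Longrightarrow> \<epsilon> P X x \<in> hom C X (FOb e P)"
    and eps_nat: "\<lbrakk>P \<in> Obj (PSh \<kappa> C); f \<in> hom C X Y; y \<in> POb P Y\<rbrakk> \<Longrightarrow> Comp C (\<epsilon> P Y y) f = \<epsilon> P X (PAr P f y)"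
    and eps_act: "\<lbrakk>a \<in> hom (PSh \<kappa> C) P Q; X \<in> Obj C; x \<in> POb P X\<rbrakk>
          \<Longrightarrow> Comp C (FAr e a) (\<epsilon> P X x) = \<epsilon> Q X (psh_map a X x)"
    and eps_ex: "\<lbrakk>P \<in> Obj (PSh \<kappa> C); d \<in> Obj C; \<And>X x. X \<in> Obj C \<Longrightarrow> x \<in> POb P X \<Longrightarrow> \<phi> X x \<in> hom C X d;
          \<And>f X Y y. f \<in> hom C X Y \<Longrightarrow> y \<in> POb P Y \<Longrightarrow> \<phi> X (PAr P f y) = Comp C (\<phi> Y y) f\<rbrakk>
          \<Longrightarrow> \<exists>h\<in>hom C (FOb e P) d. \<forall>X\<in>Obj C. \<forall>x\<in>POb P X. Comp C h (\<epsilon> P X x) = \<phi> X x"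
    and eps_eqI: "\<lbrakk>P \<in> Obj (PSh \<kappa> C); h \<in> hom C (FOb e P) d; h' \<in> hom C (FOb e P) d;
          \<And>X x. X \<in> Obj C \<Longrightarrow> x \<in> POb P X \<Longrightarrow> Comp C h (\<epsilon> P X x) = Comp C h' (\<epsilon> P X x)\<rbrakk> \<Longrightarrow> h = h'"

text \<open>Maps from the copower of \<open>X\<close> by \<open>POb P X\<close> to \<open>d\<close>
  are functions from \<open>POb P X\<close> to the arrows from \<open>X\<close> to \<open>d\<close>.
  Under this correspondence cowedges become natural transformations from \<open>P\<close> to
  \<open>hom(-, d)\<close>, and the universal cowedge becomes \<epsilon>.\<close>

lemma weighted_colimits_exists:
  fixes \<kappa> :: "'k rel" and C :: "('o, 'a) cat"
  assumes C: "category C" and coc: "cocomplete \<kappa> C" and e: "is_weighted_colimit_choice \<kappa> C e"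
  shows "\<exists>\<epsilon>. weighted_colimits C \<kappa> e \<epsilon>"
proof -
  interpret category C by fact
  let ?cowedge = "\<lambda>P. is_cowedge C C (tensor0 C P) (tensor1 C P)"
  let ?A = "PSh \<kappa> C"
  have ef: "is_functor ?A C e" using e unfolding is_weighted_colimit_choice_def by blast
  obtain w where w': "\<forall>P\<in>Obj ?A. is_coend C C (tensor0 C P) (tensor1 C P) (FOb e P) (w P)"
    "\<forall>(P, Q, \<alpha>)\<in>Arr ?A. \<forall>X\<in>Obj C. Comp C (FAr e (P, Q, \<alpha>)) (w P X) =
      Comp C (w Q X) (copower_map C (POb P X) (POb Q X) (\<alpha> X) (Ide C X))"
    using e unfolding is_weighted_colimit_choice_def by blast
  have w: "is_coend C C (tensor0 C P) (tensor1 C P) (FOb e P) (w P)" if "P \<in> Obj ?A" for P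
    using w'(1) that by blast
  have wact: "Comp C (FAr e (P, Q, \<alpha>)) (w P X) = Comp C (w Q X) (copower_map C (POb P X) (POb Q X) (\<alpha> X) (Ide C X))"
    if "(P, Q, \<alpha>) \<in> Arr ?A" "X \<in> Obj C" for P Q \<alpha> X
    using bspec[OF w'(2) that(1)] that(2) by simp
  define c where "c P X Y = fst (copower C (POb P X) Y)" for P :: "('o, 'a, 'k) presheaf" and X Y
  define i where "i P X Y = snd (copower C (POb P X) Y)" for P :: "('o, 'a, 'k) presheaf" and X Y
  have t0: "tensor0 C P = c P" for P by (intro ext) (simp add: tensor0_def c_def)
  have pre: "is_presheaf \<kappa> C P" if "P \<in> Obj ?A" for P using that by (simp add: PSh_Obj small_presheaf_is_presheaf)
  have ci: "copower C (POb P X) Y = (c P X Y, i P X Y)" for P X Y by (simp add: c_def i_def)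
  have cop: "is_copower C (POb P X) Y (c P X Y) (i P X Y)" if "P \<in> Obj ?A" "X \<in> Obj C" "Y \<in> Obj C" for P X Y
    using copower[OF coc presheaf_small[OF pre[OF that(1)] that(2)] that(3)] by (simp add: c_def i_def)
  have i_in: "i P X Y x \<in> hom C Y (c P X Y)" if "P \<in> Obj ?A" "X \<in> Obj C" "Y \<in> Obj C" "x \<in> POb P X" for P X Y x
    using cop[OF that(1-3)] that(4) unfolding is_copower_def by blast
  \<comment> \<open>For \<open>f\<close> from \<open>A\<close> to \<open>B\<close>, both sides of
    the cowedge equation leave the copower of \<open>A\<close> by \<open>POb P B\<close>, so they
    may be compared on its injections. What remains is naturality of the transformation obtained by
    composing \<open>v\<close> with the injections.\<close>
  have cowedge_iff: "?cowedge P d v \<longleftrightarrow>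
      (\<forall>f\<in>Arr C. \<forall>s\<in>POb P (Cod C f).
        Comp C (v (Dom C f)) (i P (Dom C f) (Dom C f) (PAr P f s)) = Comp C (Comp C (v (Cod C f)) (i P (Cod C f) (Cod C f) s)) f)"
    if P: "P \<in> Obj ?A" and d: "d \<in> Obj C" and v_all: "\<forall>X\<in>Obj C. v X \<in> hom C (c P X X) d" for P d v
  proof -
    have v: "v X \<in> hom C (c P X X) d" if "X \<in> Obj C" for X using v_all that by blast
    have "Comp C (v A) (tensor1 C P f (Ide C A)) = Comp C (v B) (tensor1 C P (Ide C B) f) \<longleftrightarrow>
        (\<forall>s\<in>POb P B. Comp C (v A) (i P A A (PAr P f s)) = Comp C (Comp C (v B) (i P B B s)) f)"
      if f: "f \<in> hom C A B" for f A B
    proof -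
      have AB: "A \<in> Obj C" "B \<in> Obj C" using hom_Obj[OF f] by auto
      have Pf: "PAr P f s \<in> POb P A" if "s \<in> POb P B" for s using presheaf_act[OF pre[OF P] f that] .
      have Pid: "PAr P (Ide C B) s \<in> POb P B" if "s \<in> POb P B" for s using presheaf_Ide[OF pre[OF P] AB(2) that] that by simp
      note dI = homD[OF Ide_in[OF AB(2)]]
      have P_all: "\<forall>s\<in>POb P B. PAr P f s \<in> POb P A" "\<forall>s\<in>POb P B. PAr P (Ide C B) s \<in> POb P B"
        using Pf Pid by auto
      note l = copower_map[OF cop[OF P AB(2,1)] cop[OF P AB(1,1)] ci ci P_all(1) Ide_in[OF AB(1)]]
      note r = copower_map[OF cop[OF P AB(2,1)] cop[OF P AB(2,2)] ci ci P_all(2) f]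
      have lt: "tensor1 C P f (Ide C A) = copower_map C (POb P B) (POb P A) (PAr P f) (Ide C A)"
        using homD[OF f] by (simp add: tensor1_def)
      have rt: "tensor1 C P (Ide C B) f = copower_map C (POb P B) (POb P B) (PAr P (Ide C B)) f"
        using dI by (simp add: tensor1_def)
      have lin: "tensor1 C P f (Ide C A) \<in> hom C (c P B A) (c P A A)" using l(1) unfolding lt by blast
      have rin: "tensor1 C P (Ide C B) f \<in> hom C (c P B A) (c P B B)" using r(1) unfolding rt by blast
      have L: "Comp C (Comp C (v A) (tensor1 C P f (Ide C A))) (i P B A s) = Comp C (v A) (i P A A (PAr P f s))"
        if s: "s \<in> POb P B" for s
        using Comp_assoc[OF i_in[OF P AB(2,1) s] lin v[OF AB(1)]] l(2)[OF s] Comp_Ide[OF i_in[OF P AB(1,1) Pf[OF s]]]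
        unfolding lt by simp
      have R: "Comp C (Comp C (v B) (tensor1 C P (Ide C B) f)) (i P B A s) = Comp C (Comp C (v B) (i P B B s)) f"
        if s: "s \<in> POb P B" for s
        using Comp_assoc[OF i_in[OF P AB(2,1) s] rin v[OF AB(2)]] r(2)[OF s] presheaf_Ide[OF pre[OF P] AB(2) s]
          Comp_assoc[OF f i_in[OF P AB(2,2) s] v[OF AB(2)]]
        unfolding rt by simp
      show ?thesis
      proof
        assume "Comp C (v A) (tensor1 C P f (Ide C A)) = Comp C (v B) (tensor1 C P (Ide C B) f)"
        then show "\<forall>s\<in>POb P B. Comp C (v A) (i P A A (PAr P f s)) = Comp C (Comp C (v B) (i P B B s)) f"
          using L R by metis
      next
        assume *: "\<forall>s\<in>POb P B. Comp C (v A) (i P A A (PAr P f s)) = Comp C (Comp C (v B) (i P B B s)) f"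
        show "Comp C (v A) (tensor1 C P f (Ide C A)) = Comp C (v B) (tensor1 C P (Ide C B) f)"
          by (rule copower_eqI[OF cop[OF P AB(2,1)] Comp_in[OF lin v[OF AB(1)]] Comp_in[OF rin v[OF AB(2)]]])
            (use * L R in simp)
      qed
    qed
    from this[OF homI] show ?thesis unfolding is_cowedge_def t0 using v d by auto
  qed
  \<comment> \<open>A leg of the coend after a copower injection: the transform of \<open>w\<close>
    under the correspondence of \<open>cowedge_iff\<close>.\<close>
  define \<epsilon> where "\<epsilon> P X x = Comp C (w P X) (i P X X x)" for P X x
  have wc: "?cowedge P (FOb e P) (w P)" if "P \<in> Obj ?A" for P
    using w[OF that] unfolding is_coend_def by blast
  have w_in: "w P X \<in> hom C (c P X X) (FOb e P)" if "P \<in> Obj ?A" "X \<in> Obj C" for P X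
    using wc[OF that(1)] that(2) unfolding is_cowedge_def t0 by blast
  have w_all: "\<forall>X\<in>Obj C. w P X \<in> hom C (c P X X) (FOb e P)" if "P \<in> Obj ?A" for P
    using w_in[OF that] by blast
  have eP: "FOb e P \<in> Obj C" if "P \<in> Obj ?A" for P using functor_Obj[OF ef that] .
  have eps_hom: "\<epsilon> P X x \<in> hom C X (FOb e P)" if "P \<in> Obj ?A" "X \<in> Obj C" "x \<in> POb P X" for P X x
    unfolding \<epsilon>_def using that by (intro Comp_in[OF i_in w_in])
  have he: "Comp C h (\<epsilon> P X x) = Comp C (Comp C h (w P X)) (i P X X x)"
    if "P \<in> Obj ?A" "X \<in> Obj C" "x \<in> POb P X" "h \<in> hom C (FOb e P) d" for P X x h d
    unfolding \<epsilon>_def using that by (intro Comp_assoc[OF i_in w_in])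
  have "weighted_colimits C \<kappa> e \<epsilon>"
  proof
    show "is_functor ?A C e" by (rule ef)
    show "\<And>P X x. P \<in> Obj ?A \<Longrightarrow> X \<in> Obj C \<Longrightarrow> x \<in> POb P X \<Longrightarrow> \<epsilon> P X x \<in> hom C X (FOb e P)" by (rule eps_hom)
    show "Comp C (\<epsilon> P Y y) f = \<epsilon> P X (PAr P f y)" if P: "P \<in> Obj ?A" and f: "f \<in> hom C X Y" and y: "y \<in> POb P Y"
      for P f X Y y
      using wc[OF P] homD[OF f] y unfolding cowedge_iff[OF P eP[OF P] w_all[OF P]] \<epsilon>_def by auto
    show "Comp C (FAr e a) (\<epsilon> P X x) = \<epsilon> Q X (psh_map a X x)"
      if a: "a \<in> hom ?A P Q" and X: "X \<in> Obj C" and x: "x \<in> POb P X" for a P Q X x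
    proof -
      have P: "P \<in> Obj ?A" and Q: "Q \<in> Obj ?A" using a by (auto simp: PSh_hom PSh_Obj)
      have a_eq: "a = (P, Q, psh_map a)" using a by (simp add: PSh_hom)
      then have arr: "(P, Q, psh_map a) \<in> Arr ?A" using homD[OF a] by simp
      have ax: "psh_map a X y \<in> POb Q X" if "y \<in> POb P X" for y using PSh_hom_map[OF a X that] .
      have ax_all: "\<forall>y\<in>POb P X. psh_map a X y \<in> POb Q X" using ax by blast
      note cm = copower_map[OF cop[OF P X X] cop[OF Q X X] ci ci ax_all Ide_in[OF X]]
      have cin: "copower_map C (POb P X) (POb Q X) (psh_map a X) (Ide C X) \<in> hom C (c P X X) (c Q X X)" using cm(1) by blast
      have "Comp C (FAr e a) (\<epsilon> P X x) = Comp C (Comp C (w Q X) (copower_map C (POb P X) (POb Q X) (psh_map a X) (Ide C X))) (i P X X x)"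
        using he[OF P X x functor_hom[OF ef a]] wact[OF arr X] a_eq by simp
      also have "\<dots> = Comp C (w Q X) (Comp C (i Q X X (psh_map a X x)) (Ide C X))"
        using Comp_assoc[OF i_in[OF P X X x] cin w_in[OF Q X]] cm(2)[OF x] by simp
      also have "\<dots> = \<epsilon> Q X (psh_map a X x)" using Comp_Ide[OF i_in[OF Q X X ax[OF x]]] by (simp add: \<epsilon>_def)
      finally show ?thesis .
    qed
    show "h = h'" if P: "P \<in> Obj ?A" and h: "h \<in> hom C (FOb e P) d" "h' \<in> hom C (FOb e P) d"
      and eq: "\<And>X x. X \<in> Obj C \<Longrightarrow> x \<in> POb P X \<Longrightarrow> Comp C h (\<epsilon> P X x) = Comp C h' (\<epsilon> P X x)" for P d h h'
    proof -
      have d: "d \<in> Obj C" using hom_Obj[OF h(1)] by simp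
      \<comment> \<open>Uniqueness for the coend concerns maps with prescribed legs. The composites
        of \<open>h\<close> with \<open>w\<close> form a cowedge, and \<open>h'\<close> has the same
        legs because legs are determined on copower injections, where \<open>eq\<close>
        applies.\<close>
      let ?v = "\<lambda>X. Comp C h (w P X)"
      have v: "?v X \<in> hom C (c P X X) d" if "X \<in> Obj C" for X using Comp_in[OF w_in[OF P that] h(1)] .
      then have v_all: "\<forall>X\<in>Obj C. ?v X \<in> hom C (c P X X) d" by blast
      have "?cowedge P d ?v"
        unfolding cowedge_iff[OF P d v_all]
      proof (intro ballI)
        fix f s assume f: "f \<in> Arr C" and s: "s \<in> POb P (Cod C f)"
        have fs: "PAr P f s \<in> POb P (Dom C f)" using presheaf_act[OF pre[OF P] homI[OF f] s] .
        have "\<epsilon> P (Dom C f) (PAr P f s) = Comp C (\<epsilon> P (Cod C f) s) f"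
          using wc[OF P] f s unfolding cowedge_iff[OF P eP[OF P] w_all[OF P]] \<epsilon>_def by auto
        then show "Comp C (?v (Dom C f)) (i P (Dom C f) (Dom C f) (PAr P f s)) =
            Comp C (Comp C (?v (Cod C f)) (i P (Cod C f) (Cod C f) s)) f"
          using he[OF P Dom_in[OF f] fs h(1)] he[OF P Cod_in[OF f] s h(1)]
            Comp_assoc[OF homI[OF f] eps_hom[OF P Cod_in[OF f] s] h(1)] by simp
      qed
      then have "\<exists>!k. k \<in> hom C (FOb e P) d \<and> (\<forall>X\<in>Obj C. Comp C k (w P X) = ?v X)"
        using w[OF P] unfolding is_coend_def by blast
      moreover have "Comp C h' (w P X) = ?v X" if X: "X \<in> Obj C" for X
        by (rule copower_eqI[OF cop[OF P X X] Comp_in[OF w_in[OF P X] h(2)] v[OF X]])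
          (use eq[OF X] he[OF P X _ h(1)] he[OF P X _ h(2)] in simp)
      ultimately show ?thesis using h by blast
    qed
    fix P d \<phi> assume P: "P \<in> Obj ?A" and d: "d \<in> Obj C"
      and \<phi>: "\<And>X x. X \<in> Obj C \<Longrightarrow> x \<in> POb P X \<Longrightarrow> \<phi> X x \<in> hom C X d"
        "\<And>f X Y y. f \<in> hom C X Y \<Longrightarrow> y \<in> POb P Y \<Longrightarrow> \<phi> X (PAr P f y) = Comp C (\<phi> Y y) f"
    \<comment> \<open>The copowers assemble the values of \<phi> at \<open>X\<close> into one arrow,
      and these arrows are the legs of a cowedge.\<close>
    have "\<forall>X\<in>Obj C. \<exists>h. h \<in> hom C (c P X X) d \<and> (\<forall>x\<in>POb P X. Comp C h (i P X X x) = \<phi> X x)"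
    proof
      fix X assume X: "X \<in> Obj C"
      have "\<forall>x\<in>POb P X. \<phi> X x \<in> hom C X d" using \<phi>(1)[OF X] by blast
      then have "\<exists>!h. h \<in> hom C (c P X X) d \<and> (\<forall>x\<in>POb P X. Comp C h (i P X X x) = \<phi> X x)"
        using cop[OF P X X] d unfolding is_copower_def by blast
      then show "\<exists>h. h \<in> hom C (c P X X) d \<and> (\<forall>x\<in>POb P X. Comp C h (i P X X x) = \<phi> X x)" by blast
    qed
    then obtain v where v: "\<And>X. X \<in> Obj C \<Longrightarrow> v X \<in> hom C (c P X X) d"
      "\<And>X x. X \<in> Obj C \<Longrightarrow> x \<in> POb P X \<Longrightarrow> Comp C (v X) (i P X X x) = \<phi> X x" by metis
    have v_all: "\<forall>X\<in>Obj C. v X \<in> hom C (c P X X) d" using v(1) by blast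
    have "?cowedge P d v"
      unfolding cowedge_iff[OF P d v_all]
    proof (intro ballI)
      fix f s assume f: "f \<in> Arr C" and s: "s \<in> POb P (Cod C f)"
      show "Comp C (v (Dom C f)) (i P (Dom C f) (Dom C f) (PAr P f s)) =
          Comp C (Comp C (v (Cod C f)) (i P (Cod C f) (Cod C f) s)) f"
        using v(2)[OF Dom_in[OF f] presheaf_act[OF pre[OF P] homI[OF f] s]] v(2)[OF Cod_in[OF f] s] \<phi>(2)[OF homI[OF f] s]
        by simp
    qed
    then obtain h where h: "h \<in> hom C (FOb e P) d" "\<forall>X\<in>Obj C. Comp C h (w P X) = v X"
      using w[OF P] unfolding is_coend_def by blast
    then have "\<forall>X\<in>Obj C. \<forall>x\<in>POb P X. Comp C h (\<epsilon> P X x) = \<phi> X x"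
      using he[OF P _ _ h(1)] v(2) by simp
    then show "\<exists>h\<in>hom C (FOb e P) d. \<forall>X\<in>Obj C. \<forall>x\<in>POb P X. Comp C h (\<epsilon> P X x) = \<phi> X x" using h(1) by blast
  qed
  then show ?thesis by blast
qed

section \<open>Kan extensions obtained from weighted colimits\<close>

lemma is_nat_transI:
  assumes "\<alpha> \<in> extensional (Obj C)" "\<And>X. X \<in> Obj C \<Longrightarrow> \<alpha> X \<in> hom D (FOb F X) (FOb G X)"
    "\<And>f X Y. f \<in> hom C X Y \<Longrightarrow> Comp D (\<alpha> Y) (FAr F f) = Comp D (FAr G f) (\<alpha> X)"
  shows "is_nat_trans C D F G \<alpha>"
  unfolding is_nat_trans_def using assms(1,2) assms(3)[OF homI] by (auto simp: PiE_iff)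

lemma is_nat_trans_hom: "is_nat_trans C D F G \<alpha> \<Longrightarrow> X \<in> Obj C \<Longrightarrow> \<alpha> X \<in> hom D (FOb F X) (FOb G X)"
  unfolding is_nat_trans_def by (auto dest: PiE_mem)

lemma is_nat_trans_nat: "is_nat_trans C D F G \<alpha> \<Longrightarrow> f \<in> hom C X Y \<Longrightarrow> Comp D (\<alpha> Y) (FAr F f) = Comp D (FAr G f) (\<alpha> X)"
  unfolding is_nat_trans_def hom_def by auto

lemma is_nat_trans_eqI:
  assumes "is_nat_trans C D F G \<alpha>" "is_nat_trans C D F' G' \<beta>" "\<And>X. X \<in> Obj C \<Longrightarrow> \<alpha> X = \<beta> X"
  shows "\<alpha> = \<beta>"
proof -
  have "\<alpha> \<in> extensional (Obj C)" "\<beta> \<in> extensional (Obj C)"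
    using assms(1,2) unfolding is_nat_trans_def PiE_iff by auto
  then show ?thesis by (rule extensionalityI) (rule assms(3))
qed

locale presheaf_kan_colim = presheaf_kan_ext J K C \<kappa> F D G x + weighted_colimits C \<kappa> e \<epsilon>
  for J :: "('j, 'i) cat" and K :: "('l, 'n) cat" and C :: "('o, 'a) cat" and \<kappa> :: "'k rel"
    and F D G x e \<epsilon>
begin

text \<open>Arrows from \<open>e (G k)\<close> to \<open>H k\<close> are transformations from
  \<open>G k\<close> to \<open>hom(-, H k)\<close>. By the presentation of \<open>G k\<close> these
  are compatible families of arrows from \<open>D j\<close> to \<open>H k\<close> indexed by the
  objects \<open>(j, u)\<close> of the comma category, and such a family is obtained from \<gamma>
  as \<open>H u\<close> after \<open>\<gamma> j\<close>. The unit is \<epsilon> at the elements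
  \<open>x j\<close>, restricted because natural transformations are extensional.\<close>

lemma left_kan_ext:
  "is_left_kan_ext J K C F D (fcomp e G) (\<lambda>j\<in>Obj J. \<epsilon> (FOb G (FOb F j)) (FOb D j) (x j))"
  (is "is_left_kan_ext J K C F D ?L ?\<eta>")
  unfolding is_left_kan_ext_def
proof (intro conjI allI impI)
  show "is_functor K C ?L" by (rule functor_fcomp[OF G e_functor])
  have Fj: "FOb F j \<in> Obj K" "FOb D j \<in> Obj C" if "j \<in> Obj J" for j
    using functor_Obj[OF F that] functor_Obj[OF D that] .
  have Gk: "FOb G k \<in> Obj (PSh \<kappa> C)" if "k \<in> Obj K" for k using functor_Obj[OF G that] .
  have idF: "Ide K (FOb F j) \<in> hom K (FOb F j) (FOb F j)" if "j \<in> Obj J" for j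
    using K.Ide_in[OF Fj(1)[OF that]] .
  have eta: "?\<eta> j \<in> hom C (FOb D j) (FOb ?L (FOb F j))" if "j \<in> Obj J" for j
    using eps_hom[OF Gk[OF Fj(1)[OF that]] Fj(2)[OF that] x_in[OF that]] that by simp
  show "is_nat_trans J C D (fcomp ?L F) ?\<eta>"
  proof (rule is_nat_transI)
    fix v j j' assume v: "v \<in> hom J j j'"
    have j: "j \<in> Obj J" "j' \<in> Obj J" using J.hom_Obj[OF v] by auto
    have "Comp C (?\<eta> j') (FAr D v) = \<epsilon> (FOb G (FOb F j')) (FOb D j) (PAr (FOb G (FOb F j')) (FAr D v) (x j'))"
      using eps_nat[OF Gk[OF Fj(1)[OF j(2)]] functor_hom[OF D v] x_in[OF j(2)]] j by simp
    also have "PAr (FOb G (FOb F j')) (FAr D v) (x j') = gen j (FAr F v)"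
      using gen_nat[OF v idF[OF j(2)]] gen_Ide[OF j(2)] K.Ide_Comp[OF functor_hom[OF F v]] by simp
    finally show "Comp C (?\<eta> j') (FAr D v) = Comp C (FAr (fcomp ?L F) v) (?\<eta> j)"
      using eps_act[OF functor_hom[OF G functor_hom[OF F v]] Fj(2)[OF j(1)] x_in[OF j(1)]] j by simp
  qed (use eta in auto)
  fix H \<gamma> assume "is_functor K C H \<and> is_nat_trans J C D (fcomp H F) \<gamma>"
  then have H: "is_functor K C H" and \<gamma>: "is_nat_trans J C D (fcomp H F) \<gamma>" by auto
  have \<gamma>_in: "\<gamma> j \<in> hom C (FOb D j) (FOb H (FOb F j))" if "j \<in> Obj J" for j using is_nat_trans_hom[OF \<gamma> that] by simp
  \<comment> \<open>The values that naturality and the equation with \<gamma> force on generators.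
    Since \<epsilon> is jointly epic and generators reach every element, this property determines
    \<open>d\<close>.\<close>
  define mediates where "mediates k d \<longleftrightarrow> d \<in> hom C (FOb e (FOb G k)) (FOb H k) \<and>
      (\<forall>j u f X. j \<in> Obj J \<longrightarrow> u \<in> hom K (FOb F j) k \<longrightarrow> f \<in> hom C X (FOb D j) \<longrightarrow>
      Comp C d (\<epsilon> (FOb G k) X (PAr (FOb G k) f (gen j u))) = Comp C (Comp C (FAr H u) (\<gamma> j)) f)" for k d
  have "\<exists>d. mediates k d" if k: "k \<in> Obj K" for k
  proof -
    have "\<exists>g. \<forall>j u f. j \<in> Obj J \<longrightarrow> u \<in> hom K (FOb F j) k \<longrightarrow> f \<in> hom C X (FOb D j) \<longrightarrow>
        g (PAr (FOb G k) f (gen j u)) = Comp C (Comp C (FAr H u) (\<gamma> j)) f" if X: "X \<in> Obj C" for X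
    proof (rule gen_lift[OF k X, of "\<lambda>j u f. Comp C (Comp C (FAr H u) (\<gamma> j)) f"])
      fix v j j' u f assume v: "v \<in> hom J j j'" and u: "u \<in> hom K (FOb F j') k" and f: "f \<in> hom C X (FOb D j)"
      have j: "j \<in> Obj J" "j' \<in> Obj J" using J.hom_Obj[OF v] by auto
      note Dv = functor_hom[OF D v] and Fv = functor_hom[OF F v]
      note Hu = functor_hom[OF H u] and HFv = functor_hom[OF H Fv]
      have "Comp C (Comp C (FAr H u) (\<gamma> j')) (Comp C (FAr D v) f) = Comp C (Comp C (FAr H u) (Comp C (\<gamma> j') (FAr D v))) f"
        using C.Comp_assoc[OF f Dv C.Comp_in[OF \<gamma>_in[OF j(2)] Hu]] C.Comp_assoc[OF Dv \<gamma>_in[OF j(2)] Hu] by simp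
      also have "\<dots> = Comp C (Comp C (FAr H (Comp K u (FAr F v))) (\<gamma> j)) f"
        using is_nat_trans_nat[OF \<gamma> v] C.Comp_assoc[OF \<gamma>_in[OF j(1)] HFv Hu] functor_Comp[OF H Fv u] by simp
      finally show "Comp C (Comp C (FAr H u) (\<gamma> j')) (Comp C (FAr D v) f) = Comp C (Comp C (FAr H (Comp K u (FAr F v))) (\<gamma> j)) f" .
    qed
    then have "\<forall>X\<in>Obj C. \<exists>g. \<forall>j u f. j \<in> Obj J \<longrightarrow> u \<in> hom K (FOb F j) k \<longrightarrow> f \<in> hom C X (FOb D j) \<longrightarrow>
        g (PAr (FOb G k) f (gen j u)) = Comp C (Comp C (FAr H u) (\<gamma> j)) f" by blast
    from bchoice[OF this] obtain \<phi> where \<phi>: "\<forall>X\<in>Obj C. \<forall>j u f. j \<in> Obj J \<longrightarrow> u \<in> hom K (FOb F j) k \<longrightarrow> f \<in> hom C X (FOb D j) \<longrightarrow>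
        \<phi> X (PAr (FOb G k) f (gen j u)) = Comp C (Comp C (FAr H u) (\<gamma> j)) f" ..
    have \<phi>eq: "\<phi> X (PAr (FOb G k) f (gen j u)) = Comp C (Comp C (FAr H u) (\<gamma> j)) f"
      if "j \<in> Obj J" "u \<in> hom K (FOb F j) k" "f \<in> hom C X (FOb D j)" for j u f X
      using \<phi> that C.hom_Obj[OF that(3)] by blast
    have "\<exists>d\<in>hom C (FOb e (FOb G k)) (FOb H k). \<forall>X\<in>Obj C. \<forall>y\<in>POb (FOb G k) X. Comp C d (\<epsilon> (FOb G k) X y) = \<phi> X y"
    proof (rule eps_ex[OF Gk[OF k] functor_Obj[OF H k]])
      fix X y assume X: "X \<in> Obj C" and y: "y \<in> POb (FOb G k) X"
      obtain j u f where j: "j \<in> Obj J" "u \<in> hom K (FOb F j) k" "f \<in> hom C X (FOb D j)" "y = PAr (FOb G k) f (gen j u)"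
        by (rule gen_ex[OF k X y])
      show "\<phi> X y \<in> hom C X (FOb H k)"
        unfolding j(4) \<phi>eq[OF j(1-3)] by (rule C.Comp_in[OF j(3) C.Comp_in[OF \<gamma>_in[OF j(1)] functor_hom[OF H j(2)]]])
    next
      fix h X Y y assume h: "h \<in> hom C X Y" and y: "y \<in> POb (FOb G k) Y"
      have XY: "Y \<in> Obj C" using C.hom_Obj[OF h] by simp
      obtain j u f where j: "j \<in> Obj J" "u \<in> hom K (FOb F j) k" "f \<in> hom C Y (FOb D j)" "y = PAr (FOb G k) f (gen j u)"
        by (rule gen_ex[OF k XY y])
      have "PAr (FOb G k) h y = PAr (FOb G k) (Comp C f h) (gen j u)"
        using presheaf_Comp[OF G_presheaf[OF k] h j(3) gen_in[OF j(1,2)]] j(4) by simp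
      then show "\<phi> X (PAr (FOb G k) h y) = Comp C (\<phi> Y y) h"
        using \<phi>eq[OF j(1,2) C.Comp_in[OF h j(3)]] \<phi>eq[OF j(1-3)] j(4)
          C.Comp_assoc[OF h j(3) C.Comp_in[OF \<gamma>_in[OF j(1)] functor_hom[OF H j(2)]]] by simp
    qed
    then obtain d where d: "d \<in> hom C (FOb e (FOb G k)) (FOb H k)"
      "\<forall>X\<in>Obj C. \<forall>y\<in>POb (FOb G k) X. Comp C d (\<epsilon> (FOb G k) X y) = \<phi> X y" by blast
    have "Comp C d (\<epsilon> (FOb G k) X (PAr (FOb G k) f (gen j u))) = Comp C (Comp C (FAr H u) (\<gamma> j)) f"
      if "j \<in> Obj J" "u \<in> hom K (FOb F j) k" "f \<in> hom C X (FOb D j)" for j u f X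
      using d(2) \<phi>eq[OF that] presheaf_act[OF G_presheaf[OF k] that(3) gen_in[OF that(1,2)]] C.hom_Obj[OF that(3)] by simp
    then show ?thesis using d(1) unfolding mediates_def by blast
  qed
  then obtain \<delta> where \<delta>: "\<And>k. k \<in> Obj K \<Longrightarrow> mediates k (\<delta> k)" by metis
  have \<delta>_in: "\<delta> k \<in> hom C (FOb e (FOb G k)) (FOb H k)" if "k \<in> Obj K" for k
    using \<delta>[OF that] unfolding mediates_def by blast
  have \<delta>_gen: "Comp C (\<delta> k) (\<epsilon> (FOb G k) X (PAr (FOb G k) f (gen j u))) = Comp C (Comp C (FAr H u) (\<gamma> j)) f"
    if "k \<in> Obj K" "j \<in> Obj J" "u \<in> hom K (FOb F j) k" "f \<in> hom C X (FOb D j)" for k j u f X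
    using \<delta>[OF that(1)] that(2-) unfolding mediates_def by blast
  define \<delta>' where "\<delta>' = restrict \<delta> (Obj K)"
  have nat: "is_nat_trans K C ?L H \<delta>'"
  proof (rule is_nat_transI)
    fix w k k' assume w: "w \<in> hom K k k'"
    have k: "k \<in> Obj K" "k' \<in> Obj K" using K.hom_Obj[OF w] by auto
    note Gw = functor_hom[OF G w] and Hw = functor_hom[OF H w]
    note eGw = functor_hom[OF e_functor Gw]
    have "Comp C (\<delta> k') (FAr e (FAr G w)) = Comp C (FAr H w) (\<delta> k)"
    proof (rule eps_eqI[OF Gk[OF k(1)] C.Comp_in[OF eGw \<delta>_in[OF k(2)]] C.Comp_in[OF \<delta>_in[OF k(1)] Hw]])
      fix X y assume X: "X \<in> Obj C" and y: "y \<in> POb (FOb G k) X"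
      obtain j u f where j: "j \<in> Obj J" "u \<in> hom K (FOb F j) k" "f \<in> hom C X (FOb D j)" "y = PAr (FOb G k) f (gen j u)"
        by (rule gen_ex[OF k(1) X y])
      note ey = eps_hom[OF Gk[OF k(1)] X y]
      have "Comp C (Comp C (\<delta> k') (FAr e (FAr G w))) (\<epsilon> (FOb G k) X y) =
          Comp C (Comp C (FAr H (Comp K w u)) (\<gamma> j)) f"
        using C.Comp_assoc[OF ey eGw \<delta>_in[OF k(2)]] eps_act[OF Gw X y] gen_restrict_act[OF j(1-3) w] j(4)
          \<delta>_gen[OF k(2) j(1) K.Comp_in[OF j(2) w] j(3)] by simp
      also have "\<dots> = Comp C (FAr H w) (Comp C (Comp C (FAr H u) (\<gamma> j)) f)"
        using functor_Comp[OF H j(2) w] C.Comp_assoc[OF \<gamma>_in[OF j(1)] functor_hom[OF H j(2)] Hw]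
          C.Comp_assoc[OF j(3) C.Comp_in[OF \<gamma>_in[OF j(1)] functor_hom[OF H j(2)]] Hw] by simp
      also have "\<dots> = Comp C (Comp C (FAr H w) (\<delta> k)) (\<epsilon> (FOb G k) X y)"
        using \<delta>_gen[OF k(1) j(1-3)] j(4) C.Comp_assoc[OF ey \<delta>_in[OF k(1)] Hw] by simp
      finally show "Comp C (Comp C (\<delta> k') (FAr e (FAr G w))) (\<epsilon> (FOb G k) X y) =
          Comp C (Comp C (FAr H w) (\<delta> k)) (\<epsilon> (FOb G k) X y)" .
    qed
    then show "Comp C (\<delta>' k') (FAr ?L w) = Comp C (FAr H w) (\<delta>' k)" using k by (simp add: \<delta>'_def)
  qed (use \<delta>_in in \<open>auto simp: \<delta>'_def\<close>)
  have "Comp C (\<delta>' (FOb F j)) (?\<eta> j) = \<gamma> j" if j: "j \<in> Obj J" for j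
  proof -
    have "PAr (FOb G (FOb F j)) (Ide C (FOb D j)) (gen j (Ide K (FOb F j))) = x j"
      using presheaf_Ide[OF G_presheaf[OF Fj(1)[OF j]] Fj(2)[OF j] x_in[OF j]] gen_Ide[OF j] by simp
    moreover have "Comp C (Comp C (FAr H (Ide K (FOb F j))) (\<gamma> j)) (Ide C (FOb D j)) = \<gamma> j"
      using functor_Ide[OF H Fj(1)[OF j]] C.Ide_Comp[OF \<gamma>_in[OF j]] C.Comp_Ide[OF \<gamma>_in[OF j]] by simp
    ultimately show ?thesis
      using \<delta>_gen[OF Fj(1)[OF j] j idF[OF j] C.Ide_in[OF Fj(2)[OF j]]] Fj(1)[OF j] j by (simp add: \<delta>'_def)
  qed
  moreover have "\<delta>1 = \<delta>2"
    if n1: "is_nat_trans K C ?L H \<delta>1" and n2: "is_nat_trans K C ?L H \<delta>2"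
      and eq: "\<forall>j\<in>Obj J. Comp C (\<delta>1 (FOb F j)) (?\<eta> j) = Comp C (\<delta>2 (FOb F j)) (?\<eta> j)" for \<delta>1 \<delta>2
  proof (rule is_nat_trans_eqI[OF n1 n2])
    fix k assume k: "k \<in> Obj K"
    have in12: "\<delta>1 i \<in> hom C (FOb e (FOb G i)) (FOb H i)" "\<delta>2 i \<in> hom C (FOb e (FOb G i)) (FOb H i)" if "i \<in> Obj K" for i
      using is_nat_trans_hom[OF n1 that] is_nat_trans_hom[OF n2 that] by simp_all
    show "\<delta>1 k = \<delta>2 k"
    proof (rule eps_eqI[OF Gk[OF k] in12(1)[OF k] in12(2)[OF k]])
      fix X y assume X: "X \<in> Obj C" and y: "y \<in> POb (FOb G k) X"
      obtain j u f where j: "j \<in> Obj J" "u \<in> hom K (FOb F j) k" "f \<in> hom C X (FOb D j)" "y = PAr (FOb G k) f (gen j u)"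
        by (rule gen_ex[OF k X y])
      note Gu = functor_hom[OF G j(2)]
      note eGu = functor_hom[OF e_functor Gu]
      note ex = eps_hom[OF Gk[OF Fj(1)[OF j(1)]] Fj(2)[OF j(1)] x_in[OF j(1)]]
      note eg = eps_hom[OF Gk[OF k] Fj(2)[OF j(1)] gen_in[OF j(1,2)]]
      have ey: "\<epsilon> (FOb G k) X y = Comp C (\<epsilon> (FOb G k) (FOb D j) (gen j u)) f"
        using eps_nat[OF Gk[OF k] j(3) gen_in[OF j(1,2)]] j(4) by simp
      \<comment> \<open>Naturality at \<open>u\<close> reduces the value at \<open>k\<close> on a
        generator to the composite with the unit at \<open>j\<close>. The two transformations agree
        on the latter.\<close>
      have main: "Comp C (\<delta> k) (\<epsilon> (FOb G k) X y) = Comp C (Comp C (FAr H u) (Comp C (\<delta> (FOb F j)) (?\<eta> j))) f"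
        if n: "is_nat_trans K C ?L H \<delta>" for \<delta>
      proof -
        have di: "\<delta> i \<in> hom C (FOb e (FOb G i)) (FOb H i)" if "i \<in> Obj K" for i using is_nat_trans_hom[OF n that] by simp
        have "Comp C (\<delta> k) (\<epsilon> (FOb G k) X y) = Comp C (Comp C (\<delta> k) (\<epsilon> (FOb G k) (FOb D j) (gen j u))) f"
          unfolding ey using C.Comp_assoc[OF j(3) eg di[OF k]] .
        also have "\<epsilon> (FOb G k) (FOb D j) (gen j u) = Comp C (FAr e (FAr G u)) (?\<eta> j)"
          using eps_act[OF Gu Fj(2)[OF j(1)] x_in[OF j(1)]] j(1) by simp
        also have "Comp C (\<delta> k) (Comp C (FAr e (FAr G u)) (?\<eta> j)) = Comp C (Comp C (FAr H u) (\<delta> (FOb F j))) (?\<eta> j)"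
          using C.Comp_assoc[OF ex eGu di[OF k]] is_nat_trans_nat[OF n j(2)] j(1) by simp
        also have "\<dots> = Comp C (FAr H u) (Comp C (\<delta> (FOb F j)) (?\<eta> j))"
          using C.Comp_assoc[OF ex di[OF Fj(1)[OF j(1)]] functor_hom[OF H j(2)]] j(1) by simp
        finally show ?thesis .
      qed
      show "Comp C (\<delta>1 k) (\<epsilon> (FOb G k) X y) = Comp C (\<delta>2 k) (\<epsilon> (FOb G k) X y)"
        unfolding main[OF n1] main[OF n2] using eq j(1) by simp
    qed
  qed
  ultimately show "\<exists>!\<delta>. is_nat_trans K C ?L H \<delta> \<and> (\<forall>j\<in>Obj J. Comp C (\<delta> (FOb F j)) (?\<eta> j) = \<gamma> j)"
    using nat by (intro ex1I[of _ \<delta>']) (blast, metis (no_types, lifting))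
qed

end

section \<open>Coends over a category of presheaves\<close>

text \<open>The counterpart of \<open>colim_gen\<close> for coends: the relation inside
  \<open>coend_rel\<close> before its equivalence closure.\<close>

definition coend_gen ::
  "('x, 'y) cat \<Rightarrow> ('x \<Rightarrow> 'x \<Rightarrow> 't set) \<Rightarrow> ('y \<Rightarrow> 'y \<Rightarrow> 't \<Rightarrow> 't) \<Rightarrow> ('x \<times> 't) rel" where
  "coend_gen A T0 T1 =
     {((Dom A f, T1 f (Ide A (Dom A f)) t), (Cod A f, T1 (Ide A (Cod A f)) f t)) | f t.
        f \<in> Arr A \<and> t \<in> T0 (Cod A f) (Dom A f)}"

text \<open>
  A covariant functor \<open>W : A \<rightarrow> Set\<close> is tensored with a presheaf \<open>\<Phi>\<close> on \<open>A\<close> that is presented by the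
  elements \<open>t k\<close> of \<open>\<Phi>(G k)\<close>. By the co-Yoneda lemma, the coend of \<open>\<Phi>(R) \<times> W(R)\<close> is the colimit of \<open>W(G k)\<close>.
\<close>

locale presented_tensor = A: category A + K: category K
  for A :: "('x, 'y) cat" and K :: "('l, 'n) cat" +
  fixes \<kappa> :: "'k rel" and G :: "('l, 'n, 'x, 'y) func" and \<Phi> :: "('x, 'y, 'v) presheaf" and t :: "'l \<Rightarrow> 'v"
    and W0 :: "'x \<Rightarrow> 'w set" and W1 :: "'y \<Rightarrow> 'w \<Rightarrow> 'w"
  assumes G: "is_functor K A G" and \<Phi>: "is_presheaf \<kappa> A \<Phi>" and t: "presented_by K A G \<Phi> t"
    and W_in: "\<lbrakk>a \<in> hom A R S; y \<in> W0 R\<rbrakk> \<Longrightarrow> W1 a y \<in> W0 S"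
    and W_Ide: "\<lbrakk>R \<in> Obj A; y \<in> W0 R\<rbrakk> \<Longrightarrow> W1 (Ide A R) y = y"
    and W_Comp: "\<lbrakk>a \<in> hom A R S; b \<in> hom A S T; y \<in> W0 R\<rbrakk> \<Longrightarrow> W1 (Comp A b a) y = W1 b (W1 a y)"
begin

abbreviation "T0 \<equiv> \<lambda>R S. POb \<Phi> R \<times> W0 S"
abbreviation "T1 \<equiv> \<lambda>f g (s, y). (PAr \<Phi> f s, W1 g y)"
abbreviation "E \<equiv> SIGMA R:Obj A. T0 R R"
abbreviation "r \<equiv> coend_gen A T0 T1"
abbreviation "GW0 \<equiv> \<lambda>k. W0 (FOb G k)"
abbreviation "GW1 \<equiv> \<lambda>w. W1 (FAr G w)"

text \<open>In the definition of the coend the variable that is held fixed is acted on by an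
  identity; here these identities are removed.\<close>

lemma coend_genI:
  assumes a: "a \<in> hom A R S" and s: "s \<in> POb \<Phi> S" and y: "y \<in> W0 R"
  shows "((R, PAr \<Phi> a s, y), (S, s, W1 a y)) \<in> r"
proof -
  have RS: "R \<in> Obj A" "S \<in> Obj A" using A.hom_Obj[OF a] by auto
  have "((R, T1 a (Ide A R) (s, y)), (S, T1 (Ide A S) a (s, y))) \<in> r"
    unfolding coend_gen_def using homD[OF a] s y by force
  then show ?thesis using W_Ide[OF RS(1) y] presheaf_Ide[OF \<Phi> RS(2) s] by simp
qed

lemma coend_genE:
  assumes "(c, c') \<in> r"
  obtains a R S s y where "a \<in> hom A R S" "s \<in> POb \<Phi> S" "y \<in> W0 R" "c = (R, PAr \<Phi> a s, y)" "c' = (S, s, W1 a y)"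
proof -
  obtain a s y where *: "a \<in> Arr A" "s \<in> POb \<Phi> (Cod A a)" "y \<in> W0 (Dom A a)"
    "c = (Dom A a, PAr \<Phi> a s, W1 (Ide A (Dom A a)) y)" "c' = (Cod A a, PAr \<Phi> (Ide A (Cod A a)) s, W1 a y)"
    using assms unfolding coend_gen_def by auto
  show ?thesis
    by (rule that[OF homI[OF *(1)] *(2,3)])
      (use * W_Ide[OF A.Dom_in[OF *(1)] *(3)] presheaf_Ide[OF \<Phi> A.Cod_in[OF *(1)] *(2)] in simp_all)
qed

lemma coend_gen_subset: "r \<subseteq> E \<times> E"
proof (rule subrelI)
  fix c c' assume "(c, c') \<in> r"
  then obtain a R S s y where "a \<in> hom A R S" "s \<in> POb \<Phi> S" "y \<in> W0 R" "c = (R, PAr \<Phi> a s, y)" "c' = (S, s, W1 a y)"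
    by (rule coend_genE)
  then show "(c, c') \<in> E \<times> E" using A.hom_Obj presheaf_act[OF \<Phi>] W_in by auto
qed

text \<open>The co-Yoneda move. Every element of \<open>POb \<Phi> R\<close> is some
  \<open>PAr \<Phi> a (t k)\<close>, so every point of the coend can be brought over an object
  \<open>G k\<close> with a generator as its first component.\<close>

lemma slide:
  assumes f: "presents E r f B" and k: "k \<in> Obj K" and a: "a \<in> hom A R (FOb G k)" and y: "y \<in> W0 R"
  shows "f (R, PAr \<Phi> a (t k), y) = f (FOb G k, t k, W1 a y)"
proof -
  have "((R, PAr \<Phi> a (t k), y), (FOb G k, t k, W1 a y)) \<in> r" by (rule coend_genI[OF a presented_by_in[OF t k] y])
  then show ?thesis using presents_generator[OF f] coend_gen_subset by blast
qed

lemma W_set_diagram: "set_diagram K GW0 GW1"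
  unfolding set_diagram_def using K.Dom_in K.Cod_in W_in[OF functor_hom[OF G homI]] by blast

text \<open>Sliding gives surjectivity from the colimit. For injectivity a test on the small
  category \<open>K\<close> has to be extended to an invariant of the coend over all of
  \<open>A\<close>.\<close>

lemma coend_set_colimit:
  assumes f: "presents E r f B"
  shows "set_colimit K GW0 GW1 (\<lambda>k y. f (FOb G k, t k, y)) B"
proof (rule set_colimitI[OF W_set_diagram])
  have Gk: "FOb G k \<in> Obj A" if "k \<in> Obj K" for k using functor_Obj[OF G that] .
  show "set_cocone K GW0 GW1 (\<lambda>k y. f (FOb G k, t k, y))"
  proof (rule set_coconeI)
    fix w y assume w: "w \<in> Arr K" and y: "y \<in> W0 (FOb G (Dom K w))"
    show "f (FOb G (Cod K w), t (Cod K w), W1 (FAr G w) y) = f (FOb G (Dom K w), t (Dom K w), y)"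
      using slide[OF f K.Cod_in[OF w] functor_hom[OF G homI[OF w]] y]
        presented_by_eq[OF A.category_axioms K.category_axioms G \<Phi> t homI[OF w]] by simp
  qed
  show "f (FOb G k, t k, y) \<in> B" if "k \<in> Obj K" "y \<in> W0 (FOb G k)" for k y
    by (rule presents_in[OF f]) (use that Gk presented_by_in[OF t] in simp)
  show "\<exists>k\<in>Obj K. \<exists>y\<in>W0 (FOb G k). b = f (FOb G k, t k, y)" if b: "b \<in> B" for b
  proof -
    obtain R s y where R: "R \<in> Obj A" "s \<in> POb \<Phi> R" "y \<in> W0 R" "b = f (R, s, y)" using presents_ex[OF f b] by auto
    obtain k a where k: "k \<in> Obj K" "a \<in> hom A R (FOb G k)" "s = PAr \<Phi> a (t k)" by (rule presented_by_ex[OF t R(1,2)])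
    show ?thesis using slide[OF f k(1,2) R(3)] R(4) k W_in[OF k(2) R(3)] by auto
  qed
  fix \<phi> :: "'l \<Rightarrow> 'w \<Rightarrow> bool" and k y k' y'
  assume \<phi>: "set_cocone K GW0 GW1 \<phi>"
    and k: "k \<in> Obj K" "y \<in> W0 (FOb G k)" "k' \<in> Obj K" "y' \<in> W0 (FOb G k')"
    and eq: "f (FOb G k, t k, y) = f (FOb G k', t k', y')"
  \<comment> \<open>With \<open>y\<close> fixed, the value \<open>\<phi> k (W1 a y)\<close> is
    compatible in \<open>k\<close> and \<open>a\<close>, so it descends to a function of the element
    \<open>PAr \<Phi> a (t k)\<close>. Letting \<open>y\<close> vary again gives a function on
    triples \<open>(R, s, y)\<close> that is invariant under the coend relation and restricts to
    \<phi> over the generators.\<close>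
  have lift: "\<exists>g. \<forall>k\<in>Obj K. \<forall>a\<in>hom A R (FOb G k). g (PAr \<Phi> a (t k)) = \<phi> k (W1 a y)"
    if R: "R \<in> Obj A" and y: "y \<in> W0 R" for R y
  proof (rule presented_by_lift[OF t R])
    fix w k k' a assume w: "w \<in> hom K k k'" and a: "a \<in> hom A R (FOb G k)"
    show "\<phi> k' (W1 (Comp A (FAr G w) a) y) = \<phi> k (W1 a y)"
      using W_Comp[OF a functor_hom[OF G w] y] set_coconeD[OF \<phi>, of w "W1 a y"] homD[OF w] W_in[OF a y] by simp
  qed
  define g where "g R y = (SOME g. \<forall>k\<in>Obj K. \<forall>a\<in>hom A R (FOb G k). g (PAr \<Phi> a (t k)) = \<phi> k (W1 a y))" for R y
  have g: "g R y (PAr \<Phi> a (t k)) = \<phi> k (W1 a y)"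
    if "R \<in> Obj A" "y \<in> W0 R" "k \<in> Obj K" "a \<in> hom A R (FOb G k)" for R y k a
    using someI_ex[OF lift[OF that(1,2)]] that(3,4) unfolding g_def by blast
  have "invariant r (\<lambda>(R, s, y). g R y s)"
    unfolding invariant_def
  proof (intro ballI, clarify)
    fix R0 s0 y0 S0 u0 z0 assume "((R0, s0, y0), (S0, u0, z0)) \<in> r"
    then obtain b R S s y where b: "b \<in> hom A R S" "s \<in> POb \<Phi> S" "y \<in> W0 R"
      "(R0, s0, y0) = (R, PAr \<Phi> b s, y)" "(S0, u0, z0) = (S, s, W1 b y)"
      by (rule coend_genE)
    have RS: "R \<in> Obj A" "S \<in> Obj A" using A.hom_Obj[OF b(1)] by auto
    obtain k a where k: "k \<in> Obj K" "a \<in> hom A S (FOb G k)" "s = PAr \<Phi> a (t k)" by (rule presented_by_ex[OF t RS(2) b(2)])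
    have "PAr \<Phi> b s = PAr \<Phi> (Comp A a b) (t k)" using presheaf_Comp[OF \<Phi> b(1) k(2) presented_by_in[OF t k(1)]] k(3) by simp
    then show "g R0 y0 s0 = g S0 z0 u0"
      using g[OF RS(1) b(3) k(1) A.Comp_in[OF b(1) k(2)]] g[OF RS(2) W_in[OF b(1,3)] k(1,2)] W_Comp[OF b(1) k(2) b(3)] k(3) b(4,5)
      by simp
  qed
  moreover have "(FOb G k, t k, y) \<in> E" "(FOb G k', t k', y') \<in> E" using k Gk presented_by_in[OF t] by auto
  ultimately have "g (FOb G k) y (t k) = g (FOb G k') y' (t k')"
    using presents_factor[OF f _ _ _ eq, of "\<lambda>(R, s, y). g R y s"] by simp
  moreover have "g (FOb G k) y (t k) = \<phi> k y" if "k \<in> Obj K" "y \<in> W0 (FOb G k)" for k y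
    using g[OF Gk[OF that(1)] that(2,1) A.Ide_in[OF Gk[OF that(1)]]]
      presheaf_Ide[OF \<Phi> Gk[OF that(1)] presented_by_in[OF t that(1)]] W_Ide[OF Gk[OF that(1)] that(2)] by simp
  ultimately show "\<phi> k y = \<phi> k' y'" using k by simp
qed

text \<open>The classes of the coend already form a colimit by \<open>coend_set_colimit\<close>, and
  any two colimits of the same diagram are in bijection.\<close>

lemma set_colimit_coend:
  assumes q: "set_colimit K GW0 GW1 q B"
  shows "\<exists>f. presents E r f B \<and> (\<forall>k\<in>Obj K. \<forall>y\<in>W0 (FOb G k). f (FOb G k, t k, y) = q k y)"
proof -
  let ?cl = "\<lambda>c. equiv_gen E r `` {c}"
  have "set_colimit K GW0 GW1 (\<lambda>k y. ?cl (FOb G k, t k, y)) (E // equiv_gen E r)"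
    by (rule coend_set_colimit[OF presents_quotient])
  from presents_bij_ex[OF this[unfolded set_colimit_def] q[unfolded set_colimit_def]]
  obtain g where g: "bij_betw g (E // equiv_gen E r) B"
    "\<forall>p\<in>(SIGMA k:Obj K. W0 (FOb G k)). g (case p of (k, y) \<Rightarrow> ?cl (FOb G k, t k, y)) = (case p of (k, y) \<Rightarrow> q k y)"
    by blast
  have "g (?cl (FOb G k, t k, y)) = q k y" if "k \<in> Obj K" "y \<in> W0 (FOb G k)" for k y
    using bspec[OF g(2), of "(k, y)"] that by simp
  then show ?thesis using presents_comp_bij[OF presents_quotient g(1)] by blast
qed

end

text \<open>The covariant functor now depends contravariantly on an object \<open>X\<close> of
  \<open>C\<close> through \<rho>. This covers \<open>mu\<close>, with \<open>R(X)\<close>, and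
  \<open>push\<close>, with \<open>hom(X, F R)\<close>.\<close>

locale presented_tensor_family = A: category A + K: category K + C: category C
  for A :: "('x, 'y) cat" and K :: "('l, 'n) cat" and C :: "('o, 'a) cat" +
  fixes \<kappa> :: "'k rel" and G :: "('l, 'n, 'x, 'y) func" and \<Phi> :: "('x, 'y, 'v) presheaf" and t :: "'l \<Rightarrow> 'v"
    and W0 :: "'o \<Rightarrow> 'x \<Rightarrow> 'w set" and W1 :: "'o \<Rightarrow> 'y \<Rightarrow> 'w \<Rightarrow> 'w" and \<rho> :: "'a \<Rightarrow> 'x \<Rightarrow> 'w \<Rightarrow> 'w"
  assumes G: "is_functor K A G" and \<Phi>: "is_presheaf \<kappa> A \<Phi>" and t: "presented_by K A G \<Phi> t"
    and W_in: "\<lbrakk>X \<in> Obj C; a \<in> hom A R S; y \<in> W0 X R\<rbrakk> \<Longrightarrow> W1 X a y \<in> W0 X S"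
    and W_Ide: "\<lbrakk>X \<in> Obj C; R \<in> Obj A; y \<in> W0 X R\<rbrakk> \<Longrightarrow> W1 X (Ide A R) y = y"
    and W_Comp: "\<lbrakk>X \<in> Obj C; a \<in> hom A R S; b \<in> hom A S T; y \<in> W0 X R\<rbrakk> \<Longrightarrow> W1 X (Comp A b a) y = W1 X b (W1 X a y)"
    and \<rho>_in: "\<lbrakk>h \<in> hom C X Y; R \<in> Obj A; y \<in> W0 Y R\<rbrakk> \<Longrightarrow> \<rho> h R y \<in> W0 X R"
    and \<rho>_nat: "\<lbrakk>h \<in> hom C X Y; a \<in> hom A R S; y \<in> W0 Y R\<rbrakk> \<Longrightarrow> \<rho> h S (W1 Y a y) = W1 X a (\<rho> h R y)"
begin

abbreviation "E X \<equiv> SIGMA R:Obj A. POb \<Phi> R \<times> W0 X R"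
abbreviation "r X \<equiv> coend_gen A (\<lambda>R S. POb \<Phi> R \<times> W0 X S) (\<lambda>f g (s, y). (PAr \<Phi> f s, W1 X g y))"

lemma tensor: "X \<in> Obj C \<Longrightarrow> presented_tensor A K \<kappa> G \<Phi> t (W0 X) (W1 X)"
  by unfold_locales (use G \<Phi> t W_in W_Ide W_Comp in auto)

text \<open>The identification of the coend with the colimit is compatible with restriction in
  \<open>X\<close>, because \<rho> commutes with the action of arrows of \<open>A\<close>. Hence it
  may be made for whole presheaves and not only for each \<open>X\<close> separately.\<close>

lemma coend_presheaf_iso_iff:
  "presheaf_iso C (quotient_presheaf C E r (\<lambda>h (R, s, y). (R, s, \<rho> h R y))) P \<longleftrightarrow>
    (\<exists>q. (\<forall>X\<in>Obj C. set_colimit K (\<lambda>k. W0 X (FOb G k)) (\<lambda>w. W1 X (FAr G w)) (q X) (POb P X)) \<and>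
         (\<forall>h\<in>Arr C. \<forall>k\<in>Obj K. \<forall>y\<in>W0 (Cod C h) (FOb G k).
            q (Dom C h) k (\<rho> h (FOb G k) y) = PAr P h (q (Cod C h) k y)))"
  (is "?L \<longleftrightarrow> ?R")
proof -
  have "quotient_data C E r (\<lambda>h (R, s, y). (R, s, \<rho> h R y))"
  proof
    show "r X \<subseteq> E X \<times> E X" if "X \<in> Obj C" for X by (rule presented_tensor.coend_gen_subset[OF tensor[OF that]])
    fix h assume h: "h \<in> Arr C"
    show "(case c of (R, s, y) \<Rightarrow> (R, s, \<rho> h R y)) \<in> E (Dom C h)" if "c \<in> E (Cod C h)" for c
      using that \<rho>_in[OF homI[OF h]] by auto
    fix c c' assume "(c, c') \<in> r (Cod C h)"
    then obtain a R S s y where *: "a \<in> hom A R S" "s \<in> POb \<Phi> S" "y \<in> W0 (Cod C h) R"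
      "c = (R, PAr \<Phi> a s, y)" "c' = (S, s, W1 (Cod C h) a y)"
      by (rule presented_tensor.coend_genE[OF tensor[OF C.Cod_in[OF h]]])
    have "R \<in> Obj A" using A.hom_Obj[OF *(1)] by simp
    from presented_tensor.coend_genI[OF tensor[OF C.Dom_in[OF h]] *(1,2) \<rho>_in[OF homI[OF h] this *(3)]]
    show "(case c of (R, s, y) \<Rightarrow> (R, s, \<rho> h R y), case c' of (R, s, y) \<Rightarrow> (R, s, \<rho> h R y)) \<in> r (Dom C h)"
      using \<rho>_nat[OF homI[OF h] *(1,3)] *(4,5) by simp
  qed
  note iff = quotient_data.quotient_presheaf_iso_iff[OF this]
  have Gk: "FOb G k \<in> Obj A" if "k \<in> Obj K" for k using functor_Obj[OF G that] .
  show ?thesis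
  proof
    assume ?L
    then obtain f where f: "\<And>X. X \<in> Obj C \<Longrightarrow> presents (E X) (r X) (f X) (POb P X)"
      and nat: "\<And>h c. h \<in> Arr C \<Longrightarrow> c \<in> E (Cod C h) \<Longrightarrow>
        f (Dom C h) (case c of (R, s, y) \<Rightarrow> (R, s, \<rho> h R y)) = PAr P h (f (Cod C h) c)"
      unfolding iff by blast
    show ?R
    proof (intro exI conjI ballI)
      show "set_colimit K (\<lambda>k. W0 X (FOb G k)) (\<lambda>w. W1 X (FAr G w)) (\<lambda>k y. f X (FOb G k, t k, y)) (POb P X)"
        if X: "X \<in> Obj C" for X by (rule presented_tensor.coend_set_colimit[OF tensor[OF X] f[OF X]])
      show "f (Dom C h) (FOb G k, t k, \<rho> h (FOb G k) y) = PAr P h (f (Cod C h) (FOb G k, t k, y))"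
        if "h \<in> Arr C" "k \<in> Obj K" "y \<in> W0 (Cod C h) (FOb G k)" for h k y
        using nat[OF that(1), of "(FOb G k, t k, y)"] that Gk presented_by_in[OF t] by simp
    qed
  next
    assume ?R
    then obtain q where q: "\<And>X. X \<in> Obj C \<Longrightarrow> set_colimit K (\<lambda>k. W0 X (FOb G k)) (\<lambda>w. W1 X (FAr G w)) (q X) (POb P X)"
      and nat: "\<And>h k y. h \<in> Arr C \<Longrightarrow> k \<in> Obj K \<Longrightarrow> y \<in> W0 (Cod C h) (FOb G k) \<Longrightarrow>
            q (Dom C h) k (\<rho> h (FOb G k) y) = PAr P h (q (Cod C h) k y)" by blast
    have "\<forall>X\<in>Obj C. \<exists>f. presents (E X) (r X) f (POb P X) \<and> (\<forall>k\<in>Obj K. \<forall>y\<in>W0 X (FOb G k). f (FOb G k, t k, y) = q X k y)"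
      using presented_tensor.set_colimit_coend[OF tensor q] by simp
    from bchoice[OF this] obtain f where f: "\<forall>X\<in>Obj C. presents (E X) (r X) (f X) (POb P X) \<and>
      (\<forall>k\<in>Obj K. \<forall>y\<in>W0 X (FOb G k). f X (FOb G k, t k, y) = q X k y)" ..
    show ?L unfolding iff
    proof (intro exI[of _ f] conjI ballI)
      show "presents (E X) (r X) (f X) (POb P X)" if "X \<in> Obj C" for X using f that by blast
      fix h c assume h: "h \<in> Arr C" and "c \<in> E (Cod C h)"
      then obtain R s y where R: "R \<in> Obj A" "s \<in> POb \<Phi> R" "y \<in> W0 (Cod C h) R" "c = (R, s, y)" by auto
      obtain k a where k: "k \<in> Obj K" "a \<in> hom A R (FOb G k)" "s = PAr \<Phi> a (t k)" by (rule presented_by_ex[OF t R(1,2)])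
      have X: "Dom C h \<in> Obj C" "Cod C h \<in> Obj C" using C.Dom_in C.Cod_in h by auto
      \<comment> \<open>After sliding onto a generator, \<open>f\<close> is expressed by
        \<open>q\<close>; naturality of \<open>f\<close> thus reduces to that of
        \<open>q\<close>.\<close>
      have val: "f X (R, s, y) = q X k (W1 X a y)" if "X \<in> Obj C" "y \<in> W0 X R" for X y
        using presented_tensor.slide[OF tensor[OF that(1)] f[rule_format, OF that(1), THEN conjunct1] k(1,2) that(2)] k(1,3)
          f that W_in[OF that(1) k(2) that(2)] by simp
      have hy: "\<rho> h R y \<in> W0 (Dom C h) R" by (rule \<rho>_in[OF homI[OF h] R(1,3)])
      have "f (Dom C h) (R, s, \<rho> h R y) = q (Dom C h) k (\<rho> h (FOb G k) (W1 (Cod C h) a y))"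
        using val[OF X(1) hy] \<rho>_nat[OF homI[OF h] k(2) R(3)] by simp
      also have "\<dots> = PAr P h (f (Cod C h) (R, s, y))"
        using nat[OF h k(1) W_in[OF X(2) k(2) R(3)]] val[OF X(2) R(3)] by simp
      finally show "f (Dom C h) (case c of (R, s, y) \<Rightarrow> (R, s, \<rho> h R y)) = PAr P h (f (Cod C h) c)" using R(4) by simp
    qed
  qed
qed

end

text \<open>The instance in which the covariant functor is evaluation at \<open>X\<close>: the
  multiplication of the monad sends a presheaf presented by \<open>G\<close> to the colimit of
  \<open>G\<close>.\<close>

lemma mu_iso_iff:
  fixes C :: "('o, 'a) cat" and \<kappa> :: "'k rel"
  assumes C: "category C" and K: "category K" and G: "is_functor K (PSh \<kappa> C) G"
    and \<Phi>: "is_presheaf \<kappa> (PSh \<kappa> C) \<Phi>" and t: "presented_by K (PSh \<kappa> C) G \<Phi> t"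
  shows "presheaf_iso C (mu \<kappa> C \<Phi>) P \<longleftrightarrow> (\<exists>q. psh_colimit K C G q P)"
proof -
  interpret A: category "PSh \<kappa> C" by (rule category_PSh[OF C])
  interpret K: category K by fact
  interpret C: category C by fact
  interpret presented_tensor_family "PSh \<kappa> C" K C \<kappa> G \<Phi> t "\<lambda>X R. POb R X" "\<lambda>X a. psh_map a X" "\<lambda>h R. PAr R h"
  proof
    show "PAr R h y \<in> POb R X" if "h \<in> hom C X Y" "R \<in> Obj (PSh \<kappa> C)" "y \<in> POb R Y" for h X Y R y
      using that presheaf_act[OF small_presheaf_is_presheaf] by (simp add: PSh_Obj)
    show "PAr S h (psh_map a Y y) = psh_map a X (PAr R h y)"
      if "h \<in> hom C X Y" "a \<in> hom (PSh \<kappa> C) R S" "y \<in> POb R Y" for h X Y a R S y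
      using PSh_hom_nat[OF that(2,1,3)] by simp
  qed (use G \<Phi> t PSh_hom_map PSh_Ide_map PSh_Comp(2)[OF C] in auto)
  have "mu \<kappa> C \<Phi> = quotient_presheaf C E r (\<lambda>h (R, s, y). (R, s, PAr R h y))"
    unfolding mu_def quotient_presheaf_def set_coend_def coend_rel_def coend_gen_def mu0_def mu1_def ..
  then show ?thesis using coend_presheaf_iso_iff unfolding psh_colimit_def by simp
qed

text \<open>The instance in which the covariant functor is \<open>hom(X, F -)\<close>. The resulting
  colimit is the one that defines the image presheaf of \<open>fcomp F G\<close>, so pushing forward
  along \<open>F\<close> corresponds to composing diagrams with \<open>F\<close>.\<close>

lemma push_iso_iff:
  fixes A :: "('x, 'y) cat" and C :: "('o, 'a) cat" and \<kappa> :: "'k rel"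
  assumes A: "category A" and C: "category C" and K: "category K" and G: "is_functor K A G" and F: "is_functor A C F"
    and \<Phi>: "is_presheaf \<kappa> A \<Phi>" and t: "presented_by K A G \<Phi> t"
  shows "presheaf_iso C (push A C F \<Phi>) P \<longleftrightarrow> presheaf_iso C (image_presheaf K C (fcomp F G)) P"
proof -
  interpret A: category A by fact
  interpret K: category K by fact
  interpret C: category C by fact
  interpret presented_tensor_family A K C \<kappa> G \<Phi> t "\<lambda>X R. hom C X (FOb F R)" "\<lambda>X a. Comp C (FAr F a)" "\<lambda>h R k. Comp C k h"
  proof
    show "Comp C (FAr F a) y \<in> hom C X (FOb F S)" if "X \<in> Obj C" "a \<in> hom A R S" "y \<in> hom C X (FOb F R)" for X a R S y
      using C.Comp_in[OF that(3) functor_hom[OF F that(2)]] .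
    show "Comp C (FAr F (Ide A R)) y = y" if "X \<in> Obj C" "R \<in> Obj A" "y \<in> hom C X (FOb F R)" for X R y
      using C.Ide_Comp[OF that(3)] functor_Ide[OF F that(2)] by simp
    show "Comp C (FAr F (Comp A b a)) y = Comp C (FAr F b) (Comp C (FAr F a) y)"
      if "X \<in> Obj C" "a \<in> hom A R S" "b \<in> hom A S T" "y \<in> hom C X (FOb F R)" for X a R S b T y
      using C.Comp_assoc[OF that(4) functor_hom[OF F that(2)] functor_hom[OF F that(3)]] functor_Comp[OF F that(2,3)] by simp
    show "Comp C y h \<in> hom C X (FOb F R)" if "h \<in> hom C X Y" "R \<in> Obj A" "y \<in> hom C Y (FOb F R)" for h X Y R y
      using C.Comp_in[OF that(1,3)] .
    show "Comp C (Comp C (FAr F a) y) h = Comp C (FAr F a) (Comp C y h)"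
      if "h \<in> hom C X Y" "a \<in> hom A R S" "y \<in> hom C Y (FOb F R)" for h X Y a R S y
      using C.Comp_assoc[OF that(1,3) functor_hom[OF F that(2)]] by simp
  qed (use G \<Phi> t in auto)
  have "push A C F \<Phi> = quotient_presheaf C E r (\<lambda>h (R, s, y). (R, s, Comp C y h))"
    unfolding push_def quotient_presheaf_def set_coend_def coend_rel_def coend_gen_def push0_def push1_def ..
  then have "presheaf_iso C (push A C F \<Phi>) P \<longleftrightarrow>
    (\<exists>q. (\<forall>X\<in>Obj C. set_colimit K (\<lambda>k. hom C X (FOb F (FOb G k))) (\<lambda>w. Comp C (FAr F (FAr G w))) (q X) (POb P X)) \<and>
         (\<forall>h\<in>Arr C. \<forall>k\<in>Obj K. \<forall>y\<in>hom C (Cod C h) (FOb F (FOb G k)).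
            q (Dom C h) k (Comp C y h) = PAr P h (q (Cod C h) k y)))"
    using coend_presheaf_iso_iff by simp
  \<comment> \<open>Only currying: the same colimit cocone is read as a map on pairs, as the
    description of the image presheaf requires.\<close>
  also have "\<dots> \<longleftrightarrow> (\<exists>f. (\<forall>X\<in>Obj C. presents (SIGMA k:Obj K. hom C X (FOb (fcomp F G) k)) (image_gen K C (fcomp F G) X) (f X) (POb P X)) \<and>
         (\<forall>h\<in>Arr C. \<forall>c\<in>(SIGMA k:Obj K. hom C (Cod C h) (FOb (fcomp F G) k)).
            f (Dom C h) (case c of (k, y) \<Rightarrow> (k, Comp C y h)) = PAr P h (f (Cod C h) c)))"
    (is "(\<exists>q. ?Q q) \<longleftrightarrow> (\<exists>f. ?F f)")
  proof
    assume "\<exists>q. ?Q q"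
    then obtain q where "?Q q" ..
    then have "?F (\<lambda>X (k, y). q X k y)" unfolding set_colimit_def by auto
    then show "\<exists>f. ?F f" by (rule exI[of _ "\<lambda>X (k, y). q X k y"])
  next
    assume "\<exists>f. ?F f"
    then obtain f where "?F f" ..
    then have "?Q (\<lambda>X k y. f X (k, y))" unfolding set_colimit_def by auto
    then show "\<exists>q. ?Q q" by (rule exI[of _ "\<lambda>X k y. f X (k, y)"])
  qed
  also have "\<dots> \<longleftrightarrow> presheaf_iso C (image_presheaf K C (fcomp F G)) P"
    by (rule quotient_data.quotient_presheaf_iso_iff[OF quotient_data_image[OF C K functor_fcomp[OF G F]],
          folded image_presheaf_eq, symmetric])
  finally show ?thesis .
qed

section \<open>Existence of pointwise Kan extensions\<close>

lemma presented_by_cong: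
  assumes "\<And>j. j \<in> Obj J \<Longrightarrow> x j = y j"
  shows "presented_by J C D P x \<longleftrightarrow> presented_by J C D P y"
proof -
  have "set_colimit J (\<lambda>j. hom C X (FOb D j)) (\<lambda>u. Comp C (FAr D u)) (\<lambda>j f. PAr P f (x j)) B \<longleftrightarrow>
      set_colimit J (\<lambda>j. hom C X (FOb D j)) (\<lambda>u. Comp C (FAr D u)) (\<lambda>j f. PAr P f (y j)) B" for X B
    unfolding set_colimit_def by (rule presents_cong) (auto simp: assms)
  then show ?thesis unfolding presented_by_def using assms by simp
qed

text \<open>Each \<open>G k\<close> is a chosen presheaf presented over the comma category at
  \<open>k\<close>, and an arrow \<open>w\<close> acts by postcomposition on the index
  \<open>u\<close>. All laws are checked on generators. Smallness is asked of the comma categories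
  because they index these colimits.\<close>

lemma presheaf_kan_ext_exists:
  fixes \<kappa> :: "'k rel" and C :: "('o, 'a) cat" and J :: "('j, 'i) cat" and K :: "('l, 'n) cat"
  assumes U: "universe_card \<kappa>" and C: "category C" "locally_small \<kappa> C"
    and J: "category J" and K: "category K" and F: "is_functor J K F" and D: "is_functor J C D"
    and sm: "\<And>k. small \<kappa> (Obj (comma J K F k))" "\<And>k. small \<kappa> (Arr (comma J K F k))"
  shows "\<exists>G x. presheaf_kan_ext J K C \<kappa> F D G x"
proof -
  interpret J: category J by fact
  interpret K: category K by fact
  interpret C: category C by fact
  let ?A = "PSh \<kappa> C"
  let ?D = "comma_diagram D"
  note catm = category_comma[OF J K F] and dgm = functor_comma_diagram[OF D]
  have "\<exists>p :: ('o, 'a, 'k) presheaf \<times> ('j \<times> 'n \<Rightarrow> 'k). small_presheaf \<kappa> C (fst p) \<and> presented_by (comma J K F k) C ?D (fst p) (snd p)" for k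
  proof -
    obtain P :: "('o, 'a, 'k) presheaf" and x where "small_presheaf \<kappa> C P" "presented_by (comma J K F k) C ?D P x"
      by (rule image_presheaf_exists[OF U C catm[of k] sm dgm])
    then show ?thesis by (intro exI[of _ "(P, x)"]) simp
  qed
  then obtain p :: "'l \<Rightarrow> ('o, 'a, 'k) presheaf \<times> ('j \<times> 'n \<Rightarrow> 'k)" where p: "\<And>k. small_presheaf \<kappa> C (fst (p k)) \<and>
      presented_by (comma J K F k) C ?D (fst (p k)) (snd (p k))" by metis
  define P where "P k = fst (p k)" for k
  define z where "z k j u = snd (p k) (j, u)" for k j u
  have smP: "small_presheaf \<kappa> C (P k)" and z: "presented_by (comma J K F k) C ?D (P k) (\<lambda>(j, u). z k j u)" for k
    using p by (simp_all add: P_def z_def)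
  have P: "is_presheaf \<kappa> C (P k)" for k using small_presheaf_is_presheaf[OF smP] .
  have z_in: "z k j u \<in> POb (P k) (FOb D j)" if "j \<in> Obj J" "u \<in> hom K (FOb F j) k" for k j u
    using presented_by_in[OF z, of "(j, u)" k] that by simp
  have z_nat: "PAr (P k) (FAr D v) (z k j' u) = z k j (Comp K u (FAr F v))"
    if "v \<in> hom J j j'" "u \<in> hom K (FOb F j') k" for k v j j' u
  proof -
    have "(v, u) \<in> hom (comma J K F k) (j, Comp K u (FAr F v)) (j', u)" using that by (simp add: comma_hom)
    from presented_by_eq[OF C(1) catm dgm P z this] show ?thesis by simp
  qed
  have z_ex: "\<exists>j u f. j \<in> Obj J \<and> u \<in> hom K (FOb F j) k \<and> f \<in> hom C X (FOb D j) \<and> y = PAr (P k) f (z k j u)"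
    if Xy: "X \<in> Obj C" "y \<in> POb (P k) X" for k X y
  proof -
    obtain a f where a: "a \<in> Obj (comma J K F k)" "f \<in> hom C X (FOb ?D a)" "y = PAr (P k) f (case a of (j, u) \<Rightarrow> z k j u)"
      by (rule presented_by_ex[OF z Xy])
    then show ?thesis by (cases a) auto
  qed
  \<comment> \<open>What the component at \<open>X\<close> of the action of \<open>w\<close> must do
    on generators. Postcomposing with \<open>w\<close> respects the relations between generators, so
    the presentation of \<open>P k\<close> provides such a map.\<close>
  define is_map where "is_map w k k' X m \<longleftrightarrow> (\<forall>j u f. j \<in> Obj J \<longrightarrow> u \<in> hom K (FOb F j) k \<longrightarrow> f \<in> hom C X (FOb D j) \<longrightarrow>
    m (PAr (P k) f (z k j u)) = PAr (P k') f (z k' j (Comp K w u)))" for w k k' X and m :: "'k \<Rightarrow> 'k"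
  have map_ex: "\<exists>m. is_map w k k' X m" if w: "w \<in> hom K k k'" and X: "X \<in> Obj C" for w k k' X
  proof -
    define \<psi> where "\<psi> a f = PAr (P k') f (z k' (fst a) (Comp K w (snd a)))" for a f
    have "\<exists>m. \<forall>a\<in>Obj (comma J K F k). \<forall>f\<in>hom C X (FOb ?D a). m (PAr (P k) f (case a of (j, u) \<Rightarrow> z k j u)) = \<psi> a f"
    proof (rule presented_by_lift[OF z X])
      fix b a a' f assume b: "b \<in> hom (comma J K F k) a a'" and f: "f \<in> hom C X (FOb ?D a)"
      obtain v u' j u j' u'' where *: "b = (v, u')" "a = (j, u)" "a' = (j', u'')" by (cases b; cases a; cases a')
      have v: "v \<in> hom J j j'" "u'' \<in> hom K (FOb F j') k" "u = Comp K u'' (FAr F v)" "f \<in> hom C X (FOb D j)"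
        using b f unfolding * by (auto simp: comma_hom)
      have wu: "Comp K w u'' \<in> hom K (FOb F j') k'" using K.Comp_in[OF v(2) w] .
      show "\<psi> a' (Comp C (FAr ?D b) f) = \<psi> a f"
        using presheaf_Comp[OF P v(4) functor_hom[OF D v(1)] z_in[OF _ wu]] J.hom_Obj[OF v(1)] z_nat[OF v(1) wu]
          K.Comp_assoc[OF functor_hom[OF F v(1)] v(2) w] v(3) by (simp add: \<psi>_def *)
    qed
    then obtain m where m: "\<forall>a\<in>Obj (comma J K F k). \<forall>f\<in>hom C X (FOb ?D a).
        m (PAr (P k) f (case a of (j, u) \<Rightarrow> z k j u)) = \<psi> a f" ..
    have "m (PAr (P k) f (z k j u)) = PAr (P k') f (z k' j (Comp K w u))"
      if "j \<in> Obj J" "u \<in> hom K (FOb F j) k" "f \<in> hom C X (FOb D j)" for j u f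
      using bspec[OF bspec[OF m, of "(j, u)"], of f] that by (simp add: \<psi>_def)
    then show ?thesis unfolding is_map_def by (intro exI[of _ m] allI impI)
  qed
  define m where "m w X = (SOME m. is_map w (Dom K w) (Cod K w) X m)" for w X
  have m: "m w X (PAr (P k) f (z k j u)) = PAr (P k') f (z k' j (Comp K w u))"
    if w: "w \<in> hom K k k'" and j: "j \<in> Obj J" "u \<in> hom K (FOb F j) k" "f \<in> hom C X (FOb D j)" for w k k' X j u f
  proof -
    have X: "X \<in> Obj C" using C.hom_Obj[OF j(3)] by simp
    have "is_map w k k' X (m w X)" using someI_ex[OF map_ex[OF w X]] homD[OF w] unfolding m_def by simp
    then show ?thesis using j unfolding is_map_def by blast
  qed
  define G where "G = \<lparr>FOb = P, FAr = \<lambda>w. (P (Dom K w), P (Cod K w), \<lambda>X\<in>Obj C. \<lambda>y\<in>POb (P (Dom K w)) X. m w X y)\<rparr>"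
  \<comment> \<open>The unit of a pointwise Kan extension at \<open>j\<close> is the generator
    indexed by the identity of \<open>FOb F j\<close>.\<close>
  define x where "x j = z (FOb F j) j (Ide K (FOb F j))" for j
  have Gw: "FAr G w \<in> hom ?A (P k) (P k')" if w: "w \<in> hom K k k'" for w k k'
  proof -
    have "(P k, P k', \<lambda>X\<in>Obj C. \<lambda>y\<in>POb (P k) X. m w X y) \<in> hom ?A (P k) (P k')"
    proof (rule PSh_homI[OF C(1) smP smP])
      fix X y assume X: "X \<in> Obj C" "y \<in> POb (P k) X"
      obtain j u f where j: "j \<in> Obj J" "u \<in> hom K (FOb F j) k" "f \<in> hom C X (FOb D j)" "y = PAr (P k) f (z k j u)"
        using z_ex[OF X] by blast
      show "m w X y \<in> POb (P k') X"
        unfolding j(4) m[OF w j(1-3)] by (rule presheaf_act[OF P j(3) z_in[OF j(1) K.Comp_in[OF j(2) w]]])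
    next
      fix X Y h y assume h: "h \<in> hom C X Y" and y: "y \<in> POb (P k) Y"
      have Y: "Y \<in> Obj C" using C.hom_Obj[OF h] by simp
      obtain j u f where j: "j \<in> Obj J" "u \<in> hom K (FOb F j) k" "f \<in> hom C Y (FOb D j)" "y = PAr (P k) f (z k j u)"
        using z_ex[OF Y y] by blast
      show "m w X (PAr (P k) h y) = PAr (P k') h (m w Y y)"
        using presheaf_Comp[OF P h j(3) z_in[OF j(1,2)]] m[OF w j(1,2) C.Comp_in[OF h j(3)]] m[OF w j(1-3)] j(4)
          presheaf_Comp[OF P h j(3) z_in[OF j(1) K.Comp_in[OF j(2) w]]] by simp
    qed
    then show ?thesis using homD[OF w] by (simp add: G_def)
  qed
  have act: "psh_map (FAr G w) X (PAr (P k) f (z k j u)) = PAr (P k') f (z k' j (Comp K w u))"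
    if w: "w \<in> hom K k k'" and j: "j \<in> Obj J" "u \<in> hom K (FOb F j) k" "f \<in> hom C X (FOb D j)" for w k k' X j u f
    using m[OF w j] presheaf_act[OF P j(3) z_in[OF j(1,2)]] C.hom_Obj[OF j(3)] homD[OF w] by (simp add: G_def)
  have G: "is_functor K ?A G"
  proof (rule is_functorI)
    show "FOb G k \<in> Obj ?A" for k using smP by (simp add: G_def PSh_Obj)
    show "FAr G w \<in> hom ?A (FOb G k) (FOb G k')" if "w \<in> hom K k k'" for w k k'
      using Gw[OF that] by (simp add: G_def)
  next
    fix k assume k: "k \<in> Obj K"
    have idP: "Ide ?A (P k) \<in> hom ?A (P k) (P k)"
      by (rule category.Ide_in[OF category_PSh[OF C(1)]]) (simp add: PSh_Obj smP)
    have "FAr G (Ide K k) = Ide ?A (P k)"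
    proof (rule PSh_hom_eqI[OF Gw[OF K.Ide_in[OF k]] idP])
      fix X y assume X: "X \<in> Obj C" "y \<in> POb (P k) X"
      obtain j u f where j: "j \<in> Obj J" "u \<in> hom K (FOb F j) k" "f \<in> hom C X (FOb D j)" "y = PAr (P k) f (z k j u)"
        using z_ex[OF X] by blast
      show "psh_map (FAr G (Ide K k)) X y = psh_map (Ide ?A (P k)) X y"
        using act[OF K.Ide_in[OF k] j(1-3)] K.Ide_Comp[OF j(2)] PSh_Ide_map[OF X] j(4) by simp
    qed
    then show "FAr G (Ide K k) = Ide ?A (FOb G k)" by (simp add: G_def)
  next
    fix v w k k' k'' assume v: "v \<in> hom K k k'" and w: "w \<in> hom K k' k''"
    note c = PSh_Comp[OF C(1) Gw[OF v] Gw[OF w]]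
    show "FAr G (Comp K w v) = Comp ?A (FAr G w) (FAr G v)"
    proof (rule PSh_hom_eqI[OF Gw[OF K.Comp_in[OF v w]] c(1)])
      fix X y assume X: "X \<in> Obj C" "y \<in> POb (P k) X"
      obtain j u f where j: "j \<in> Obj J" "u \<in> hom K (FOb F j) k" "f \<in> hom C X (FOb D j)" "y = PAr (P k) f (z k j u)"
        using z_ex[OF X] by blast
      show "psh_map (FAr G (Comp K w v)) X y = psh_map (Comp ?A (FAr G w) (FAr G v)) X y"
        using act[OF K.Comp_in[OF v w] j(1-3)] c(2)[OF X] act[OF v j(1-3)] act[OF w j(1) K.Comp_in[OF j(2) v] j(3)]
          K.Comp_assoc[OF j(2) v w] j(4) by simp
    qed
  qed
  have x_in: "x j \<in> POb (FOb G (FOb F j)) (FOb D j)" if "j \<in> Obj J" for j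
    using z_in[OF that K.Ide_in[OF functor_Obj[OF F that]]] by (simp add: x_def G_def)
  have gen: "psh_map (FAr G u) (FOb D j) (x j) = z k j u" if j: "j \<in> Obj J" "u \<in> hom K (FOb F j) k" for j u k
  proof -
    note idF = K.Ide_in[OF functor_Obj[OF F j(1)]] and Dj = functor_Obj[OF D j(1)]
    \<comment> \<open>\<open>act\<close> speaks of restrictions of generators, so \<open>x j\<close>
      is written as a restriction along an identity.\<close>
    have "x j = PAr (P (FOb F j)) (Ide C (FOb D j)) (z (FOb F j) j (Ide K (FOb F j)))"
      using presheaf_Ide[OF P Dj z_in[OF j(1) idF]] by (simp add: x_def)
    then show ?thesis
      using act[OF j(2,1) idF C.Ide_in[OF Dj]] K.Comp_Ide[OF j(2)] presheaf_Ide[OF P Dj z_in[OF j]] by simp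
  qed
  have "presheaf_kan_ext J K C \<kappa> F D G x"
  proof
    fix k
    have "presented_by (comma J K F k) C ?D (P k) (\<lambda>(j, u). psh_map (FAr G u) (FOb D j) (x j)) \<longleftrightarrow>
        presented_by (comma J K F k) C ?D (P k) (\<lambda>(j, u). z k j u)"
      by (rule presented_by_cong) (use gen in auto)
    then show "presented_by (comma J K F k) C ?D (FOb G k) (\<lambda>(j, u). psh_map (FAr G u) (FOb D j) (x j))"
      using z by (simp add: G_def)
  qed (use F D G x_in in auto)
  then show ?thesis by blast
qed

section \<open>Diagrams of presheaves as Kan extensions\<close>

text \<open>
  The category of elements of \<open>G : K \<rightarrow> P C\<close>, restricted to a set \<open>S\<close> of objects of \<open>C\<close>. An arrow
  \<open>(w, f, y, y')\<close> has underlying arrows \<open>w\<close> of \<open>K\<close> and \<open>f\<close> of \<open>C\<close>.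
\<close>

definition elements ::
  "('l, 'n) cat \<Rightarrow> ('o, 'a) cat \<Rightarrow> 'o set \<Rightarrow> ('l, 'n, ('o, 'a, 'k) presheaf, ('o, 'a, 'k) psh_arr) func
    \<Rightarrow> ('l \<times> 'o \<times> 'k, 'n \<times> 'a \<times> 'k \<times> 'k) cat" where
  "elements K C S G = \<lparr>
     Obj = {(k, X, y). k \<in> Obj K \<and> X \<in> S \<and> y \<in> POb (FOb G k) X},
     Arr = {(w, f, y, y'). w \<in> Arr K \<and> f \<in> Arr C \<and> Dom C f \<in> S \<and> Cod C f \<in> S \<and>
              y \<in> POb (FOb G (Dom K w)) (Dom C f) \<and> y' \<in> POb (FOb G (Cod K w)) (Cod C f) \<and>
              psh_map (FAr G w) (Dom C f) y = PAr (FOb G (Cod K w)) f y'},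
     Dom = (\<lambda>(w, f, y, y'). (Dom K w, Dom C f, y)),
     Cod = (\<lambda>(w, f, y, y'). (Cod K w, Cod C f, y')),
     Ide = (\<lambda>(k, X, y). (Ide K k, Ide C X, y, y)),
     Comp = (\<lambda>(w', f', z, z') (w, f, y, y'). (Comp K w' w, Comp C f' f, y, z'))\<rparr>"

lemma elements_Obj: "(k, X, y) \<in> Obj (elements K C S G) \<longleftrightarrow> k \<in> Obj K \<and> X \<in> S \<and> y \<in> POb (FOb G k) X"
  by (simp add: elements_def)

lemma elements_hom: "(w, f, s, s') \<in> hom (elements K C S G) (k, X, y) (k', X', y') \<longleftrightarrow>
    w \<in> hom K k k' \<and> f \<in> hom C X X' \<and> X \<in> S \<and> X' \<in> S \<and> s = y \<and> s' = y' \<and> y \<in> POb (FOb G k) X \<and> y' \<in> POb (FOb G k') X' \<and>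
    psh_map (FAr G w) X y = PAr (FOb G k') f y'"
  by (auto simp: elements_def hom_def)

lemma category_elements:
  assumes K: "category K" and C: "category C" and G: "is_functor K (PSh \<kappa> C) G" and S: "S \<subseteq> Obj C"
  shows "category (elements K C S G)"
proof -
  interpret K: category K by fact
  interpret C: category C by fact
  let ?T = "elements K C S G"
  have comp: "Comp ?T (w', f', z, z') (w, f, y, y') = (Comp K w' w, Comp C f' f, y, z')" for w' f' z z' w f y y'
    by (simp add: elements_def)
  have ide: "Ide ?T (k, X, y) = (Ide K k, Ide C X, y, y)" for k X y by (simp add: elements_def)
  have pre: "is_presheaf \<kappa> C (FOb G k)" if "k \<in> Obj K" for k
    using functor_Obj[OF G that] by (simp add: PSh_Obj small_presheaf_is_presheaf)
  show ?thesis
  proof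
    show "Dom ?T a \<in> Obj ?T" "Cod ?T a \<in> Obj ?T" if "a \<in> Arr ?T" for a
      using that K.Dom_in K.Cod_in by (auto simp: elements_def)
  next
    fix p assume p: "p \<in> Obj ?T"
    obtain k X y where *: "p = (k, X, y)" by (cases p)
    have kX: "k \<in> Obj K" "X \<in> S" "y \<in> POb (FOb G k) X" "X \<in> Obj C" using p S unfolding * elements_Obj by auto
    show "Ide ?T p \<in> hom ?T p p"
      unfolding * ide elements_hom
      using kX K.Ide_in C.Ide_in functor_Ide[OF G kX(1)] PSh_Ide_map[OF kX(4,3)] presheaf_Ide[OF pre[OF kX(1)] kX(4,3)] by simp
  next
    fix a p q assume a: "a \<in> hom ?T p q"
    obtain w f s s' k X y k' X' y' where *: "a = (w, f, s, s')" "p = (k, X, y)" "q = (k', X', y')" by (cases a; cases p; cases q)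
    show "Comp ?T a (Ide ?T p) = a" "Comp ?T (Ide ?T q) a = a"
      using a K.Comp_Ide C.Comp_Ide K.Ide_Comp C.Ide_Comp unfolding * comp ide elements_hom by auto
  next
    fix a p q b r assume a: "a \<in> hom ?T p q" and b: "b \<in> hom ?T q r"
    obtain w f s s' k X y k' X' y' w' f' t t' k'' X'' y'' where *: "a = (w, f, s, s')" "p = (k, X, y)" "q = (k', X', y')"
      "b = (w', f', t, t')" "r = (k'', X'', y'')" by (cases a; cases p; cases q; cases b; cases r)
    have h: "w \<in> hom K k k'" "f \<in> hom C X X'" "X \<in> S" "X' \<in> S" "s = y" "s' = y'" "y \<in> POb (FOb G k) X" "y' \<in> POb (FOb G k') X'"
      "psh_map (FAr G w) X y = PAr (FOb G k') f y'"
      and h': "w' \<in> hom K k' k''" "f' \<in> hom C X' X''" "X'' \<in> S" "t = y'" "t' = y''" "y'' \<in> POb (FOb G k'') X''"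
      "psh_map (FAr G w') X' y' = PAr (FOb G k'') f' y''"
      using a b unfolding * elements_hom by auto
    have k: "k'' \<in> Obj K" "X \<in> Obj C" using K.hom_Obj[OF h'(1)] C.hom_Obj[OF h(2)] by auto
    have "psh_map (FAr G (Comp K w' w)) X y = psh_map (FAr G w') X (PAr (FOb G k') f y')"
      using functor_Comp[OF G h(1) h'(1)] PSh_Comp(2)[OF C functor_hom[OF G h(1)] functor_hom[OF G h'(1)] k(2) h(7)] h(9) by simp
    also have "\<dots> = PAr (FOb G k'') (Comp C f' f) y''"
      using PSh_hom_nat[OF functor_hom[OF G h'(1)] h(2,8)] h'(7) presheaf_Comp[OF pre[OF k(1)] h(2) h'(2,6)] by simp
    finally show "Comp ?T b a \<in> hom ?T p r"
      unfolding * comp elements_hom using h h' K.Comp_in C.Comp_in by auto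
  next
    fix a b c p q r s assume abc: "a \<in> hom ?T p q" "b \<in> hom ?T q r" "c \<in> hom ?T r s"
    obtain w1 f1 s1 t1 w2 f2 s2 t2 w3 f3 s3 t3 where *: "a = (w1, f1, s1, t1)" "b = (w2, f2, s2, t2)" "c = (w3, f3, s3, t3)"
      by (cases a; cases b; cases c)
    obtain k1 X1 y1 k2 X2 y2 k3 X3 y3 k4 X4 y4 where **: "p = (k1, X1, y1)" "q = (k2, X2, y2)" "r = (k3, X3, y3)" "s = (k4, X4, y4)"
      by (cases p; cases q; cases r; cases s)
    show "Comp ?T c (Comp ?T b a) = Comp ?T (Comp ?T c b) a"
      using abc K.Comp_assoc C.Comp_assoc unfolding * ** comp elements_hom by auto
  qed
qed

text \<open>The objects \<open>((k, D0 i, z i), id)\<close> embed the chosen presentation of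
  \<open>G k\<close> into the comma category over \<open>k\<close>. Every other object has an arrow
  to one of them after restricting along a suitable arrow of \<open>C\<close>, so each test on the
  comma category is decided by the presentation over \<open>J\<close>.\<close>

lemma elements_kan_ext:
  fixes \<kappa> :: "'k rel" and C :: "('o, 'a) cat" and K :: "('l, 'n) cat"
  assumes K: "category K" and C: "category C" and G: "is_functor K (PSh \<kappa> C) G" and S: "S \<subseteq> Obj C"
    and dense: "\<And>k. k \<in> Obj K \<Longrightarrow> \<exists>(J :: ('k, 'k) cat) D z. category J \<and> is_functor J C D \<and> FOb D ` Obj J \<subseteq> S \<and>
      presented_by J C D (FOb G k) z"
  shows "presheaf_kan_ext (elements K C S G) K C \<kappa> \<lparr>FOb = fst, FAr = fst\<rparr>
    \<lparr>FOb = \<lambda>p. fst (snd p), FAr = \<lambda>a. fst (snd a)\<rparr> G (\<lambda>p. snd (snd p))"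
    (is "presheaf_kan_ext ?T K C \<kappa> ?F ?D G ?x")
proof -
  interpret K: category K by fact
  interpret C: category C by fact
  have T: "category ?T" by (rule category_elements[OF K C G S])
  have F: "is_functor ?T K ?F" and D: "is_functor ?T C ?D"
    using S unfolding is_functor_def by (auto simp: elements_def hom_def)
  have pre: "is_presheaf \<kappa> C (FOb G k)" if "k \<in> Obj K" for k
    using functor_Obj[OF G that] by (simp add: PSh_Obj small_presheaf_is_presheaf)
  have Gin: "psh_map (FAr G u) X y \<in> POb (FOb G k) X" if "u \<in> hom K k1 k" "X \<in> S" "y \<in> POb (FOb G k1) X" for u k1 k X y
    using PSh_hom_map[OF functor_hom[OF G that(1)]] that(2,3) S by blast
  have id: "psh_map (FAr G (Ide K k)) X y = y" if "k \<in> Obj K" "X \<in> S" "y \<in> POb (FOb G k) X" for k X y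
    using functor_Ide[OF G that(1)] PSh_Ide_map[of X C y] that S by auto
  show ?thesis
  proof (intro presheaf_kan_ext.intro presheaf_kan_ext_axioms.intro)
    show "category ?T" "category K" "category C" "is_functor ?T K ?F" "is_functor ?T C ?D" "is_functor K (PSh \<kappa> C) G"
      by fact+
    show "?x p \<in> POb (FOb G (FOb ?F p)) (FOb ?D p)" if "p \<in> Obj ?T" for p
      using that by (auto simp: elements_def)
    fix k assume k: "k \<in> Obj K"
    obtain J :: "('k, 'k) cat" and D0 z where J: "category J" and D0: "is_functor J C D0" and JS: "FOb D0 ` Obj J \<subseteq> S"
      and z: "presented_by J C D0 (FOb G k) z" using dense[OF k] by blast
    have zin: "z i \<in> POb (FOb G k) (FOb D0 i)" "FOb D0 i \<in> S" if "i \<in> Obj J" for i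
      using presented_by_in[OF z that] JS that by auto
    let ?X = "comma ?T K ?F k"
    let ?e = "\<lambda>(p, u). psh_map (FAr G u) (FOb ?D p) (?x p)"
    let ?cD = "comma_diagram ?D"
    show "presented_by ?X C ?cD (FOb G k) ?e"
    proof (rule presented_byI[OF C category_comma[OF T K F] functor_comma_diagram[OF D] pre[OF k]])
      show "?e q \<in> POb (FOb G k) (FOb ?cD q)" if q: "q \<in> Obj ?X" for q
        using q Gin by (cases q) (auto simp: elements_Obj)
      show "PAr (FOb G k) (FAr ?cD b) (?e q') = ?e q" if b: "b \<in> hom ?X q q'" for b q q'
      proof -
        obtain w f s t u0 k1 X1 y1 u1 k2 X2 y2 u2 where *: "b = ((w, f, s, t), u0)" "q = ((k1, X1, y1), u1)" "q' = ((k2, X2, y2), u2)"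
          by (cases b; cases q; cases q') (metis prod.exhaust)
        have h: "w \<in> hom K k1 k2" "f \<in> hom C X1 X2" "X1 \<in> S" "X2 \<in> S" "y1 \<in> POb (FOb G k1) X1" "y2 \<in> POb (FOb G k2) X2"
          "psh_map (FAr G w) X1 y1 = PAr (FOb G k2) f y2" "u2 \<in> hom K k2 k" "u1 = Comp K u2 w"
          using b unfolding * by (auto simp: comma_hom elements_hom)
        have "psh_map (FAr G u1) X1 y1 = psh_map (FAr G u2) X1 (PAr (FOb G k2) f y2)"
          using functor_Comp[OF G h(1,8)] PSh_Comp(2)[OF C functor_hom[OF G h(1)] functor_hom[OF G h(8)] _ h(5)] h(3,7,9) S by auto
        then show ?thesis using PSh_hom_nat[OF functor_hom[OF G h(8)] h(2,6)] by (simp add: *)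
      qed
      show "\<exists>q\<in>Obj ?X. \<exists>f\<in>hom C Y (FOb ?cD q). y = PAr (FOb G k) f (?e q)"
        if Y: "Y \<in> Obj C" and y: "y \<in> POb (FOb G k) Y" for Y y
      proof -
        obtain i f where i: "i \<in> Obj J" "f \<in> hom C Y (FOb D0 i)" "y = PAr (FOb G k) f (z i)" by (rule presented_by_ex[OF z Y y])
        \<comment> \<open>The object of the comma category that stands for the generator
          \<open>z i\<close>; its structure map is an identity, so it contributes \<open>z i\<close>
          itself.\<close>
        let ?q = "((k, FOb D0 i, z i), Ide K k)"
        have "?q \<in> Obj ?X" using i(1) k zin K.Ide_in by (simp add: elements_Obj)
        moreover have "?e ?q = z i" using id[OF k] zin[OF i(1)] by simp
        ultimately show ?thesis using i(2,3) by (intro bexI[of _ ?q] bexI[of _ f]) simp_all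
      qed
      fix \<phi> :: "('l \<times> 'o \<times> 'k) \<times> 'n \<Rightarrow> 'a \<Rightarrow> bool" and Y q f q' f'
      assume Y: "Y \<in> Obj C"
        and \<phi>: "\<And>b q q' f. b \<in> hom ?X q q' \<Longrightarrow> f \<in> hom C Y (FOb ?cD q) \<Longrightarrow>
          \<phi> q' (Comp C (FAr ?cD b) f) = \<phi> q f"
        and q: "q \<in> Obj ?X" "f \<in> hom C Y (FOb ?cD q)" "q' \<in> Obj ?X" "f' \<in> hom C Y (FOb ?cD q')"
        and eq: "PAr (FOb G k) f (?e q) = PAr (FOb G k) f' (?e q')"
      let ?\<psi> = "\<lambda>i g. \<phi> ((k, FOb D0 i, z i), Ide K k) g"
      have \<phi>': "\<phi> ((k2, X2, y2), u2) (Comp C f g) = \<phi> ((k1, X1, y1), Comp K u2 w) g"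
        if "w \<in> hom K k1 k2" "f \<in> hom C X1 X2" "X1 \<in> S" "X2 \<in> S" "y1 \<in> POb (FOb G k1) X1" "y2 \<in> POb (FOb G k2) X2"
          "psh_map (FAr G w) X1 y1 = PAr (FOb G k2) f y2" "u2 \<in> hom K k2 k" "g \<in> hom C Y X1" for w f g k1 k2 X1 X2 y1 y2 u2
        using \<phi>[of "((w, f, y1, y2), u2)" "((k1, X1, y1), Comp K u2 w)" "((k2, X2, y2), u2)" g] that
        by (simp add: comma_hom elements_hom)
      \<comment> \<open>Two arrows of the comma category are used. The first pushes
        \<open>y1\<close> along \<open>u\<close> into \<open>G k\<close>. The second is an arrow
        \<open>g\<close> of \<open>C\<close> exhibiting the result as a restriction of some
        \<open>z i\<close>; it lies in the category of elements because both of its ends are in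
        \<open>S\<close>.\<close>
      have norm: "\<exists>i\<in>Obj J. \<exists>g\<in>hom C Y (FOb D0 i). PAr (FOb G k) f (?e q) = PAr (FOb G k) g (z i) \<and> \<phi> q f = ?\<psi> i g"
        if q: "q \<in> Obj ?X" "f \<in> hom C Y (FOb ?cD q)" for q f
      proof -
        obtain k1 X1 y1 u where *: "q = ((k1, X1, y1), u)" by (cases q) (metis prod.exhaust)
        have h: "k1 \<in> Obj K" "X1 \<in> S" "y1 \<in> POb (FOb G k1) X1" "u \<in> hom K k1 k" "f \<in> hom C Y X1"
          using q unfolding * by (auto simp: elements_Obj)
        have X1: "X1 \<in> Obj C" using h(2) S by blast
        let ?y = "psh_map (FAr G u) X1 y1"
        have y: "?y \<in> POb (FOb G k) X1" by (rule Gin[OF h(4,2,3)])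
        obtain i g where i: "i \<in> Obj J" "g \<in> hom C X1 (FOb D0 i)" "?y = PAr (FOb G k) g (z i)"
          by (rule presented_by_ex[OF z X1 y])
        note zi = zin[OF i(1)]
        have "\<phi> q f = \<phi> ((k, X1, ?y), Ide K k) (Comp C (Ide C X1) f)"
          using \<phi>'[OF h(4) C.Ide_in[OF X1] h(2,2,3) y _ K.Ide_in[OF k] h(5)] presheaf_Ide[OF pre[OF k] X1 y] K.Ide_Comp[OF h(4)]
          by (simp add: *)
        also have "\<dots> = \<phi> ((k, X1, ?y), Comp K (Ide K k) (Ide K k)) f"
          using C.Ide_Comp[OF h(5)] K.Comp_Ide[OF K.Ide_in[OF k]] by simp
        also have "\<dots> = ?\<psi> i (Comp C g f)"
          using \<phi>'[OF K.Ide_in[OF k] i(2) h(2) zi(2) y zi(1) _ K.Ide_in[OF k] h(5)] id[OF k h(2) y] i(3) by simp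
        finally have "\<phi> q f = ?\<psi> i (Comp C g f)" .
        moreover have "PAr (FOb G k) f (?e q) = PAr (FOb G k) (Comp C g f) (z i)"
          using presheaf_Comp[OF pre[OF k] h(5) i(2) zi(1)] i(3) by (simp add: *)
        ultimately show ?thesis using i(1) C.Comp_in[OF h(5) i(2)] by blast
      qed
      obtain i g where i: "i \<in> Obj J" "g \<in> hom C Y (FOb D0 i)" "PAr (FOb G k) f (?e q) = PAr (FOb G k) g (z i)" "\<phi> q f = ?\<psi> i g"
        using norm[OF q(1,2)] by blast
      obtain i' g' where i': "i' \<in> Obj J" "g' \<in> hom C Y (FOb D0 i')" "PAr (FOb G k) f' (?e q') = PAr (FOb G k) g' (z i')"
        "\<phi> q' f' = ?\<psi> i' g'" using norm[OF q(3,4)] by blast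
      have "?\<psi> i g = ?\<psi> i' g'"
      proof (rule presented_by_factor[OF z Y _ i(1,2) i'(1,2)])
        show "PAr (FOb G k) g (z i) = PAr (FOb G k) g' (z i')" using i(3) i'(3) eq by simp
        fix v a a' h assume v: "v \<in> hom J a a'" and h: "h \<in> hom C Y (FOb D0 a)"
        have a: "a \<in> Obj J" "a' \<in> Obj J" using category.hom_Obj[OF J v] by auto
        note za = zin[OF a(1)] and za' = zin[OF a(2)]
        \<comment> \<open>The arrow with components \<open>Ide K k\<close>, \<open>FAr D0 v\<close>,
          \<open>z a\<close> and \<open>z a'\<close> belongs to the category of elements since
          \<open>z\<close> is compatible with \<open>v\<close>.\<close>
        show "?\<psi> a' (Comp C (FAr D0 v) h) = ?\<psi> a h"
          using \<phi>'[OF K.Ide_in[OF k] functor_hom[OF D0 v] za(2) za'(2) za(1) za'(1) _ K.Ide_in[OF k] h] id[OF k za(2,1)]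
            presented_by_eq[OF C J D0 pre[OF k] z v] K.Comp_Ide[OF K.Ide_in[OF k]] by simp
      qed
      then show "\<phi> q f = \<phi> q' f'" using i(4) i'(4) by simp
    qed
  qed
qed

text \<open>A functor that is bijective on objects and arrows induces one with the same property on
  each comma category, along which the presentations are carried. It serves to replace the category
  of elements by a copy in \<open>'k\<close>.\<close>

lemma presheaf_kan_ext_copy:
  fixes J :: "('j, 'i) cat" and J' :: "('p, 'q) cat" and K :: "('l, 'n) cat"
  assumes kan: "presheaf_kan_ext J K C \<kappa> F D G x"
    and J': "category J'" and I: "is_functor J' J I"
    and bo: "bij_betw (FOb I) (Obj J') (Obj J)" and ba: "bij_betw (FAr I) (Arr J') (Arr J)"
  shows "presheaf_kan_ext J' K C \<kappa> (fcomp F I) (fcomp D I) G (\<lambda>j. x (FOb I j))"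
proof -
  interpret presheaf_kan_ext J K C \<kappa> F D G x by (rule kan)
  have F': "is_functor J' K (fcomp F I)" and D': "is_functor J' C (fcomp D I)"
    by (rule functor_fcomp[OF I F], rule functor_fcomp[OF I D])
  have Icod: "FOb I (Cod J' v) = Cod J (FAr I v)" "FOb I (Dom J' v) = Dom J (FAr I v)" if "v \<in> Arr J'" for v
    using homD[OF functor_hom[OF I homI[OF that]]] by auto
  show ?thesis
  proof (intro presheaf_kan_ext.intro presheaf_kan_ext_axioms.intro)
    show "category J'" "category K" "category C" "is_functor J' K (fcomp F I)" "is_functor J' C (fcomp D I)"
      "is_functor K (PSh \<kappa> C) G" by (fact J' K.category_axioms C.category_axioms F' D' G)+
    show "x (FOb I j) \<in> POb (FOb G (FOb (fcomp F I) j)) (FOb (fcomp D I) j)" if "j \<in> Obj J'" for j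
      using x_in[OF functor_Obj[OF I that]] by simp
    fix k assume k: "k \<in> Obj K"
    let ?X = "comma J K F k" and ?X' = "comma J' K (fcomp F I) k"
    define I' :: "('p \<times> 'n, 'q \<times> 'n, 'j \<times> 'n, 'i \<times> 'n) func"
      where "I' = \<lparr>FOb = map_prod (FOb I) id, FAr = map_prod (FAr I) id\<rparr>"
    have fun': "is_functor ?X' ?X I'"
    proof (rule is_functorI)
      show "FOb I' q \<in> Obj ?X" if "q \<in> Obj ?X'" for q
        using that functor_Obj[OF I] by (cases q) (auto simp: I'_def)
      show "FAr I' (Ide ?X' q) = Ide ?X (FOb I' q)" if "q \<in> Obj ?X'" for q
        using that functor_Ide[OF I] by (cases q) (auto simp: I'_def comma_def)
    next
      fix b q q' assume b: "b \<in> hom ?X' q q'"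
      obtain v w j u j' u' where *: "b = (v, w)" "q = (j, u)" "q' = (j', u')" by (cases b; cases q; cases q')
      show "FAr I' b \<in> hom ?X (FOb I' q) (FOb I' q')"
        using b functor_hom[OF I] unfolding * by (auto simp: comma_hom I'_def)
    next
      fix b q q' b' q'' assume b: "b \<in> hom ?X' q q'" "b' \<in> hom ?X' q' q''"
      obtain v w j u j' u' v' w' j'' u'' where *: "b = (v, w)" "q = (j, u)" "q' = (j', u')" "b' = (v', w')" "q'' = (j'', u'')"
        by (cases b; cases q; cases q'; cases b'; cases q'')
      show "FAr I' (Comp ?X' b' b) = Comp ?X (FAr I' b') (FAr I' b)"
        using b functor_Comp[OF I] unfolding * comma_hom by (auto simp: I'_def comma_def)
    qed
    have bo': "bij_betw (FOb I') (Obj ?X') (Obj ?X)"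
      unfolding bij_betw_def
    proof
      show "inj_on (FOb I') (Obj ?X')"
        using bo by (auto simp: I'_def inj_on_def bij_betw_def comma_def)
      show "FOb I' ` Obj ?X' = Obj ?X"
      proof (intro equalityI subsetI)
        fix q assume "q \<in> Obj ?X"
        then obtain j u where q: "q = (j, u)" "j \<in> Obj J" "u \<in> hom K (FOb F j) k" by (cases q) auto
        moreover obtain i where "i \<in> Obj J'" "j = FOb I i" using q(2) bo unfolding bij_betw_def by blast
        ultimately show "q \<in> FOb I' ` Obj ?X'" by (intro image_eqI[of _ _ "(i, u)"]) (auto simp: I'_def)
      qed (use functor_Obj[OF fun'] in blast)
    qed
    have ba': "bij_betw (FAr I') (Arr ?X') (Arr ?X)"
      unfolding bij_betw_def
    proof
      show "inj_on (FAr I') (Arr ?X')"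
        using ba by (auto simp: I'_def inj_on_def bij_betw_def comma_def)
      show "FAr I' ` Arr ?X' = Arr ?X"
      proof (intro equalityI subsetI)
        fix b assume "b \<in> Arr ?X"
        then obtain v u where b: "b = (v, u)" "v \<in> Arr J" "u \<in> hom K (FOb F (Cod J v)) k" by (auto simp: comma_def)
        moreover obtain i where "i \<in> Arr J'" "v = FAr I i" using b(2) ba unfolding bij_betw_def by blast
        ultimately show "b \<in> FAr I' ` Arr ?X'"
          by (intro image_eqI[of _ _ "(i, u)"]) (auto simp: I'_def comma_def Icod)
      next
        fix b assume "b \<in> FAr I' ` Arr ?X'"
        then obtain b' where "b' \<in> Arr ?X'" "b = FAr I' b'" by blast
        then show "b \<in> Arr ?X" using homD[OF functor_hom[OF fun' homI]] by simp
      qed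
    qed
    have "presented_by ?X' C (fcomp (comma_diagram D) I') (FOb G k) (\<lambda>q. case FOb I' q of (j, u) \<Rightarrow> gen j u)"
      by (rule presented_by_copy[OF C.category_axioms category_comma[OF J.category_axioms K.category_axioms F]
            functor_comma_diagram[OF D] G_presheaf[OF k] category_comma[OF J' K.category_axioms F'] fun' bo' ba' presented[OF k]])
    moreover have "fcomp (comma_diagram D) I' = comma_diagram (fcomp D I)"
      by (auto simp: fcomp_def comma_diagram_def I'_def fun_eq_iff)
    moreover have "(\<lambda>q. case FOb I' q of (j, u) \<Rightarrow> gen j u) = (\<lambda>(j, u). psh_map (FAr G u) (FOb (fcomp D I) j) (x (FOb I j)))"
      by (auto simp: I'_def fun_eq_iff)
    ultimately show "presented_by ?X' C (comma_diagram (fcomp D I)) (FOb G k)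
        (\<lambda>(j, u). psh_map (FAr G u) (FOb (fcomp D I) j) (x (FOb I j)))" by simp
  qed
qed

text \<open>The presentations of the various \<open>G k\<close> need not be related to each other.
  Only the objects they use are collected, and the category of elements over this set supplies the
  arrows that connect them.\<close>

lemma presheaf_diagram_is_kan_ext:
  fixes \<kappa> :: "'k rel" and C :: "('o, 'a) cat" and K :: "('l, 'n) cat"
  assumes U: "universe_card \<kappa>" and C: "category C" "locally_small \<kappa> C"
    and K: "category K" "small \<kappa> (Obj K)" "small \<kappa> (Arr K)" and G: "is_functor K (PSh \<kappa> C) G"
  obtains J :: "('k, 'k) cat" and F D x where "small_category \<kappa> J" "presheaf_kan_ext J K C \<kappa> F D G x"
proof -
  have Gk: "small_presheaf \<kappa> C (FOb G k)" if "k \<in> Obj K" for k using functor_Obj[OF G that] by (simp add: PSh_Obj)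
  define dense where "dense k S \<longleftrightarrow> (\<exists>(J :: ('k, 'k) cat) D z. category J \<and> is_functor J C D \<and>
      FOb D ` Obj J \<subseteq> S \<and> presented_by J C D (FOb G k) z)" for k S
  have "\<exists>S. small \<kappa> S \<and> S \<subseteq> Obj C \<and> dense k S" if "k \<in> Obj K" for k
  proof -
    obtain J :: "('k, 'k) cat" and D z where "small_category \<kappa> J" "is_functor J C D" "presented_by J C D (FOb G k) z"
      using Gk[OF \<open>k \<in> Obj K\<close>] small_presheaf_iff[OF C(1)] by blast
    then show ?thesis
      using functor_Obj[of J C D] by (intro exI[of _ "FOb D ` Obj J"]) (auto simp: dense_def small_category_def small_image)
  qed
  then obtain S where S: "\<And>k. k \<in> Obj K \<Longrightarrow> small \<kappa> (S k) \<and> S k \<subseteq> Obj C \<and> dense k (S k)" by metis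
  define U where "U = (\<Union>k\<in>Obj K. S k)"
  have UC: "U \<subseteq> Obj C" and Usm: "small \<kappa> U" using S small_UN[OF assms(1) K(2)] unfolding U_def by blast+
  let ?T = "elements K C U G"
  have kan: "presheaf_kan_ext ?T K C \<kappa> \<lparr>FOb = fst, FAr = fst\<rparr>
    \<lparr>FOb = \<lambda>p. fst (snd p), FAr = \<lambda>a. fst (snd a)\<rparr> G (\<lambda>p. snd (snd p))"
  proof (rule elements_kan_ext[OF K(1) C(1) G UC])
    fix k assume k: "k \<in> Obj K"
    then obtain J :: "('k, 'k) cat" and D z where "category J" "is_functor J C D" "FOb D ` Obj J \<subseteq> S k"
      "presented_by J C D (FOb G k) z" using S unfolding dense_def by blast
    moreover have "S k \<subseteq> U" using k unfolding U_def by blast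
    ultimately show "\<exists>(J :: ('k, 'k) cat) D z. category J \<and> is_functor J C D \<and> FOb D ` Obj J \<subseteq> U \<and>
      presented_by J C D (FOb G k) z" by (meson order_trans)
  qed
  \<comment> \<open>Products of these two unions with \<open>K\<close> and \<open>U\<close> contain
    all objects and arrows of the category of elements. Local smallness of \<open>C\<close> enters
    through \<open>?H\<close>.\<close>
  let ?V = "\<Union>k\<in>Obj K. \<Union>X\<in>U. POb (FOb G k) X" and ?H = "\<Union>X\<in>U. \<Union>Y\<in>U. hom C X Y"
  have "small \<kappa> (POb (FOb G k) X)" if "k \<in> Obj K" "X \<in> U" for k X
    using presheaf_small[OF small_presheaf_is_presheaf[OF Gk[OF that(1)]]] that(2) UC by blast
  then have V: "small \<kappa> ?V" by (intro small_UN[OF assms(1)] K(2) Usm)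
  have "small \<kappa> (hom C X Y)" if "X \<in> U" "Y \<in> U" for X Y
    using C(2) that UC unfolding locally_small_def by blast
  then have H: "small \<kappa> ?H" by (intro small_UN[OF assms(1)] Usm)
  have b: "small \<kappa> (Obj K \<times> U \<times> ?V)" "small \<kappa> (Arr K \<times> ?H \<times> ?V \<times> ?V)"
    by (intro small_Sigma[OF assms(1)] K Usm V H)+
  have o: "Obj ?T \<subseteq> Obj K \<times> U \<times> ?V" by (auto simp: elements_def)
  have a: "Arr ?T \<subseteq> Arr K \<times> ?H \<times> ?V \<times> ?V"
    using category.Dom_in[OF K(1)] category.Cod_in[OF K(1)] by (fastforce simp: elements_def hom_def)
  have sm: "small \<kappa> (Obj ?T)" "small \<kappa> (Arr ?T)"
    by (rule small_subset[OF b(1) o], rule small_subset[OF b(2) a])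
  obtain J :: "('k, 'k) cat" and I where J: "small_category \<kappa> J" "is_functor J ?T I"
    "bij_betw (FOb I) (Obj J) (Obj ?T)" "bij_betw (FAr I) (Arr J) (Arr ?T)"
    by (rule category_copy[OF category_elements[OF K(1) C(1) G UC] sm])
  have "category J" using J(1) by (simp add: small_category_def)
  from presheaf_kan_ext_copy[OF kan this J(2-4)] show ?thesis using that[OF J(1)] by blast
qed


section \<open>Uniqueness of left Kan extensions\<close>

lemma is_nat_trans_Comp:
  assumes D: "category D" and C: "category C" and F: "is_functor C D F" and G: "is_functor C D G" and H: "is_functor C D H"
    and \<alpha>: "is_nat_trans C D F G \<alpha>" and \<beta>: "is_nat_trans C D G H \<beta>"
  shows "is_nat_trans C D F H (\<lambda>X\<in>Obj C. Comp D (\<beta> X) (\<alpha> X))"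
proof (rule is_nat_transI)
  interpret C: category C by fact
  interpret D: category D by fact
  note a = is_nat_trans_hom[OF \<alpha>] and b = is_nat_trans_hom[OF \<beta>]
  show "(\<lambda>X\<in>Obj C. Comp D (\<beta> X) (\<alpha> X)) X \<in> hom D (FOb F X) (FOb H X)" if "X \<in> Obj C" for X
    using D.Comp_in[OF a b] that by simp
  fix f X Y assume f: "f \<in> hom C X Y"
  have XY: "X \<in> Obj C" "Y \<in> Obj C" using C.hom_Obj[OF f] by auto
  show "Comp D ((\<lambda>X\<in>Obj C. Comp D (\<beta> X) (\<alpha> X)) Y) (FAr F f) = Comp D (FAr H f) ((\<lambda>X\<in>Obj C. Comp D (\<beta> X) (\<alpha> X)) X)"
    using D.Comp_assoc[OF functor_hom[OF F f] a[OF XY(2)] b[OF XY(2)]] is_nat_trans_nat[OF \<alpha> f] is_nat_trans_nat[OF \<beta> f]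
      D.Comp_assoc[OF a[OF XY(1)] functor_hom[OF G f] b[OF XY(2)]] D.Comp_assoc[OF a[OF XY(1)] b[OF XY(1)] functor_hom[OF H f]] XY
    by simp
qed simp

text \<open>The identity mediates between \<eta> and itself as well, and mediating transformations
  are unique.\<close>

lemma left_kan_ext_endo:
  assumes K: "category K" and C: "category C" and F: "is_functor J K F"
    and L: "is_left_kan_ext J K C F D L \<eta>"
    and \<alpha>: "is_nat_trans K C L L \<alpha>" and eq: "\<And>j. j \<in> Obj J \<Longrightarrow> Comp C (\<alpha> (FOb F j)) (\<eta> j) = \<eta> j"
    and k: "k \<in> Obj K"
  shows "\<alpha> k = Ide C (FOb L k)"
proof -
  interpret C: category C by fact
  interpret K: category K by fact
  have fL: "is_functor K C L" and \<eta>: "is_nat_trans J C D (fcomp L F) \<eta>"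
    and un: "\<exists>!\<delta>. is_nat_trans K C L L \<delta> \<and> (\<forall>j\<in>Obj J. Comp C (\<delta> (FOb F j)) (\<eta> j) = \<eta> j)"
    using L unfolding is_left_kan_ext_def by blast+
  have "is_nat_trans K C L L (\<lambda>k\<in>Obj K. Ide C (FOb L k))"
  proof (rule is_nat_transI)
    fix f X Y assume f: "f \<in> hom K X Y"
    show "Comp C ((\<lambda>k\<in>Obj K. Ide C (FOb L k)) Y) (FAr L f) = Comp C (FAr L f) ((\<lambda>k\<in>Obj K. Ide C (FOb L k)) X)"
      using K.hom_Obj[OF f] C.Ide_Comp[OF functor_hom[OF fL f]] C.Comp_Ide[OF functor_hom[OF fL f]] by simp
  qed (use C.Ide_in functor_Obj[OF fL] in simp_all)
  moreover have "Comp C ((\<lambda>k\<in>Obj K. Ide C (FOb L k)) (FOb F j)) (\<eta> j) = \<eta> j" if "j \<in> Obj J" for j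
    using C.Ide_Comp[OF is_nat_trans_hom[OF \<eta> that]] functor_Obj[OF F that] by simp
  ultimately have "\<alpha> = (\<lambda>k\<in>Obj K. Ide C (FOb L k))" using un \<alpha> eq by blast
  then show ?thesis using k by simp
qed

lemma left_kan_ext_unique:
  assumes K: "category K" and C: "category C" and F: "is_functor J K F"
    and L: "is_left_kan_ext J K C F D L \<eta>" and L': "is_left_kan_ext J K C F D L' \<eta>'"
  shows "\<exists>\<delta> \<delta>'. is_nat_trans K C L L' \<delta> \<and> is_nat_trans K C L' L \<delta>' \<and>
    (\<forall>k\<in>Obj K. Comp C (\<delta>' k) (\<delta> k) = Ide C (FOb L k) \<and> Comp C (\<delta> k) (\<delta>' k) = Ide C (FOb L' k))"
proof -
  interpret C: category C by fact
  have fL: "is_functor K C L" "is_nat_trans J C D (fcomp L F) \<eta>"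
    and fL': "is_functor K C L'" "is_nat_trans J C D (fcomp L' F) \<eta>'"
    using L L' unfolding is_left_kan_ext_def by blast+
  obtain \<delta> where \<delta>: "is_nat_trans K C L L' \<delta>" "\<forall>j\<in>Obj J. Comp C (\<delta> (FOb F j)) (\<eta> j) = \<eta>' j"
    using L fL' unfolding is_left_kan_ext_def by blast
  obtain \<delta>' where \<delta>': "is_nat_trans K C L' L \<delta>'" "\<forall>j\<in>Obj J. Comp C (\<delta>' (FOb F j)) (\<eta>' j) = \<eta> j"
    using L' fL unfolding is_left_kan_ext_def by blast
  have "Comp C (\<delta>' k) (\<delta> k) = Ide C (FOb L k)" if k: "k \<in> Obj K" for k
  proof -
    have "(\<lambda>k\<in>Obj K. Comp C (\<delta>' k) (\<delta> k)) k = Ide C (FOb L k)"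
    proof (rule left_kan_ext_endo[OF K C F L is_nat_trans_Comp[OF C K fL(1) fL'(1) fL(1) \<delta>(1) \<delta>'(1)] _ k])
      fix j assume j: "j \<in> Obj J"
      note Fj = functor_Obj[OF F j]
      show "Comp C ((\<lambda>k\<in>Obj K. Comp C (\<delta>' k) (\<delta> k)) (FOb F j)) (\<eta> j) = \<eta> j"
        using C.Comp_assoc[OF is_nat_trans_hom[OF fL(2) j, simplified] is_nat_trans_hom[OF \<delta>(1) Fj] is_nat_trans_hom[OF \<delta>'(1) Fj]]
          \<delta>(2) \<delta>'(2) j Fj by simp
    qed
    then show ?thesis using k by simp
  qed
  moreover have "Comp C (\<delta> k) (\<delta>' k) = Ide C (FOb L' k)" if k: "k \<in> Obj K" for k
  proof -
    have "(\<lambda>k\<in>Obj K. Comp C (\<delta> k) (\<delta>' k)) k = Ide C (FOb L' k)"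
    proof (rule left_kan_ext_endo[OF K C F L' is_nat_trans_Comp[OF C K fL'(1) fL(1) fL'(1) \<delta>'(1) \<delta>(1)] _ k])
      fix j assume j: "j \<in> Obj J"
      note Fj = functor_Obj[OF F j]
      show "Comp C ((\<lambda>k\<in>Obj K. Comp C (\<delta> k) (\<delta>' k)) (FOb F j)) (\<eta>' j) = \<eta>' j"
        using C.Comp_assoc[OF is_nat_trans_hom[OF fL'(2) j, simplified] is_nat_trans_hom[OF \<delta>'(1) Fj] is_nat_trans_hom[OF \<delta>(1) Fj]]
          \<delta>(2) \<delta>'(2) j Fj by simp
    qed
    then show ?thesis using k by simp
  qed
  ultimately show ?thesis using \<delta>(1) \<delta>'(1) by blast
qed

text \<open>Generators are pulled back along the inverse \<delta>', and a test for \<open>L'\<close>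
  becomes a test for \<open>L\<close> by composing with \<delta>.\<close>

lemma presented_by_nat_iso:
  fixes K :: "('l, 'n) cat" and C :: "('o, 'a) cat"
  assumes C: "category C" and K: "category K" and L: "is_functor K C L" and L': "is_functor K C L'"
    and Q: "is_presheaf \<kappa> C Q" and z: "presented_by K C L Q z"
    and \<delta>: "is_nat_trans K C L L' \<delta>" and \<delta>': "is_nat_trans K C L' L \<delta>'"
    and inv: "\<And>k. k \<in> Obj K \<Longrightarrow> Comp C (\<delta>' k) (\<delta> k) = Ide C (FOb L k)"
      "\<And>k. k \<in> Obj K \<Longrightarrow> Comp C (\<delta> k) (\<delta>' k) = Ide C (FOb L' k)"
  shows "presented_by K C L' Q (\<lambda>k. PAr Q (\<delta>' k) (z k))"
proof -
  interpret C: category C by fact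
  interpret K: category K by fact
  note d = is_nat_trans_hom[OF \<delta>] and d' = is_nat_trans_hom[OF \<delta>']
  note zin = presented_by_in[OF z]
  have act: "PAr Q f (PAr Q (\<delta>' k) (z k)) = PAr Q (Comp C (\<delta>' k) f) (z k)" if "k \<in> Obj K" "f \<in> hom C X (FOb L' k)" for k X f
    using presheaf_Comp[OF Q that(2) d'[OF that(1)] zin[OF that(1)]] by simp
  show ?thesis
  proof (rule presented_byI[OF C K L' Q])
    show "PAr Q (\<delta>' k) (z k) \<in> POb Q (FOb L' k)" if "k \<in> Obj K" for k
      by (rule presheaf_act[OF Q d'[OF that] zin[OF that]])
    show "PAr Q (FAr L' w) (PAr Q (\<delta>' k') (z k')) = PAr Q (\<delta>' k) (z k)" if w: "w \<in> hom K k k'" for w k k'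
    proof -
      have k: "k \<in> Obj K" "k' \<in> Obj K" using K.hom_Obj[OF w] by auto
      show ?thesis
        using act[OF k(2) functor_hom[OF L' w]] is_nat_trans_nat[OF \<delta>' w] presheaf_Comp[OF Q d'[OF k(1)] functor_hom[OF L w] zin[OF k(2)]]
          presented_by_eq[OF C K L Q z w] by simp
    qed
    show "\<exists>k\<in>Obj K. \<exists>f\<in>hom C X (FOb L' k). y = PAr Q f (PAr Q (\<delta>' k) (z k))" if X: "X \<in> Obj C" "y \<in> POb Q X" for X y
    proof -
      obtain k f where k: "k \<in> Obj K" "f \<in> hom C X (FOb L k)" "y = PAr Q f (z k)" by (rule presented_by_ex[OF z X])
      have "Comp C (\<delta> k) f \<in> hom C X (FOb L' k)" by (rule C.Comp_in[OF k(2) d[OF k(1)]])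
      moreover have "y = PAr Q (Comp C (\<delta> k) f) (PAr Q (\<delta>' k) (z k))"
        using act[OF k(1) calculation] C.Comp_assoc[OF k(2) d[OF k(1)] d'[OF k(1)]] inv(1)[OF k(1)] C.Ide_Comp[OF k(2)] k(3) by simp
      ultimately show ?thesis using k(1) by blast
    qed
    fix \<phi> :: "'l \<Rightarrow> 'a \<Rightarrow> bool" and X k f k' f'
    assume X: "X \<in> Obj C"
      and \<phi>: "\<And>w k k' f. w \<in> hom K k k' \<Longrightarrow> f \<in> hom C X (FOb L' k) \<Longrightarrow> \<phi> k' (Comp C (FAr L' w) f) = \<phi> k f"
      and k: "k \<in> Obj K" "f \<in> hom C X (FOb L' k)" "k' \<in> Obj K" "f' \<in> hom C X (FOb L' k')"
      and eq: "PAr Q f (PAr Q (\<delta>' k) (z k)) = PAr Q f' (PAr Q (\<delta>' k') (z k'))"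
    let ?\<psi> = "\<lambda>k g. \<phi> k (Comp C (\<delta> k) g)"
    have "?\<psi> k (Comp C (\<delta>' k) f) = ?\<psi> k' (Comp C (\<delta>' k') f')"
    proof (rule presented_by_factor[OF z X _ k(1) C.Comp_in[OF k(2) d'[OF k(1)]] k(3) C.Comp_in[OF k(4) d'[OF k(3)]]])
      show "PAr Q (Comp C (\<delta>' k) f) (z k) = PAr Q (Comp C (\<delta>' k') f') (z k')"
        using act[OF k(1,2)] act[OF k(3,4)] eq by simp
      fix w i i' g assume w: "w \<in> hom K i i'" and g: "g \<in> hom C X (FOb L i)"
      have i: "i \<in> Obj K" "i' \<in> Obj K" using K.hom_Obj[OF w] by auto
      have "Comp C (\<delta> i') (Comp C (FAr L w) g) = Comp C (FAr L' w) (Comp C (\<delta> i) g)"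
        using C.Comp_assoc[OF g functor_hom[OF L w] d[OF i(2)]] is_nat_trans_nat[OF \<delta> w]
          C.Comp_assoc[OF g d[OF i(1)] functor_hom[OF L' w]] by simp
      then show "?\<psi> i' (Comp C (FAr L w) g) = ?\<psi> i g" using \<phi>[OF w C.Comp_in[OF g d[OF i(1)]]] by simp
    qed
    moreover have "Comp C (\<delta> k) (Comp C (\<delta>' k) f) = f" if "k \<in> Obj K" "f \<in> hom C X (FOb L' k)" for k f
      using C.Comp_assoc[OF that(2) d'[OF that(1)] d[OF that(1)]] inv(2)[OF that(1)] C.Ide_Comp[OF that(2)] by simp
    ultimately show "\<phi> k f = \<phi> k' f'" using k by simp
  qed
qed

text \<open>Makes the image presheaf independent of the chosen left Kan extension, so that an
  arbitrary one may be exchanged for \<open>fcomp e G\<close>.\<close>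

lemma left_kan_ext_image_iso:
  assumes K: "category K" and C: "category C" and F: "is_functor J K F"
    and L: "is_left_kan_ext J K C F D L \<eta>" and L': "is_left_kan_ext J K C F D L' \<eta>'"
    and Q: "is_presheaf \<kappa> C Q" and iso: "presheaf_iso C (image_presheaf K C L) Q"
  shows "presheaf_iso C (image_presheaf K C L') Q"
proof -
  have fL: "is_functor K C L" and fL': "is_functor K C L'" using L L' unfolding is_left_kan_ext_def by blast+
  obtain \<delta> \<delta>' where \<delta>: "is_nat_trans K C L L' \<delta>" "is_nat_trans K C L' L \<delta>'"
    "\<forall>k\<in>Obj K. Comp C (\<delta>' k) (\<delta> k) = Ide C (FOb L k) \<and> Comp C (\<delta> k) (\<delta>' k) = Ide C (FOb L' k)"
    using left_kan_ext_unique[OF K C F L L'] by blast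
  obtain z where z: "presented_by K C L Q z" using iso image_presheaf_iso_iff[OF C K fL Q] by blast
  have "presented_by K C L' Q (\<lambda>k. PAr Q (\<delta>' k) (z k))"
    by (rule presented_by_nat_iso[OF C K fL fL' Q z \<delta>(1,2)]) (use \<delta>(3) in auto)
  then show ?thesis using image_presheaf_iso_iff[OF C K fL' Q] by blast
qed

section \<open>Partial evaluations and Kan extensions\<close>

theorem theorem5p10:
  fixes \<kappa> :: "'k rel"
    and C :: "('o, 'a) cat"
    and e :: "(('o, 'a, 'k) presheaf, ('o, 'a, 'k) psh_arr, 'o, 'a) func"
    and P Q :: "('o, 'a, 'k) presheaf"
  assumes "universe_card \<kappa>"
    and "category C"
    and "locally_small \<kappa> C"
    and "cocomplete \<kappa> C"
    and "is_weighted_colimit_choice \<kappa> C e"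
    and "P \<in> Obj (PSh \<kappa> C)"
    and "Q \<in> Obj (PSh \<kappa> C)"
  shows "(\<exists>(J :: ('k, 'k) cat) D.
            small_category \<kappa> J \<and> is_functor J C D \<and>
            presheaf_iso C (image_presheaf J C D) P \<and>
            (\<exists>(K :: ('k, 'k) cat) F.
               small_category \<kappa> K \<and> is_functor J K F \<and>
               (\<exists>L \<eta>. is_left_kan_ext J K C F D L \<eta> \<and>
                      presheaf_iso C (image_presheaf K C L) Q)))
         \<longleftrightarrow> (\<exists>\<Phi>. is_partial_evaluation \<kappa> C e P Q \<Phi>)"
  (is "?L \<longleftrightarrow> ?R")
proof -
  let ?A = "PSh \<kappa> C"
  note U = assms(1) and C = assms(2) and ls = assms(3)
  have P: "is_presheaf \<kappa> C P" and Q: "is_presheaf \<kappa> C Q"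
    using assms(6,7) by (auto simp: PSh_Obj small_presheaf_is_presheaf)
  obtain \<epsilon> where \<epsilon>: "weighted_colimits C \<kappa> e \<epsilon>"
    using weighted_colimits_exists[OF C assms(4,5)] by blast
  note ef = weighted_colimits.e_functor[OF \<epsilon>]
  note PC = category_PSh[OF C, of \<kappa>] and lsP = locally_small_PSh[OF U C]
  show ?thesis
  proof
    assume ?L
    then obtain J :: "('k, 'k) cat" and D and K :: "('k, 'k) cat" and F L \<eta>
      where sJ: "small_category \<kappa> J" and D: "is_functor J C D" and JP: "presheaf_iso C (image_presheaf J C D) P"
        and sK: "small_category \<kappa> K" and F: "is_functor J K F"
        and L: "is_left_kan_ext J K C F D L \<eta>" and LQ: "presheaf_iso C (image_presheaf K C L) Q" by blast
    have J: "category J" and K: "category K" "small \<kappa> (Obj K)" "small \<kappa> (Arr K)"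
      using sJ sK by (simp_all add: small_category_def)
    obtain G x where G: "presheaf_kan_ext J K C \<kappa> F D G x"
      using presheaf_kan_ext_exists[OF U C ls J K(1) F D small_comma[OF U sJ sK]] by blast
    note fG = presheaf_kan_ext.G[OF G]
    obtain y where "presented_by J C D P y" using JP image_presheaf_iso_iff[OF C J D P] by blast
    then obtain q where q: "psh_colimit K C G q P" using presheaf_kan_ext.presented_colimit[OF G P] by blast
    have "is_left_kan_ext J K C F D (fcomp e G) (\<lambda>j\<in>Obj J. \<epsilon> (FOb G (FOb F j)) (FOb D j) (x j))"
      by (rule presheaf_kan_colim.left_kan_ext[OF presheaf_kan_colim.intro[OF G \<epsilon>]])
    \<comment> \<open>The given \<open>L\<close> is known only by its universal property; uniqueness
      carries the isomorphism over to \<open>fcomp e G\<close>.\<close>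
    then have eGQ: "presheaf_iso C (image_presheaf K C (fcomp e G)) Q"
      by (rule left_kan_ext_image_iso[OF K(1) C F L _ Q LQ])
    \<comment> \<open>The image presheaf of \<open>G\<close> one level up, with small presheaves as
      objects. This is where local smallness of \<open>PSh\<close> is needed.\<close>
    obtain \<Phi> :: "(('o, 'a, 'k) presheaf, ('o, 'a, 'k) psh_arr, 'k) presheaf" and t
      where \<Phi>: "small_presheaf \<kappa> ?A \<Phi>" and t: "presented_by K ?A G \<Phi> t"
      by (rule image_presheaf_exists[OF U PC lsP K fG])
    note \<Phi>' = small_presheaf_is_presheaf[OF \<Phi>]
    have "presheaf_iso C (mu \<kappa> C \<Phi>) P" using q mu_iso_iff[OF C K(1) fG \<Phi>' t] by blast
    moreover have "presheaf_iso C (push ?A C e \<Phi>) Q"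
      using eGQ push_iso_iff[OF PC C K(1) fG ef \<Phi>' t] by blast
    ultimately show ?R unfolding is_partial_evaluation_def using \<Phi> by (auto simp: PSh_Obj)
  next
    assume ?R
    then obtain \<Phi> where \<Phi>: "small_presheaf \<kappa> ?A \<Phi>"
      and mu: "presheaf_iso C (mu \<kappa> C \<Phi>) P" and push: "presheaf_iso C (push ?A C e \<Phi>) Q"
      unfolding is_partial_evaluation_def by (auto simp: PSh_Obj)
    note \<Phi>' = small_presheaf_is_presheaf[OF \<Phi>]
    \<comment> \<open>One presenting diagram of \<Phi> supplies both the category \<open>K\<close>
      required by the first condition and the functor \<open>G\<close>.\<close>
    obtain K :: "('k, 'k) cat" and G t
      where sK: "small_category \<kappa> K" and fG: "is_functor K ?A G" and t: "presented_by K ?A G \<Phi> t"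
      using \<Phi> unfolding small_presheaf_iff[OF PC] by blast
    have K: "category K" "small \<kappa> (Obj K)" "small \<kappa> (Arr K)" using sK by (simp_all add: small_category_def)
    obtain q where q: "psh_colimit K C G q P" using mu mu_iso_iff[OF C K(1) fG \<Phi>' t] by blast
    have eGQ: "presheaf_iso C (image_presheaf K C (fcomp e G)) Q"
      using push push_iso_iff[OF PC C K(1) fG ef \<Phi>' t] by blast
    \<comment> \<open>Recovers from \<open>G\<close> a diagram \<open>D\<close> and a functor
      \<open>F\<close> of which it is the Kan extension; \<open>K\<close> stays as it is.\<close>
    obtain J :: "('k, 'k) cat" and F D x where sJ: "small_category \<kappa> J" and G: "presheaf_kan_ext J K C \<kappa> F D G x"
      by (rule presheaf_diagram_is_kan_ext[OF U C ls K fG])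
    have J: "category J" using sJ by (simp add: small_category_def)
    note F = presheaf_kan_ext.F[OF G] and D = presheaf_kan_ext.D[OF G]
    have "presheaf_iso C (image_presheaf J C D) P"
      using presheaf_kan_ext.colimit_presented[OF G P q] image_presheaf_iso_iff[OF C J D P] by blast
    moreover have "is_left_kan_ext J K C F D (fcomp e G) (\<lambda>j\<in>Obj J. \<epsilon> (FOb G (FOb F j)) (FOb D j) (x j))"
      by (rule presheaf_kan_colim.left_kan_ext[OF presheaf_kan_colim.intro[OF G \<epsilon>]])
    ultimately show ?L using sJ sK D F eGQ by blast
  qed
qed

end
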